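(* Let $b$ be a locally integrable function on $\mathbb{R}^n$ and $\vec b=(b,b)$. Let $0<\alpha<2n$ and let $I_\alpha$ be the bilinear fractional integral operator $$I_{\alpha}(f_{1},f_{2})(x)=\int_{\mathbb{R}^n}\int_{\mathbb{R}^n}\frac{f_{1}(y_{1})f_{2}(y_{2})}{\big(|x-y_{1}|+|x-y_{2}|\big)^{2n-\alpha}}\,dy_{1}dy_{2}.$$ Let $1<p_{1},p_{2}<\infty$ and $0<q<\infty$ with $1/q=1/p_{1}+1/p_{2}-\alpha/n$. Then the following statements are equivalent: (c1) $b\in {\rm BMO}$; (c2) $[b,I_{\alpha}]_{j}$ is a bounded operator from $L^{p_{1}}\times L^{p_{2}}$ to $L^{q}$ for $j=1,2$; (c3) $[b,I_{\alpha}]_{j}$ is a bounded operator from $L^{p_{1}}\times L^{p_{2}}$ to $L^{q,\infty}$ for $j=1,2$; (c4) $[\Pi\vec{b},I_{\alpha}]$ is a bounded operator from $L^{p_{1}}\times L^{p_{2}}$ to $L^{q}$; (c5) $[\Pi\vec{b},I_{\alpha}]$ is a bounded operator from $L^{p_{1}}\times L^{p_{2}}$ to $L^{q,\infty}$.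
   Context: All Lebesgue and weak Lebesgue spaces are on $\mathbb{R}^n$ with Lebesgue measure. ${\rm BMO}$ is the set of $f\in L^1_{\rm loc}(\mathbb{R}^n)$ with $\sup_Q\frac{1}{|Q|}\int_Q|f(x)-f_Q|\,dx<\infty$, the supremum over cubes $Q$ with sides parallel to the axes and $f_Q=\frac{1}{|Q|}\int_Q f$. For a bilinear operator $T$: $[b,T]_{1}(f_{1},f_{2})=bT(f_{1},f_{2})-T(bf_{1},f_{2})$, $[b,T]_{2}(f_{1},f_{2})=bT(f_{1},f_{2})-T(f_{1},bf_{2})$, and for $\vec b=(b_1,b_2)$, $[\Pi\vec{b},T](f_{1},f_{2})=[b_{2},[b_{1},T]_{1}]_{2}(f_{1},f_{2})=b_2[b_1,T]_1(f_1,f_2)-[b_1,T]_1(f_1,b_2f_2)$. *)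

theory Defs
  imports "HOL-Analysis.Analysis"
begin

definition locally_integrable :: "(real^'n \<Rightarrow> complex) \<Rightarrow> bool" where
  "locally_integrable f \<longleftrightarrow> (\<forall>K. compact K \<longrightarrow> set_integrable lebesgue K f)"

definition cubes :: "(real^'n) set set" where
  "cubes = {cbox a (\<chi> i. a $ i + l) | a l. l > 0}"

definition cube_mean :: "(real^'n) set \<Rightarrow> (real^'n \<Rightarrow> 'b) \<Rightarrow> 'b::{banach, second_countable_topology}" where
  "cube_mean Q f = (1 / measure lebesgue Q) *\<^sub>R (LINT x:Q|lebesgue. f x)"

definition BMO :: "(real^'n \<Rightarrow> complex) set" where
  "BMO = {f. locally_integrable f \<and>
     bdd_above ((\<lambda>Q. cube_mean Q (\<lambda>x. norm (f x - cube_mean Q f))) ` cubes)}"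

text \<open>For exponents below 1, and for the weak spaces, the functionals called norms here are
  only quasi-norms.\<close>

definition Lp :: "real \<Rightarrow> (real^'n \<Rightarrow> complex) set" where
  "Lp p = {f \<in> borel_measurable lebesgue. integrable lebesgue (\<lambda>x. norm (f x) powr p)}"

definition Lp_norm :: "real \<Rightarrow> (real^'n \<Rightarrow> complex) \<Rightarrow> real" where
  "Lp_norm p f = (LINT x|lebesgue. norm (f x) powr p) powr (1 / p)"

definition weak_Lp :: "real \<Rightarrow> (real^'n \<Rightarrow> complex) set" where
  "weak_Lp p = {f \<in> borel_measurable lebesgue.
     (\<forall>t>0. emeasure lebesgue {x. norm (f x) > t} < \<infinity>) \<and>
     bdd_above ((\<lambda>t. t * measure lebesgue {x. norm (f x) > t} powr (1 / p)) ` {0<..})}"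

definition weak_Lp_norm :: "real \<Rightarrow> (real^'n \<Rightarrow> complex) \<Rightarrow> real" where
  "weak_Lp_norm p f = (SUP t\<in>{0<..}. t * measure lebesgue {x. norm (f x) > t} powr (1 / p))"

text \<open>A bilinear operator sends a pair of functions to a partially defined function: the value
  is \<open>None\<close> at the points where the defining expression makes no sense. This keeps the
  convention that the Bochner integral of a non-integrable function is 0 from giving a meaning
  to divergent expressions.\<close>

type_synonym 'n bilinear_op =
  "(real^'n \<Rightarrow> complex) \<Rightarrow> (real^'n \<Rightarrow> complex) \<Rightarrow> real^'n \<Rightarrow> complex option"

definition frac_kernel ::
    "real \<Rightarrow> (real^'n \<Rightarrow> complex) \<Rightarrow> (real^'n \<Rightarrow> complex) \<Rightarrow> real^'n \<Rightarrow> (real^'n) \<times> (real^'n) \<Rightarrow> complex" where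
  "frac_kernel \<alpha> f1 f2 x = (\<lambda>(y1, y2).
     f1 y1 * f2 y2 / of_real ((norm (x - y1) + norm (x - y2)) powr (2 * real CARD('n) - \<alpha>)))"

definition frac_int :: "real \<Rightarrow> ('n::finite) bilinear_op" where
  "frac_int \<alpha> f1 f2 x =
     (if integrable (lebesgue \<Otimes>\<^sub>M lebesgue) (frac_kernel \<alpha> f1 f2 x)
      then Some (LINT y|(lebesgue \<Otimes>\<^sub>M lebesgue). frac_kernel \<alpha> f1 f2 x y) else None)"

definition commutator1 ::
    "(real^'n \<Rightarrow> complex) \<Rightarrow> ('n::finite) bilinear_op \<Rightarrow> 'n bilinear_op" where
  "commutator1 b T f1 f2 x =
     (case (T f1 f2 x, T (\<lambda>y. b y * f1 y) f2 x) of
        (Some u, Some v) \<Rightarrow> Some (b x * u - v) | _ \<Rightarrow> None)"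

definition commutator2 ::
    "(real^'n \<Rightarrow> complex) \<Rightarrow> ('n::finite) bilinear_op \<Rightarrow> 'n bilinear_op" where
  "commutator2 b T f1 f2 x =
     (case (T f1 f2 x, T f1 (\<lambda>y. b y * f2 y) x) of
        (Some u, Some v) \<Rightarrow> Some (b x * u - v) | _ \<Rightarrow> None)"

definition iterated_commutator ::
    "(real^'n \<Rightarrow> complex) \<times> (real^'n \<Rightarrow> complex) \<Rightarrow> ('n::finite) bilinear_op \<Rightarrow> 'n bilinear_op" where
  "iterated_commutator = (\<lambda>(b1, b2) T. commutator2 b2 (commutator1 b1 T))"

text \<open>Boundedness from \<open>Lp p1 \<times> Lp p2\<close> into a space \<open>Y\<close> with (quasi-)norm \<open>N\<close>: for every pair of
  functions the image is defined almost everywhere (and set to 0 on the exceptional null set),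
  lies in \<open>Y\<close>, and satisfies the norm inequality.\<close>

definition bounded_bilinear_op ::
    "real \<Rightarrow> real \<Rightarrow> (real^'n \<Rightarrow> complex) set \<Rightarrow> ((real^'n \<Rightarrow> complex) \<Rightarrow> real)
     \<Rightarrow> ('n::finite) bilinear_op \<Rightarrow> bool" where
  "bounded_bilinear_op p1 p2 Y N T \<longleftrightarrow>
     (\<exists>C. \<forall>f1\<in>Lp p1. \<forall>f2\<in>Lp p2.
        (AE x in lebesgue. T f1 f2 x \<noteq> None) \<and>
        (let g = (\<lambda>x. case T f1 f2 x of None \<Rightarrow> 0 | Some z \<Rightarrow> z) in
         g \<in> Y \<and> N g \<le> C * Lp_norm p1 f1 * Lp_norm p2 f2))"

abbreviation bounded_to_Lp :: "real \<Rightarrow> real \<Rightarrow> real \<Rightarrow> ('n::finite) bilinear_op \<Rightarrow> bool" where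
  "bounded_to_Lp p1 p2 q \<equiv> bounded_bilinear_op p1 p2 (Lp q) (Lp_norm q)"

abbreviation bounded_to_weak_Lp :: "real \<Rightarrow> real \<Rightarrow> real \<Rightarrow> ('n::finite) bilinear_op \<Rightarrow> bool" where
  "bounded_to_weak_Lp p1 p2 q \<equiv> bounded_bilinear_op p1 p2 (weak_Lp q) (weak_Lp_norm q)"

end

theory Submission
  imports Defs "HOL-Real_Asymp.Real_Asymp"
begin

text \<open>
  If \<open>b\<close> is in BMO, choose \<open>\<alpha> = a1 + a2\<close> with \<open>a1\<close>, \<open>a2\<close> proportional to \<open>1/p1\<close>, \<open>1/p2\<close>. The bilinear kernel is
  at most \<open>\<bar>x - y1\<bar>\<^bsup>a1 - n\<^esup> \<bar>x - y2\<bar>\<^bsup>a2 - n\<^esup>\<close>, so that every commutator is dominated by a product of two linear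
  potentials, with or without a factor \<open>\<bar>b x - b y\<bar>\<close> under the integral, and Hoelder's inequality (valid for
  every \<open>q > 0\<close>) reduces the claim to linear bounds from \<open>L\<^bsup>p\<^esup>\<close> to \<open>L\<^bsup>q\<^esup>\<close> with \<open>1 < p < q\<close>. There duality is
  available: \<open>\<bar>b x - b y\<bar>\<close> is split into the oscillation at \<open>y\<close> over a ball around \<open>x\<close> and the oscillation at
  \<open>x\<close> over a ball around \<open>y\<close>, and in the dual form both halves are the same operator. That operator is bounded by
  Hedberg's argument, using the John-Nirenberg inequality and the Hardy-Littlewood maximal theorem.

  Conversely, for \<open>x\<close> in a cube far away from \<open>Q\<close> the kernel is almost constant on \<open>Q \<times> Q\<close>. Testing on
  the indicator of \<open>Q\<close> and on a mean-zero function that pairs with \<open>b\<close> to its mean oscillation on \<open>Q\<close>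
  gives two inequalities at a common point \<open>x\<close> whose error terms can be absorbed. The product structure
  of the iterated commutator turns both test integrals into squares.
\<close>

section \<open>Powers of extended nonnegative reals\<close>

text \<open>For sufficiency the obstacle is the range \<open>q \<le> 1\<close>: the target is then
  only quasi-normed and has no usable dual, so duality can enter only after the bilinear operator
  has been cut into linear factors whose target exponents exceed 1. On the linear side functions
  take values in \<open>ennreal\<close>, so Tonelli and Hoelder apply without integrability
  conditions; that the potentials are finite almost everywhere then yields, as a by-product, that
  the commutators are defined almost everywhere. Scales are written as \<open>exp u\<close>: kernels
  become superpositions of indicators of balls with exponential weights, and Hedberg's optimisation
  over the radius becomes a balance of two exponentials. For necessity the obstacle is that the
  value \<open>b x\<close> at the point of evaluation is not under control. Its distance from the
  mean on \<open>Q\<close> is a second unknown besides the mean oscillation; the two can be played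
  off against each other only if both tests are evaluated at the same \<open>x\<close>. Weak bounds
  supply such a point because each test is bad only on a small part of the distant cube.\<close>

definition epow :: "ennreal \<Rightarrow> real \<Rightarrow> ennreal" where
  "epow x p = (if x = \<infinity> then \<infinity> else ennreal (enn2real x powr p))"

abbreviation enorm :: "'a::real_normed_vector \<Rightarrow> ennreal" where
  "enorm z \<equiv> ennreal (norm z)"

abbreviation pow_integral :: "real \<Rightarrow> ('a::euclidean_space \<Rightarrow> ennreal) \<Rightarrow> ennreal" where
  "pow_integral p F \<equiv> \<integral>\<^sup>+x. epow (F x) p \<partial>lborel"

abbreviation ball_vol :: "'a::euclidean_space \<Rightarrow> real \<Rightarrow> ennreal" where
  "ball_vol x r \<equiv> emeasure lborel (cball x r)"

abbreviation ball_integral :: "('a::euclidean_space \<Rightarrow> ennreal) \<Rightarrow> 'a \<Rightarrow> real \<Rightarrow> ennreal" where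
  "ball_integral F x r \<equiv> \<integral>\<^sup>+y. F y * indicator (cball x r) y \<partial>lborel"

lemma epow_ennreal: "0 \<le> x \<Longrightarrow> epow (ennreal x) p = ennreal (x powr p)"
  by (simp add: epow_def)

lemma epow_top [simp]: "epow \<infinity> p = \<infinity>" "epow top p = \<infinity>"
  by (simp_all add: epow_def)

lemma epow_0 [simp]: "epow 0 p = 0"
  by (simp add: epow_def)

lemma epow_eq_top_iff [simp]: "epow x p = \<infinity> \<longleftrightarrow> x = \<infinity>" "epow x p = top \<longleftrightarrow> x = top"
  by (simp_all add: epow_def)

lemma epow_less_top_iff [simp]: "epow x p < \<infinity> \<longleftrightarrow> x < \<infinity>" "epow x p < top \<longleftrightarrow> x < top"
  by (simp_all add: epow_def less_top[symmetric])

lemma epow_eq_0_iff [simp]: "epow x p = 0 \<longleftrightarrow> x = 0"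
  by (cases x) (auto simp: epow_ennreal top_unique ennreal_eq_0_iff)

lemma epow_1 [simp]: "epow x 1 = x"
  by (cases x) (auto simp: epow_ennreal)

lemma epow_one [simp]: "epow 1 p = 1"
  using epow_ennreal[of 1 p] by simp

lemma epow_mono: "x \<le> y \<Longrightarrow> 0 \<le> p \<Longrightarrow> epow x p \<le> epow y p"
  by (cases x; cases y) (auto simp: epow_ennreal top_unique intro!: ennreal_leI powr_mono2)

lemma epow_mult: "0 < p \<Longrightarrow> epow (x * y) p = epow x p * epow y p"
  by (cases x; cases y)
     (auto simp: epow_ennreal powr_mult simp flip: ennreal_mult,
      auto simp: ennreal_mult_top ennreal_top_mult epow_ennreal ennreal_eq_0_iff)

lemma epow_epow: "epow (epow x p) r = epow x (p * r)"
  by (cases x) (auto simp: epow_ennreal powr_powr)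

text \<open>No sign condition is imposed on the exponents, because \<open>0\<close> and
  \<open>\<infinity>\<close> are fixed by every \<open>epow _ p\<close> and are idempotent under
  multiplication. Factors such as \<open>epow x (q - 1)\<close> can thus be split off without cases
  on the base.\<close>

lemma epow_add: "epow x (p + r) = epow x p * epow x r"
  by (cases x) (auto simp: epow_ennreal powr_add ennreal_mult)

lemma epow_measurable [measurable]:
  assumes [measurable]: "f \<in> borel_measurable M"
  shows "(\<lambda>x. epow (f x) p) \<in> borel_measurable M"
  unfolding epow_def by measurable

lemma ennreal_Young:
  assumes "1 < p" "1 < r" "1 / p + 1 / r = 1"
  shows "x * y \<le> epow x p / ennreal p + epow y r / ennreal r"
proof (cases "x = \<infinity> \<or> y = \<infinity>")
  case True
  then show ?thesis
    using assms by (auto simp: ennreal_top_divide)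
next
  case False
  then obtain a c where "x = ennreal a" "y = ennreal c" "0 \<le> a" "0 \<le> c"
    by (metis ennreal_cases infinity_ennreal_def)
  with Youngs_inequality[of p r a c] assms show ?thesis
    by (simp add: epow_ennreal divide_ennreal flip: ennreal_mult ennreal_plus)
qed

text \<open>Both functions are normalised by their norms \<open>A\<close> and \<open>B\<close>, and
  Young's inequality is integrated. The normalisation needs finite nonzero integrals: if one
  vanishes, so does the product almost everywhere; if neither vanishes and one is infinite, the
  right side is infinite.\<close>

lemma nn_integral_Holder:
  assumes [measurable]: "f \<in> borel_measurable M" "g \<in> borel_measurable M"
  assumes p: "1 < p" and r: "1 < r" and pr: "1 / p + 1 / r = 1"
  shows "(\<integral>\<^sup>+x. f x * g x \<partial>M) \<le>
    epow (\<integral>\<^sup>+x. epow (f x) p \<partial>M) (1 / p) * epow (\<integral>\<^sup>+x. epow (g x) r \<partial>M) (1 / r)"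
    (is "_ \<le> epow ?I _ * epow ?J _")
proof -
  consider "?I = 0 \<or> ?J = 0" | "?I \<noteq> 0" "?J \<noteq> 0" "?I = \<infinity> \<or> ?J = \<infinity>"
    | "?I \<noteq> 0" "?J \<noteq> 0" "?I \<noteq> \<infinity>" "?J \<noteq> \<infinity>" by blast
  then show ?thesis
  proof cases
    case 1
    then have "AE x in M. f x * g x = 0"
      by (auto simp: nn_integral_0_iff_AE elim!: eventually_mono)
    then have "(\<integral>\<^sup>+x. f x * g x \<partial>M) = 0"
      by (simp add: nn_integral_0_iff_AE)
    then show ?thesis by simp
  next
    case 2
    then show ?thesis by (auto simp: ennreal_mult_eq_top_iff)
  next
    case 3
    define A where "A = epow ?I (1 / p)"
    define B where "B = epow ?J (1 / r)"
    have AB: "A \<noteq> 0" "B \<noteq> 0" "A \<noteq> top" "B \<noteq> top" using 3 by (auto simp: A_def B_def)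
    have A: "epow A p = ?I" and B: "epow B r = ?J"
      using p r by (auto simp: A_def B_def epow_epow)
    have *: "epow (u / C) s = epow u s / epow C s" if "C \<noteq> 0" "C \<noteq> top" "0 < s" for u C s
    proof -
      have "epow (u / C) s * epow C s = epow (u / C * C) s"
        using that by (simp add: epow_mult)
      also have "u / C * C = u"
        using that by (simp add: ennreal_divide_times less_top ennreal_mult_divide_eq mult_divide_eq_ennreal)
      finally show ?thesis
        using that by (metis epow_eq_0_iff epow_eq_top_iff(2) mult_divide_eq_ennreal)
    qed
    have "f x * g x \<le> A * B * (epow (f x) p / ?I / ennreal p + epow (g x) r / ?J / ennreal r)" for x
    proof -
      have "f x * g x = (A * B) * ((f x / A) * (g x / B))"
        using AB by (smt (verit) ennreal_divide_times mult.assoc mult.commute mult_divide_eq_ennreal ennreal_times_divide)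
      also have "\<dots> \<le> (A * B) * (epow (f x / A) p / ennreal p + epow (g x / B) r / ennreal r)"
        by (intro mult_left_mono ennreal_Young p r pr) auto
      finally show ?thesis
        using p r AB by (simp add: * A B)
    qed
    then have "(\<integral>\<^sup>+x. f x * g x \<partial>M) \<le>
       (\<integral>\<^sup>+x. A * B * (epow (f x) p / ?I / ennreal p + epow (g x) r / ?J / ennreal r) \<partial>M)"
      by (intro nn_integral_mono)
    also have "\<dots> = A * B * (?I / ?I / ennreal p + ?J / ?J / ennreal r)"
      by (simp add: nn_integral_cmult nn_integral_add nn_integral_divide)
    also have "?I / ?I / ennreal p + ?J / ?J / ennreal r = ennreal (1 / p + 1 / r)"
      using 3 p r by (simp add: ennreal_divide_self less_top divide_ennreal flip: ennreal_plus ennreal_1)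
    finally show ?thesis by (simp add: pr A_def B_def)
  qed
qed

text \<open>The exponents \<open>q1 / q\<close> and \<open>q2 / q\<close> are conjugate and exceed 1
  whatever the size of \<open>q\<close>, so the classical inequality applies to the
  \<open>q\<close>-th powers.\<close>

lemma nn_integral_Holder_powr:
  assumes [measurable]: "f \<in> borel_measurable M" "g \<in> borel_measurable M"
  assumes q: "0 < q" "0 < q1" "0 < q2" and qq: "1 / q = 1 / q1 + 1 / q2"
  shows "(\<integral>\<^sup>+x. epow (f x * g x) q \<partial>M) \<le>
    epow (\<integral>\<^sup>+x. epow (f x) q1 \<partial>M) (q / q1) * epow (\<integral>\<^sup>+x. epow (g x) q2 \<partial>M) (q / q2)"
proof -
  have "q / q1 + q / q2 = q * (1 / q)" unfolding qq by (simp add: distrib_left)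
  then have eq: "q / q1 + q / q2 = 1" using q by simp
  have "q / q1 > 0" "q / q2 > 0" using q by auto
  with eq have "q / q1 < 1" "q / q2 < 1" by linarith+
  then have 1: "1 < q1 / q" "1 < q2 / q" using q by (auto simp: field_simps)
  have "(\<integral>\<^sup>+x. epow (f x * g x) q \<partial>M) = (\<integral>\<^sup>+x. epow (f x) q * epow (g x) q \<partial>M)"
    using q by (simp add: epow_mult)
  also have "\<dots> \<le> epow (\<integral>\<^sup>+x. epow (epow (f x) q) (q1 / q) \<partial>M) (1 / (q1 / q)) *
      epow (\<integral>\<^sup>+x. epow (epow (g x) q) (q2 / q) \<partial>M) (1 / (q2 / q))"
    using 1 eq by (intro nn_integral_Holder) auto
  finally show ?thesis using q by (simp add: epow_epow)
qed

text \<open>Testing against truncations of \<open>h\<^bsup>q - 1\<^esup>\<close> makes the quantity that is divided out finite.\<close>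

lemma nn_integral_epow_le_dual:
  fixes h :: "'a::euclidean_space \<Rightarrow> ennreal"
  assumes [measurable]: "h \<in> borel_measurable borel"
  assumes q: "1 < q" "1 < q'" "1 / q + 1 / q' = 1"
    and dual: "\<And>g. g \<in> borel_measurable borel \<Longrightarrow>
      (\<integral>\<^sup>+x. g x * h x \<partial>lborel) \<le> K * epow (pow_integral q' g) (1 / q')"
  shows "pow_integral q h \<le> epow K q"
proof -
  define H where "H N x = (if x \<in> ball 0 (real N) then min (h x) (of_nat N) else 0)" for N :: nat and x
  have "H N = (\<lambda>x. min (h x) (of_nat N) * indicator (ball 0 (real N)) x)" for N
    by (auto simp: H_def fun_eq_iff)
  moreover have [measurable]: "ball (0::'a) (real N) \<in> sets borel" for N by simp
  ultimately have [measurable]: "H N \<in> borel_measurable borel" for N by simp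
  have Hh: "H N x \<le> h x" for N x by (auto simp: H_def)
  have fin: "pow_integral q (H N) < \<infinity>" for N
  proof -
    have "pow_integral q (H N) \<le> (\<integral>\<^sup>+x. epow (of_nat N) q * indicator (ball (0::'a) (real N)) x \<partial>lborel)"
      using q by (intro nn_integral_mono) (auto simp: H_def intro!: epow_mono)
    also have "\<dots> = epow (of_nat N) q * emeasure lborel (ball 0 (real N) :: 'a set)"
      by (simp add: nn_integral_cmult_indicator)
    also have "\<dots> < \<infinity>"
      using emeasure_lborel_ball_finite[of "0::'a" "real N"]
      by (auto simp: ennreal_mult_less_top ennreal_of_nat_eq_real_of_nat)
    finally show ?thesis .
  qed
  \<comment> \<open>The first identity makes the \<open>q'\<close>-integral of the test function
    equal to the \<open>q\<close>-integral of the truncation itself; the second recovers that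
    integral from the power left after the division.\<close>
  have qq: "q' * (q - 1) = q" "(1 - 1 / q') * q = 1" using q by (auto simp: field_simps)
  have bd: "pow_integral q (H N) \<le> epow K q" (is "?I \<le> _") for N
  proof (cases "?I = 0")
    case False
    have "?I = (\<integral>\<^sup>+x. epow (H N x) (q - 1) * H N x \<partial>lborel)"
      using epow_add[of _ "q - 1" 1] by simp
    also have "\<dots> \<le> (\<integral>\<^sup>+x. epow (H N x) (q - 1) * h x \<partial>lborel)"
      by (intro nn_integral_mono mult_left_mono Hh) auto
    also have "\<dots> \<le> K * epow ?I (1 / q')"
      using dual[of "\<lambda>x. epow (H N x) (q - 1)"] qq by (simp add: epow_epow mult.commute)
    finally have 1: "?I \<le> K * epow ?I (1 / q')" .
    have "?I = epow ?I (1 - 1 / q') * epow ?I (1 / q')"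
      by (simp flip: epow_add)
    with 1 have "epow ?I (1 / q') * epow ?I (1 - 1 / q') \<le> epow ?I (1 / q') * K"
      by (simp add: mult.commute)
    then have "epow ?I (1 - 1 / q') \<le> K"
      using False fin[of N] by (subst (asm) ennreal_mult_le_mult_iff) auto
    then have "epow (epow ?I (1 - 1 / q')) q \<le> epow K q"
      using q by (intro epow_mono) auto
    then show ?thesis using qq by (simp add: epow_epow)
  qed simp
  have mono: "H N x \<le> H (Suc N) x" for N x
    by (auto simp: H_def intro!: min.coboundedI2 add_increasing)
  have sup: "(SUP N. epow (H N x) q) = epow (h x) q" for x
  proof (rule antisym)
    show "(SUP N. epow (H N x) q) \<le> epow (h x) q"
      using q by (intro SUP_least epow_mono Hh) auto
    obtain N0 :: nat where N0: "norm x < real N0" using reals_Archimedean2 by blast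
    show "epow (h x) q \<le> (SUP N. epow (H N x) q)"
    proof (cases "h x = \<infinity>")
      case True
      have "of_nat N \<le> (SUP N. epow (H N x) q)" for N :: nat
      proof -
        \<comment> \<open>At least \<open>N0\<close>, so that \<open>x\<close> lies in the ball, and
          at least 1, so that \<open>M\<close> is at most \<open>M powr q\<close>.\<close>
        define M where "M = max (max N N0) 1"
        have "H M x = of_nat M"
          using N0 True by (auto simp: H_def M_def)
        moreover have "ennreal (real M) \<le> epow (ennreal (real M)) q"
          using q powr_mono[of 1 q "real M"] by (auto simp: epow_ennreal M_def intro!: ennreal_leI)
        ultimately have "of_nat M \<le> epow (H M x) q"
          by (simp add: ennreal_of_nat_eq_real_of_nat)
        moreover have "(of_nat N :: ennreal) \<le> of_nat M" by (simp add: M_def)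
        ultimately show ?thesis by (meson SUP_upper2 UNIV_I order_trans)
      qed
      then have sup_top: "(SUP N. epow (H N x) q) = \<infinity>"
        by (metis ennreal_SUP_of_nat_eq_top SUP_least infinity_ennreal_def top_unique)
      show ?thesis unfolding sup_top by simp
    next
      case False
      then obtain a where a: "h x = ennreal a" "0 \<le> a" by (metis ennreal_cases infinity_ennreal_def)
      obtain N1 :: nat where N1: "a < real N1" using reals_Archimedean2 by blast
      define M where "M = max N0 N1"
      have "H M x = h x"
        using N0 N1 a by (auto simp: H_def M_def ennreal_of_nat_eq_real_of_nat ennreal_leI min_def)
      then show ?thesis by (metis SUP_upper UNIV_I)
    qed
  qed
  have "pow_integral q h = (SUP N. \<integral>\<^sup>+x. epow (H N x) q \<partial>lborel)"
    unfolding sup[symmetric]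
    using q mono by (intro nn_integral_monotone_convergence_SUP incseq_SucI le_funI epow_mono) auto
  also have "\<dots> \<le> epow K q" by (intro SUP_least bd)
  finally show ?thesis .
qed

section \<open>Exponential integrals and layer-cake formulas\<close>

lemma nn_integral_exp_minus_atLeast:
  assumes "0 < s"
  shows "(\<integral>\<^sup>+u. ennreal (exp (- s * u)) * indicator {a..} u \<partial>lborel) = ennreal (exp (- s * a) / s)"
proof -
  have "((\<lambda>u. - exp (- s * u) / s) \<longlongrightarrow> - 0 / s) at_top"
    by (intro tendsto_intros filterlim_compose[OF exp_at_bot] filterlim_tendsto_neg_mult_at_bot[where c="-s"])
       (use assms in \<open>auto simp: filterlim_ident\<close>)
  then have "(\<integral>\<^sup>+u. ennreal (exp (- s * u)) * indicator {a..} u \<partial>lborel) = ennreal (0 - (- exp (- s * a) / s))"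
    using assms by (intro nn_integral_FTC_atLeast[where F="\<lambda>u. - exp (- s * u) / s"])
      (auto intro!: derivative_eq_intros)
  then show ?thesis by simp
qed

lemma nn_integral_exp_atMost:
  assumes "0 < s"
  shows "(\<integral>\<^sup>+u. ennreal (exp (s * u)) * indicator {..a} u \<partial>lborel) = ennreal (exp (s * a) / s)"
proof -
  have "(\<integral>\<^sup>+u. ennreal (exp (s * u)) * indicator {..a} u \<partial>lborel) =
    (\<integral>\<^sup>+u. ennreal (exp (- s * u)) * indicator {-a..} u \<partial>lborel)"
    by (subst nn_integral_real_affine[where c="-1" and t=0])
       (auto intro!: nn_integral_cong split: split_indicator)
  also have "\<dots> = ennreal (exp (s * a) / s)"
    using nn_integral_exp_minus_atLeast[OF assms, of "-a"] by simp
  finally show ?thesis .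
qed

text \<open>Covers the degenerate cases of the layer-cake formulas, \<open>t = 0\<close> and
  \<open>x = \<infinity>\<close>, in which every level contributes.\<close>

lemma nn_integral_exp_eq_top:
  fixes s :: real
  assumes "s \<noteq> 0"
  shows "(\<integral>\<^sup>+u. ennreal (exp (s * u)) \<partial>lborel) = \<infinity>"
proof -
  have pos: "(\<integral>\<^sup>+u. ennreal (exp (s * u)) \<partial>lborel) = \<infinity>" if s: "0 < s" for s :: real
  proof -
    have "of_nat n \<le> (\<integral>\<^sup>+u. ennreal (exp (s * u)) \<partial>lborel)" for n :: nat
    proof -
      have "s * real n \<le> exp (s * real n)" using exp_ge_add_one_self[of "s * real n"] by linarith
      then have "ennreal (real n) \<le> ennreal (exp (s * real n) / s)" using s by (intro ennreal_leI) (simp add: field_simps)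
      also have "\<dots> = (\<integral>\<^sup>+u. ennreal (exp (s * u)) * indicator {..real n} u \<partial>lborel)"
        using nn_integral_exp_atMost[OF s, of "real n"] by simp
      also have "\<dots> \<le> (\<integral>\<^sup>+u. ennreal (exp (s * u)) \<partial>lborel)"
        by (intro nn_integral_mono) (auto split: split_indicator)
      finally show ?thesis by (simp add: ennreal_of_nat_eq_real_of_nat)
    qed
    then show ?thesis
      by (metis ennreal_SUP_of_nat_eq_top SUP_least infinity_ennreal_def top_unique)
  qed
  show ?thesis
  proof (cases "0 < s")
    case False
    have "(\<integral>\<^sup>+u. ennreal (exp (s * u)) \<partial>lborel) = (\<integral>\<^sup>+u. ennreal (exp (- s * u)) \<partial>lborel)"
      by (subst nn_integral_real_affine[where c="-1" and t=0]) auto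
    then show ?thesis using pos[of "- s"] False assms by simp
  qed (rule pos)
qed

text \<open>Parametrising the levels by \<open>e\<^bsup>u\<^esup>\<close> avoids the singular density \<open>t\<^bsup>s - 1\<^esup>\<close> at \<open>t = 0\<close>. In the first formula
  both sides are infinite for \<open>t = 0\<close>, because \<open>0 powr s = 0\<close>.\<close>

lemma inverse_powr_layer_cake:
  assumes s: "0 < s" and t: "0 \<le> t"
  shows "inverse (ennreal (t powr s)) = ennreal s * (\<integral>\<^sup>+u. ennreal (exp (- s * u)) * indicator {u. t \<le> exp u} u \<partial>lborel)"
proof (cases "t = 0")
  case True
  have "(\<integral>\<^sup>+u. ennreal (exp (- s * u)) \<partial>lborel) = \<infinity>"
    using s by (intro nn_integral_exp_eq_top) simp
  then show ?thesis using True s by (simp add: ennreal_mult_top less_imp_le)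
next
  case False
  with t have "t > 0" by simp
  have "{u. t \<le> exp u} = {ln t..}" using \<open>t > 0\<close>
    by (auto; metis exp_gt_zero exp_le_cancel_iff exp_ln)
  then have "(\<integral>\<^sup>+u. ennreal (exp (- s * u)) * indicator {u. t \<le> exp u} u \<partial>lborel) = ennreal (exp (- s * ln t) / s)"
    using nn_integral_exp_minus_atLeast[OF s] by simp
  moreover have "exp (- s * ln t) = inverse (t powr s)"
    using \<open>t > 0\<close> by (simp add: powr_def exp_minus)
  ultimately show ?thesis
    using s \<open>t > 0\<close> by (simp add: inverse_ennreal flip: ennreal_mult')
qed

lemma powr_layer_cake:
  assumes s: "0 < s"
  shows "epow x s = ennreal s * (\<integral>\<^sup>+u. ennreal (exp (s * u)) * indicator {u. ennreal (exp u) < x} u \<partial>lborel)"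
proof -
  consider "x = 0" | "x = \<infinity>" | a where "x = ennreal a" "0 < a"
    by (metis ennreal_cases ennreal_less_zero_iff infinity_ennreal_def zero_less_iff_neq_zero)
  then show ?thesis
  proof cases
    case 1 then show ?thesis by simp
  next
    case 2
    have "(\<integral>\<^sup>+u. ennreal (exp (s * u)) \<partial>lborel) = \<infinity>"
      using s by (intro nn_integral_exp_eq_top) simp
    then show ?thesis using 2 s by (simp add: ennreal_mult_top less_imp_le)
  next
    case 3
    have "(\<integral>\<^sup>+u. ennreal (exp (s * u)) * indicator {u. ennreal (exp u) < x} u \<partial>lborel) =
      (\<integral>\<^sup>+u. ennreal (exp (s * u)) * indicator {..ln a} u \<partial>lborel)"
    proof (rule nn_integral_cong_AE)
      \<comment> \<open>The level set is open at \<open>ln a\<close>, the explicit integral runs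
        over a closed half-line; the endpoint is a null set.\<close>
      have "AE u in lborel. u \<noteq> ln a" by (rule AE_lborel_singleton)
      then show "AE u in lborel. ennreal (exp (s * u)) * indicator {u. ennreal (exp u) < x} u =
          ennreal (exp (s * u)) * indicator {..ln a} u"
      proof eventually_elim
        case (elim u)
        then have "exp u < a \<longleftrightarrow> u \<le> ln a"
          using 3 by (metis exp_ln exp_less_cancel_iff less_eq_real_def)
        then show ?case
          using 3 by (auto simp: ennreal_less_iff split: split_indicator)
      qed
    qed
    also have "\<dots> = ennreal (exp (s * ln a) / s)"
      by (rule nn_integral_exp_atMost[OF s])
    finally show ?thesis
      using s 3 by (simp add: epow_ennreal powr_def flip: ennreal_mult')
  qed
qed

section \<open>The maximal theorem\<close>

text \<open>Joint measurability in centre, point and radius is what the Tonelli exchanges between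
  space and scale require.\<close>

lemma indicator_cball_measurable [measurable]:
  fixes f g :: "'b \<Rightarrow> 'a::euclidean_space"
  assumes [measurable]: "f \<in> borel_measurable M" "g \<in> borel_measurable M" "r \<in> borel_measurable M"
  shows "(\<lambda>z. indicator (cball (f z) (r z)) (g z) :: ennreal) \<in> borel_measurable M"
proof -
  have "(\<lambda>z. indicator (cball (f z) (r z)) (g z) :: ennreal) = (\<lambda>z. if dist (f z) (g z) \<le> r z then 1 else 0)"
    by (auto simp: indicator_def)
  then show ?thesis by simp
qed

lemma emeasure_cball_scale:
  fixes x y :: "'a::euclidean_space"
  assumes "0 \<le> c" "0 \<le> r"
  shows "ball_vol x (c * r) = ennreal (c ^ DIM('a)) * ball_vol y r"
  using assms by (simp add: emeasure_cball power_mult_distrib mult_ac flip: ennreal_mult)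

lemma unit_ball_vol_DIM_pos: "0 < unit_ball_vol (real DIM('a::euclidean_space))"
  by (intro unit_ball_vol_pos) simp

lemma emeasure_cball_pos: "0 < r \<Longrightarrow> 0 < emeasure lborel (cball (x::'a::euclidean_space) r)"
  using unit_ball_vol_DIM_pos[where 'a='a] by (simp add: emeasure_cball)

text \<open>The sum over the cover is an integral over \<open>count_space\<close>, so that families
  of balls indexed by their centres can be handled with monotonicity and Tonelli, without an
  enumeration.\<close>

lemma emeasure_le_countable_cover:
  assumes "countable C" "\<And>i. i \<in> C \<Longrightarrow> A i \<in> sets M" "S \<in> sets M" "S \<subseteq> (\<Union>i\<in>C. A i)"
  shows "emeasure M S \<le> (\<integral>\<^sup>+i. emeasure M (A i) \<partial>count_space C)"
proof -
  have "emeasure M S = (\<integral>\<^sup>+x. indicator S x \<partial>M)"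
    using assms(3) by simp
  also have "\<dots> \<le> (\<integral>\<^sup>+x. \<integral>\<^sup>+i. indicator (A i) x \<partial>count_space C \<partial>M)"
  proof (rule nn_integral_mono)
    fix x
    show "indicator S x \<le> (\<integral>\<^sup>+i. indicator (A i) x \<partial>count_space C)"
    proof (cases "x \<in> S")
      case True
      then obtain j where j: "j \<in> C" "x \<in> A j" using assms by blast
      have "1 = (\<integral>\<^sup>+i. indicator {j} i \<partial>count_space C)"
        using j by simp
      also have "\<dots> \<le> (\<integral>\<^sup>+i. indicator (A i) x \<partial>count_space C)"
        using j by (intro nn_integral_mono) (auto split: split_indicator)
      finally show ?thesis using True by simp
    qed simp
  qed
  also have "\<dots> = (\<integral>\<^sup>+i. \<integral>\<^sup>+x. indicator (A i) x \<partial>M \<partial>count_space C)"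
    using assms by (intro nn_integral_count_space_nn_integral) auto
  also have "\<dots> = (\<integral>\<^sup>+i. emeasure M (A i) \<partial>count_space C)"
    using assms by (intro nn_integral_cong) auto
  finally show ?thesis .
qed

text \<open>The integrals over the \<open>A i\<close> are values of the measure with density
  \<open>G\<close>, which is countably additive.\<close>

lemma nn_integral_disjoint_family_le:
  assumes "countable C" "disjoint_family_on A C" "\<And>i. i \<in> C \<Longrightarrow> A i \<in> sets M"
    and "\<And>i. i \<in> C \<Longrightarrow> A i \<subseteq> W" "W \<in> sets M"
    and [measurable]: "G \<in> borel_measurable M"
  shows "(\<integral>\<^sup>+i. \<integral>\<^sup>+y. G y * indicator (A i) y \<partial>M \<partial>count_space C) \<le> (\<integral>\<^sup>+y. G y * indicator W y \<partial>M)"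
proof -
  have "(\<integral>\<^sup>+i. \<integral>\<^sup>+y. G y * indicator (A i) y \<partial>M \<partial>count_space C) =
      (\<integral>\<^sup>+i. emeasure (density M G) (A i) \<partial>count_space C)"
    using assms by (intro nn_integral_cong) (simp add: emeasure_density)
  also have "\<dots> = emeasure (density M G) (\<Union>i\<in>C. A i)"
    using assms by (intro emeasure_UN_countable[symmetric]) auto
  also have "\<dots> \<le> emeasure (density M G) W"
    using assms by (intro emeasure_mono) auto
  finally show ?thesis using assms by (simp add: emeasure_density)
qed

lemma Vitali_selection:
  fixes r :: "'a::euclidean_space \<Rightarrow> real"
  assumes "\<And>x. x \<in> S \<Longrightarrow> 0 < r x \<and> r x \<le> B"
  obtains C where "countable C" "C \<subseteq> S" "disjoint_family_on (\<lambda>x. cball x (r x)) C"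
    "S \<subseteq> (\<Union>x\<in>C. cball x (5 * r x))"
proof -
  have "S \<subseteq> (\<Union>i\<in>S. cball i (r i))"
    using assms by (force intro: less_imp_le)
  from Vitali_covering_lemma_cballs[OF this assms] obtain C where
    "countable C" "C \<subseteq> S" "pairwise (\<lambda>i j. disjnt (cball i (r i)) (cball j (r j))) C"
    "S \<subseteq> (\<Union>x\<in>C. cball x (5 * r x))" by blast
  then show thesis
    by (intro that[of C]) (auto simp: disjoint_family_on_def pairwise_def disjnt_def)
qed

text \<open>The balls enlarged by the factor 5 cover \<open>S\<close> at the price of
  \<open>5 ^ DIM('a)\<close> in volume, while the integrals of \<open>G\<close> over the selected
  disjoint balls add up to at most the total integral.\<close>

lemma Vitali_emeasure_le:
  fixes G :: "'a::euclidean_space \<Rightarrow> ennreal"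
  assumes [measurable]: "G \<in> borel_measurable borel" "S \<in> sets borel"
    and r: "\<And>x. x \<in> S \<Longrightarrow> 0 < r x \<and> r x \<le> B"
    and c: "\<And>x. x \<in> S \<Longrightarrow> c * ball_vol x (r x) \<le> ball_integral G x (r x)"
  shows "c * emeasure lborel S \<le> 5 ^ DIM('a) * (\<integral>\<^sup>+y. G y \<partial>lborel)"
proof -
  obtain C where C: "countable C" "C \<subseteq> S" "disjoint_family_on (\<lambda>x. cball x (r x)) C"
    "S \<subseteq> (\<Union>x\<in>C. cball x (5 * r x))"
    using r by (rule Vitali_selection)
  have "c * emeasure lborel S \<le> c * (\<integral>\<^sup>+x. ball_vol x (5 * r x) \<partial>count_space C)"
    using C by (intro mult_left_mono emeasure_le_countable_cover) auto
  also have "\<dots> = (\<integral>\<^sup>+x. c * ball_vol x (5 * r x) \<partial>count_space C)"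
    by (simp add: nn_integral_cmult)
  also have "\<dots> \<le> (\<integral>\<^sup>+x. 5 ^ DIM('a) * ball_integral G x (r x) \<partial>count_space C)"
  proof (rule nn_integral_mono)
    fix x assume "x \<in> space (count_space C)"
    then have x: "x \<in> S" using C by auto
    have "c * ball_vol x (5 * r x) = 5 ^ DIM('a) * (c * ball_vol x (r x))"
      using r[OF x] emeasure_cball_scale[of 5 "r x" x x] by (simp add: mult_ac flip: ennreal_power)
    also have "\<dots> \<le> 5 ^ DIM('a) * ball_integral G x (r x)"
      by (intro mult_left_mono c x) auto
    finally show "c * ball_vol x (5 * r x) \<le> 5 ^ DIM('a) * ball_integral G x (r x)" .
  qed
  also have "\<dots> = 5 ^ DIM('a) * (\<integral>\<^sup>+x. \<integral>\<^sup>+y. G y * indicator (cball x (r x)) y \<partial>lborel \<partial>count_space C)"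
    by (simp add: nn_integral_cmult)
  also have "\<dots> \<le> 5 ^ DIM('a) * (\<integral>\<^sup>+y. G y * indicator UNIV y \<partial>lborel)"
    using C by (intro mult_left_mono nn_integral_disjoint_family_le) auto
  finally show ?thesis by simp
qed

definition ball_avg :: "('a::euclidean_space \<Rightarrow> ennreal) \<Rightarrow> 'a \<Rightarrow> real \<Rightarrow> ennreal" where
  "ball_avg G x r = ball_integral G x r / ball_vol x r"

lemma ball_integral_eq_avg:
  assumes "0 < r"
  shows "ball_integral G x r = ball_avg G x r * ball_vol x r"
  using emeasure_cball_pos[OF assms, of x] emeasure_lborel_cball_finite[of x r]
  unfolding ball_avg_def by (simp add: ennreal_divide_times ennreal_mult_divide_eq mult_divide_eq_ennreal)

lemma ball_avg_measurable [measurable]: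
  assumes [measurable]: "G \<in> borel_measurable borel" "0 \<le> r"
  shows "(\<lambda>x. ball_avg G x r) \<in> borel_measurable borel"
proof -
  have "(\<lambda>x::'a. ball_avg G x r) = (\<lambda>x. ball_integral G x r / emeasure lborel (cball (0::'a) r))"
    using assms by (simp add: ball_avg_def emeasure_cball)
  also have "\<dots> \<in> borel_measurable borel" by measurable
  finally show ?thesis .
qed

text \<open>Restricting the radii to integer powers of \<open>e\<close> makes this a countable
  supremum, hence measurable. Other radii are recovered in \<open>ball_integral_le_maximal\<close>
  at the cost of a dimensional factor.\<close>

definition maximal :: "('a::euclidean_space \<Rightarrow> ennreal) \<Rightarrow> 'a \<Rightarrow> ennreal" where
  "maximal G x = (SUP k::int. ball_avg G x (exp (of_int k)))"

lemma maximal_measurable [measurable]: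
  assumes [measurable]: "G \<in> borel_measurable borel"
  shows "maximal G \<in> borel_measurable borel"
proof -
  have "(\<lambda>x. SUP k::int. ball_avg G x (exp (of_int k))) \<in> borel_measurable borel"
    by (intro borel_measurable_SUP) auto
  then show ?thesis by (simp add: maximal_def[abs_def])
qed

lemma maximal_weak_type:
  fixes G :: "'a::euclidean_space \<Rightarrow> ennreal"
  assumes [measurable]: "G \<in> borel_measurable borel" and c: "0 < c"
  shows "ennreal c * emeasure lborel {x. ennreal c < maximal G x} \<le> 5 ^ DIM('a) * (\<integral>\<^sup>+y. G y \<partial>lborel)"
proof (cases "(\<integral>\<^sup>+y. G y \<partial>lborel) = \<infinity>")
  case True
  then show ?thesis by (simp add: ennreal_mult_top)
next
  case False
  then obtain I where I: "(\<integral>\<^sup>+y. G y \<partial>lborel) = ennreal I" "0 \<le> I"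
    by (metis ennreal_cases infinity_ennreal_def)
  define S where "S = {x. ennreal c < maximal G x}"
  have "\<exists>r. 0 < r \<and> ennreal c < ball_avg G x r" if "x \<in> S" for x
    using that unfolding S_def maximal_def less_SUP_iff by (auto intro: exp_gt_zero)
  then obtain r where r: "\<And>x. x \<in> S \<Longrightarrow> 0 < r x" "\<And>x. x \<in> S \<Longrightarrow> ennreal c < ball_avg G x (r x)"
    by metis
  have c': "ennreal c * ball_vol x (r x) \<le> ball_integral G x (r x)"
    if "x \<in> S" for x
    using r[OF that] by (auto simp: ball_integral_eq_avg intro: mult_right_mono)
  define \<omega> where "\<omega> = unit_ball_vol (real DIM('a))"
  have \<omega>: "\<omega> > 0" unfolding \<omega>_def by (rule unit_ball_vol_DIM_pos)
  \<comment> \<open>The Vitali selection needs bounded radii. A ball with average above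
    \<open>c\<close> has volume at most \<open>I / c\<close>, and for radii above 1 the radius is at
    most its power with exponent \<open>DIM('a)\<close>.\<close>
  have rB: "r x \<le> max 1 (I / (c * \<omega>))" if "x \<in> S" for x
  proof (cases "r x \<le> 1")
    case False
    have "ennreal (c * (\<omega> * r x ^ DIM('a))) \<le> ball_integral G x (r x)"
      using c'[OF that] r(1)[OF that] c \<omega> by (simp add: emeasure_cball \<omega>_def ennreal_mult)
    also have "\<dots> \<le> (\<integral>\<^sup>+y. G y \<partial>lborel)"
      by (intro nn_integral_mono) (auto split: split_indicator)
    finally have "c * (\<omega> * r x ^ DIM('a)) \<le> I" using I by simp
    moreover have "r x ^ 1 \<le> r x ^ DIM('a)"
      using False by (intro power_increasing) (auto simp: Suc_leI)
    ultimately have "c * (\<omega> * r x) \<le> I"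
      by (smt (verit) c \<omega> mult_le_cancel_left_pos power_one_right)
    then have "r x \<le> I / (c * \<omega>)" using c \<omega> by (simp add: field_simps)
    then show ?thesis by simp
  qed simp
  show ?thesis
    unfolding S_def[symmetric]
    by (rule Vitali_emeasure_le[where r=r and B="max 1 (I / (c * \<omega>))"])
       (use r rB c' in \<open>auto simp: S_def\<close>)
qed

text \<open>Serves to truncate at a height: the part of \<open>G\<close> below \<open>c\<close> adds
  at most \<open>c\<close> to every average.\<close>

lemma maximal_le_add:
  assumes [measurable]: "G' \<in> borel_measurable borel" and le: "\<And>x. G x \<le> G' x + c"
  shows "maximal G x \<le> maximal G' x + c"
  unfolding maximal_def
proof (rule SUP_least)
  fix k :: int
  let ?r = "exp (real_of_int k)" and ?B = "cball x (exp (real_of_int k))"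
  have "(\<integral>\<^sup>+y. G y * indicator ?B y \<partial>lborel) \<le> (\<integral>\<^sup>+y. G' y * indicator ?B y + c * indicator ?B y \<partial>lborel)"
    by (intro nn_integral_mono) (use le in \<open>auto split: split_indicator\<close>)
  also have "\<dots> = (\<integral>\<^sup>+y. G' y * indicator ?B y \<partial>lborel) + c * emeasure lborel ?B"
    by (simp add: nn_integral_add nn_integral_cmult_indicator)
  finally have "ball_avg G x ?r \<le> ((\<integral>\<^sup>+y. G' y * indicator ?B y \<partial>lborel) + c * emeasure lborel ?B) / emeasure lborel ?B"
    unfolding ball_avg_def by (rule divide_right_mono_ennreal)
  also have "\<dots> = ball_avg G' x ?r + c"
    using emeasure_cball_pos[of ?r x] emeasure_lborel_cball_finite[of x ?r]
    by (simp add: ball_avg_def add_divide_distrib_ennreal mult_divide_eq_ennreal)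
  also have "\<dots> \<le> (SUP k::int. ball_avg G' x (exp (of_int k))) + c"
    by (intro add_right_mono SUP_upper) auto
  finally show "ball_avg G x ?r \<le> (SUP k::int. ball_avg G' x (exp (of_int k))) + c" .
qed

text \<open>Marcinkiewicz interpolation. At level \<open>exp u\<close> the part of \<open>G\<close>
  not exceeding \<open>exp u / 2\<close> is discarded, and the weak-type bound at height
  \<open>exp u / 2\<close> is applied to the rest, which gives the factor
  \<open>2 * 5 ^ DIM('a)\<close>. Exchanging the integrals leaves a layer cake of
  \<open>2 * G\<close> with exponent \<open>p - 1 > 0\<close>, the source of the last
  factor.\<close>

theorem maximal_strong_type:
  fixes G :: "'a::euclidean_space \<Rightarrow> ennreal"
  assumes [measurable]: "G \<in> borel_measurable borel" and p: "1 < p"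
  shows "pow_integral p (maximal G) \<le>
    ennreal (p * (2 * 5 ^ DIM('a)) * (2 powr (p - 1) / (p - 1))) * pow_integral p G"
proof -
  let ?level = "\<lambda>u. {x. ennreal (exp u) < maximal G x}"
  let ?T = "\<lambda>x u. G x * indicator {x. ennreal (exp u) < 2 * G x} x"
  let ?M = "\<lambda>x u. ennreal (exp (p * u)) * indicator {u. ennreal (exp u) < maximal G x} u"
  let ?S = "\<lambda>x u. ennreal (exp ((p - 1) * u)) * (G x * indicator {u. ennreal (exp u) < 2 * G x} u)"
  define c where "c = ennreal (2 * 5 ^ DIM('a))"
  have level: "emeasure lborel (?level u) \<le>
      c * ennreal (exp (- u)) * (\<integral>\<^sup>+x. ?T x u \<partial>lborel)" for u
  proof -
    define G' where "G' x = ?T x u" for x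
    have [measurable]: "G' \<in> borel_measurable borel" unfolding G'_def by measurable
    define h where "h = exp u / 2"
    have h: "h > 0" by (auto simp: h_def)
    have hh: "ennreal (exp u) = ennreal h + ennreal h"
      by (simp add: h_def flip: ennreal_plus)
    have "G x \<le> G' x + ennreal h" for x
    proof (cases "ennreal (exp u) < 2 * G x")
      case False
      then have "2 * G x \<le> 2 * ennreal h" by (simp add: hh mult_2)
      then have "G x \<le> ennreal h"
        by (subst (asm) ennreal_mult_le_mult_iff) auto
      then show ?thesis by (simp add: add_increasing)
    qed (simp add: G'_def add_increasing2)
    then have 1: "maximal G x \<le> maximal G' x + ennreal h" for x by (intro maximal_le_add) auto
    have sub: "?level u \<subseteq> {x. ennreal h < maximal G' x}"
    proof safe
      fix x assume "ennreal (exp u) < maximal G x"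
      with 1[of x] have "ennreal h + ennreal h < maximal G' x + ennreal h"
        unfolding hh by (rule order.strict_trans2[rotated])
      then show "ennreal h < maximal G' x" by (meson add_right_mono not_le)
    qed
    have "emeasure lborel (?level u) \<le> emeasure lborel {x. ennreal h < maximal G' x}"
      using sub by (intro emeasure_mono) auto
    also have "\<dots> = ennreal (1 / h) * (ennreal h * emeasure lborel {x. ennreal h < maximal G' x})"
    proof -
      have "ennreal (1 / h) * ennreal h = 1" using h by (simp flip: ennreal_mult)
      then show ?thesis by (metis mult.assoc mult_1)
    qed
    also have "\<dots> \<le> ennreal (1 / h) * (5 ^ DIM('a) * (\<integral>\<^sup>+y. G' y \<partial>lborel))"
      using h by (intro mult_left_mono maximal_weak_type) auto
    also have "ennreal (1 / h) * (5 ^ DIM('a) * (\<integral>\<^sup>+y. G' y \<partial>lborel)) = c * ennreal (exp (- u)) * (\<integral>\<^sup>+y. G' y \<partial>lborel)"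
    proof -
      have "ennreal (1 / h) * 5 ^ DIM('a) = c * ennreal (exp (- u))"
      proof -
        have "(5 :: ennreal) ^ DIM('a) = ennreal (5 ^ DIM('a))"
          using ennreal_power[of 5 "DIM('a)"] by simp
        then have "ennreal (1 / h) * 5 ^ DIM('a) = ennreal (1 / h * 5 ^ DIM('a))"
          using h by (simp only: ennreal_mult[symmetric] zero_le_divide_1_iff less_imp_le) (simp flip: ennreal_mult)
        also have "1 / h * 5 ^ DIM('a) = 2 * 5 ^ DIM('a) * exp (- u)"
          by (simp add: h_def exp_minus field_simps)
        finally show ?thesis by (simp add: c_def ennreal_mult)
      qed
      then show ?thesis by (simp add: mult.assoc[symmetric])
    qed
    finally show ?thesis by (simp add: G'_def)
  qed
  have "pow_integral p (maximal G) =
      (\<integral>\<^sup>+x. ennreal p * (\<integral>\<^sup>+u. ?M x u \<partial>lborel) \<partial>lborel)"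
    using p by (simp add: powr_layer_cake)
  also have "\<dots> = ennreal p * (\<integral>\<^sup>+x. (\<integral>\<^sup>+u. ?M x u \<partial>lborel) \<partial>lborel)"
    by (simp add: nn_integral_cmult)
  also have "(\<integral>\<^sup>+x. (\<integral>\<^sup>+u. ?M x u \<partial>lborel) \<partial>lborel) =
      (\<integral>\<^sup>+u. (\<integral>\<^sup>+x. ?M x u \<partial>lborel) \<partial>lborel)"
    by (rule lborel_pair.Fubini') simp
  also have "\<dots> = (\<integral>\<^sup>+u. ennreal (exp (p * u)) * emeasure lborel (?level u) \<partial>lborel)"
  proof (rule nn_integral_cong)
    fix u :: real
    have "(\<integral>\<^sup>+x. ?M x u \<partial>lborel) =
       (\<integral>\<^sup>+x. ennreal (exp (p * u)) * indicator (?level u) x \<partial>lborel)"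
      by (intro nn_integral_cong) (auto split: split_indicator)
    also have "\<dots> = ennreal (exp (p * u)) * emeasure lborel (?level u)"
      by (intro nn_integral_cmult_indicator) measurable
    finally show "(\<integral>\<^sup>+x. ?M x u \<partial>lborel) = \<dots>" .
  qed
  also have "\<dots> \<le> (\<integral>\<^sup>+u. c * (\<integral>\<^sup>+x. ?S x u \<partial>lborel) \<partial>lborel)"
  proof (rule nn_integral_mono)
    fix u :: real
    have "ennreal (exp (p * u)) * emeasure lborel (?level u) \<le>
      ennreal (exp (p * u)) * (c * ennreal (exp (- u)) * (\<integral>\<^sup>+x. ?T x u \<partial>lborel))"
      by (intro mult_left_mono level) auto
    also have "\<dots> = c * (ennreal (exp (p * u)) * ennreal (exp (- u)) * (\<integral>\<^sup>+x. ?T x u \<partial>lborel))"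
      by (simp add: mult_ac)
    also have "ennreal (exp (p * u)) * ennreal (exp (- u)) = ennreal (exp ((p - 1) * u))"
      by (simp add: algebra_simps flip: ennreal_mult exp_add)
    also have "ennreal (exp ((p - 1) * u)) * (\<integral>\<^sup>+x. ?T x u \<partial>lborel) =
      (\<integral>\<^sup>+x. ennreal (exp ((p - 1) * u)) * (?T x u) \<partial>lborel)"
      by (intro nn_integral_cmult[symmetric]) measurable
    also have "\<dots> = (\<integral>\<^sup>+x. ?S x u \<partial>lborel)"
      by (intro nn_integral_cong) (auto split: split_indicator)
    finally show "ennreal (exp (p * u)) * emeasure lborel (?level u) \<le> c * \<dots>" .
  qed
  also have "\<dots> = c * (\<integral>\<^sup>+u. (\<integral>\<^sup>+x. ?S x u \<partial>lborel) \<partial>lborel)"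
    by (intro nn_integral_cmult) measurable
  also have "(\<integral>\<^sup>+u. (\<integral>\<^sup>+x. ?S x u \<partial>lborel) \<partial>lborel) =
      (\<integral>\<^sup>+x. (\<integral>\<^sup>+u. ?S x u \<partial>lborel) \<partial>lborel)"
    by (rule lborel_pair.Fubini') simp
  also have "\<dots> = (\<integral>\<^sup>+x. ennreal (2 powr (p - 1) / (p - 1)) * epow (G x) p \<partial>lborel)"
  proof (rule nn_integral_cong)
    fix x
    let ?L = "\<integral>\<^sup>+u. ennreal (exp ((p - 1) * u)) * indicator {u. ennreal (exp u) < 2 * G x} u \<partial>lborel"
    have "(\<integral>\<^sup>+u. ?S x u \<partial>lborel) = G x * ?L"
      by (subst nn_integral_cmult[symmetric]) (auto simp: mult_ac)
    also have "?L = ennreal (1 / (p - 1)) * (ennreal (p - 1) * ?L)"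
      using p by (simp add: mult.assoc[symmetric] flip: ennreal_mult)
    also have "ennreal (p - 1) * ?L = epow (2 * G x) (p - 1)"
      using p by (intro powr_layer_cake[symmetric]) simp
    also have "\<dots> = ennreal (2 powr (p - 1)) * epow (G x) (p - 1)"
      using p epow_ennreal[of 2 "p - 1"] by (simp add: epow_mult)
    also have "G x * (ennreal (1 / (p - 1)) * (ennreal (2 powr (p - 1)) * epow (G x) (p - 1))) =
        (ennreal (1 / (p - 1)) * ennreal (2 powr (p - 1))) * (epow (G x) (p - 1) * epow (G x) 1)"
      by (simp add: mult_ac)
    also have "\<dots> = ennreal (2 powr (p - 1) / (p - 1)) * epow (G x) p"
    proof -
      have "epow (G x) (p - 1) * epow (G x) 1 = epow (G x) p"
        using epow_add[of "G x" "p - 1" 1] by simp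
      moreover have "ennreal (1 / (p - 1)) * ennreal (2 powr (p - 1)) = ennreal (2 powr (p - 1) / (p - 1))"
        using p by (simp add: ennreal_mult[symmetric])
      ultimately show ?thesis by metis
    qed
    finally show "(\<integral>\<^sup>+u. ?S x u \<partial>lborel) = \<dots>" .
  qed
  also have "\<dots> = ennreal (2 powr (p - 1) / (p - 1)) * pow_integral p G"
    by (simp add: nn_integral_cmult)
  finally have "pow_integral p (maximal G) \<le>
      ennreal p * (c * (ennreal (2 powr (p - 1) / (p - 1)) * pow_integral p G))"
    by (simp add: mult_left_mono)
  moreover have "ennreal (p * (2 * 5 ^ DIM('a)) * (2 powr (p - 1) / (p - 1))) =
      ennreal p * c * ennreal (2 powr (p - 1) / (p - 1))"
    unfolding c_def using p
    by (subst ennreal_mult, simp, simp, subst ennreal_mult) auto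
  ultimately show ?thesis by (simp only: mult.assoc)
qed

section \<open>The John-Nirenberg inequality\<close>

text \<open>Takes the role of Lebesgue's differentiation theorem. Almost all of \<open>E\<close> is
  covered by small disjoint balls inside an open set of nearly the same measure; \<open>h\<close> is
  at least \<open>t\<close> on \<open>E\<close> but has averages at most \<open>l\<close> on these
  balls, so \<open>t\<close> times the measure of \<open>E\<close> is at most \<open>l\<close> times
  that measure up to an arbitrarily small error.\<close>

lemma emeasure_eq_0_of_small_averages:
  fixes h :: "'a::euclidean_space \<Rightarrow> ennreal"
  assumes [measurable]: "h \<in> borel_measurable borel" and E [measurable]: "E \<in> sets borel"
    and fin: "emeasure lborel E < \<infinity>"
    and \<rho>: "\<And>j. 0 < \<rho> j" "\<rho> \<longlonglongrightarrow> 0"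
    and lt: "0 \<le> l" "l < t"
    and h: "\<And>x. x \<in> E \<Longrightarrow> ennreal t \<le> h x"
    and avg: "\<And>x j. x \<in> E \<Longrightarrow> (ball_integral h x (\<rho> j))
                 \<le> ennreal l * ball_vol x (\<rho> j)"
  shows "emeasure lborel E = 0"
proof -
  obtain e where e: "emeasure lborel E = ennreal e" "0 \<le> e"
    using fin by (metis ennreal_cases infinity_ennreal_def less_irrefl)
  have "t * e \<le> l * e + \<epsilon>'" if "0 < \<epsilon>'" for \<epsilon>'
  proof -
    \<comment> \<open>Chosen so that the excess \<open>l * \<epsilon>\<close> in the final estimate
      stays below \<open>\<epsilon>'\<close>, also for \<open>l = 0\<close>.\<close>
    define \<epsilon> where "\<epsilon> = \<epsilon>' / (l + 1)"
    have \<epsilon>: "0 < \<epsilon>" using that lt by (simp add: \<epsilon>_def)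
    obtain U where U: "open U" "E \<subseteq> U" "emeasure lborel (U - E) < ennreal \<epsilon>"
      using outer_regular_lborel[OF E \<epsilon>] by blast
    have [measurable]: "U \<in> sets borel" using U by auto
    have "emeasure lborel U = emeasure lborel E + emeasure lborel (U - E)"
      using U by (subst plus_emeasure) (auto simp: Un_absorb1)
    also have "\<dots> \<le> ennreal (e + \<epsilon>)"
      using U e \<epsilon> by (simp add: add_left_mono)
    finally have U_le: "emeasure lborel U \<le> ennreal (e + \<epsilon>)" .
    \<comment> \<open>Indexing by pairs lets one centre carry arbitrarily small balls, as a fine
      cover in Vitali's sense demands.\<close>
    define K where "K = {(x, j). x \<in> E \<and> cball x (\<rho> j) \<subseteq> U}"
    have "\<exists>i. i \<in> K \<and> x \<in> cball (fst i) (\<rho> (snd i)) \<and> \<rho> (snd i) < d" if "x \<in> E" "0 < d" for x d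
    proof -
      obtain d' where d': "0 < d'" "cball x d' \<subseteq> U"
        using U \<open>x \<in> E\<close> open_contains_cball by blast
      have "eventually (\<lambda>j. \<rho> j < min d d') sequentially"
        using \<rho>(2) d' that by (intro order_tendstoD) auto
      then obtain j where j: "\<rho> j < min d d'" by (auto simp: eventually_sequentially)
      then have "cball x (\<rho> j) \<subseteq> U" using d' by (meson less_imp_le min.strict_boundedE order_trans subset_cball)
      with that j \<rho>(1)[of j] show ?thesis by (intro exI[of _ "(x, j)"]) (auto simp: K_def less_imp_le)
    qed
    then obtain C where C: "countable C" "C \<subseteq> K"
      "pairwise (\<lambda>i j. disjnt (cball (fst i) (\<rho> (snd i))) (cball (fst j) (\<rho> (snd j)))) C"
      "negligible (E - (\<Union>i\<in>C. cball (fst i) (\<rho> (snd i))))"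
      using Vitali_covering_theorem_cballs[of K "\<lambda>i. \<rho> (snd i)" E fst] \<rho>(1) by blast
    define B where "B i = cball (fst i) (\<rho> (snd i))" for i :: "'a \<times> nat"
    have [measurable]: "B i \<in> sets borel" for i by (simp add: B_def)
    have disj: "disjoint_family_on B C"
      using C(3) by (auto simp: disjoint_family_on_def pairwise_def disjnt_def B_def)
    have [measurable]: "(\<Union>i\<in>C. B i) \<in> sets borel"
      using C(1) by (intro sets.countable_UN') auto
    have "emeasure lborel (E - (\<Union>i\<in>C. B i)) = 0"
      using C(4) unfolding B_def[symmetric] negligible_iff_null_sets null_sets_def
      by (auto simp: emeasure_completion)
    then have "emeasure lborel ((E \<inter> (\<Union>i\<in>C. B i)) \<union> (E - (\<Union>i\<in>C. B i))) = emeasure lborel (E \<inter> (\<Union>i\<in>C. B i))"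
      by (intro emeasure_Un_null_set) (auto simp: null_sets_def)
    then have "emeasure lborel E = emeasure lborel (E \<inter> (\<Union>i\<in>C. B i))"
      by (simp only: Int_Diff_Un)
    also have "\<dots> \<le> (\<integral>\<^sup>+i. emeasure lborel (E \<inter> B i) \<partial>count_space C)"
      using C(1) by (intro emeasure_le_countable_cover) auto
    finally have "ennreal t * emeasure lborel E \<le> ennreal t * (\<integral>\<^sup>+i. emeasure lborel (E \<inter> B i) \<partial>count_space C)"
      by (rule mult_left_mono) simp
    also have "\<dots> = (\<integral>\<^sup>+i. ennreal t * emeasure lborel (E \<inter> B i) \<partial>count_space C)"
      by (simp add: nn_integral_cmult)
    also have "\<dots> \<le> (\<integral>\<^sup>+i. ennreal l * emeasure lborel (B i) \<partial>count_space C)"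
    proof (rule nn_integral_mono)
      fix i assume "i \<in> space (count_space C)"
      then have i: "fst i \<in> E" using C(2) by (auto simp: K_def)
      have "ennreal t * emeasure lborel (E \<inter> B i) = (\<integral>\<^sup>+y. ennreal t * indicator (E \<inter> B i) y \<partial>lborel)"
        by (simp add: nn_integral_cmult_indicator)
      also have "\<dots> \<le> (\<integral>\<^sup>+y. h y * indicator (B i) y \<partial>lborel)"
        using h by (intro nn_integral_mono) (auto split: split_indicator)
      also have "\<dots> \<le> ennreal l * emeasure lborel (B i)"
        using avg[OF i, of "snd i"] by (simp add: B_def)
      finally show "ennreal t * emeasure lborel (E \<inter> B i) \<le> ennreal l * emeasure lborel (B i)" .
    qed
    also have "\<dots> = ennreal l * (\<integral>\<^sup>+i. emeasure lborel (B i) \<partial>count_space C)"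
      by (simp add: nn_integral_cmult)
    also have "(\<integral>\<^sup>+i. emeasure lborel (B i) \<partial>count_space C) = emeasure lborel (\<Union>i\<in>C. B i)"
      using C(1) disj by (intro emeasure_UN_countable[symmetric]) auto
    also have "ennreal l * emeasure lborel (\<Union>i\<in>C. B i) \<le> ennreal l * emeasure lborel U"
      using C(2) by (intro mult_left_mono emeasure_mono UN_least) (auto simp: K_def B_def subset_iff)
    also have "\<dots> \<le> ennreal l * ennreal (e + \<epsilon>)"
      by (intro mult_left_mono U_le) simp
    finally have "ennreal (t * e) \<le> ennreal (l * (e + \<epsilon>))"
      using e lt \<epsilon> by (simp add: ennreal_mult)
    then have "t * e \<le> l * (e + \<epsilon>)"
      using e lt \<epsilon> by (subst (asm) ennreal_le_iff) auto
    also have "\<dots> \<le> l * e + \<epsilon>'"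
      using lt that by (simp add: \<epsilon>_def field_simps)
    finally show ?thesis .
  qed
  then have "t * e \<le> l * e" by (rule field_le_epsilon)
  with lt e have "e = 0" by (smt (verit) mult_strict_right_mono)
  then show ?thesis using e by simp
qed

text \<open>Bounded mean oscillation over balls, with a free choice of centre \<open>m x r\<close>
  in place of the mean. The centre is assumed jointly measurable in the point and the scale
  \<open>u\<close>, because weights built from it are integrated over both.\<close>

locale ball_bmo =
  fixes b :: "'a::euclidean_space \<Rightarrow> complex" and m :: "'a \<Rightarrow> real \<Rightarrow> complex" and A :: real
  assumes b_meas [measurable]: "b \<in> borel_measurable borel"
    and m_meas [measurable]: "(\<lambda>(x, u). m x (exp u)) \<in> borel_measurable (borel \<Otimes>\<^sub>M borel)"
    and A_pos: "0 < A"
    and osc: "0 < r \<Longrightarrow> (ball_integral (\<lambda>y. enorm (b y - m x r)) x r)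
      \<le> ennreal A * ball_vol x r"
begin

text \<open>Averaging the triangle inequality over the ball: two constants that are both close to
  \<open>b\<close> in mean are close to each other.\<close>

lemma norm_diff_le:
  assumes r: "0 < r" "0 \<le> l" and bd: "ball_integral (\<lambda>y. enorm (b y - c)) x r
      \<le> ennreal l * ball_vol x r"
  shows "norm (m x r - c) \<le> A + l"
proof -
  have "enorm (m x r - c) * ball_vol x r =
     ball_integral (\<lambda>y. enorm (m x r - c)) x r"
    by (simp add: nn_integral_cmult_indicator)
  also have "\<dots> \<le> (\<integral>\<^sup>+y. enorm (b y - m x r) * indicator (cball x r) y +
      enorm (b y - c) * indicator (cball x r) y \<partial>lborel)"
  proof (intro nn_integral_mono)
    fix y
    have "norm (m x r - c) \<le> norm (b y - m x r) + norm (b y - c)"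
      using norm_triangle_ineq4[of "b y - c" "b y - m x r"] by (simp add: algebra_simps)
    then show "enorm (m x r - c) * indicator (cball x r) y \<le>
      enorm (b y - m x r) * indicator (cball x r) y + enorm (b y - c) * indicator (cball x r) y"
      by (auto split: split_indicator simp flip: ennreal_plus)
  qed
  also have "\<dots> = ball_integral (\<lambda>y. enorm (b y - m x r)) x r +
      ball_integral (\<lambda>y. enorm (b y - c)) x r"
    by (intro nn_integral_add) auto
  also have "\<dots> \<le> ennreal A * ball_vol x r + ennreal l * ball_vol x r"
    by (intro add_mono osc r bd)
  also have "\<dots> = ennreal (A + l) * ball_vol x r"
    using A_pos r by (simp add: distrib_right)
  finally have "enorm (m x r - c) \<le> ennreal (A + l)"
    using emeasure_cball_pos[OF r(1), of x] emeasure_lborel_cball_finite[of x r]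
    by (simp add: mult.commute[of _ "ball_vol x r"] ennreal_mult_le_mult_iff)
  then show ?thesis using A_pos r by (subst (asm) ennreal_le_iff) auto
qed

lemma norm_mean_diff_le:
  assumes sub: "cball x r \<subseteq> cball y (c * r)" and r: "0 < r" "0 < c"
  shows "norm (m x r - m y (c * r)) \<le> A * (1 + c ^ DIM('a))"
proof -
  have "ball_integral (\<lambda>z. enorm (b z - m y (c * r))) x r \<le>
      ball_integral (\<lambda>z. enorm (b z - m y (c * r))) y (c * r)"
    using sub by (intro nn_integral_mono) (auto split: split_indicator)
  also have "\<dots> \<le> ennreal A * ball_vol y (c * r)"
    using r by (intro osc) auto
  also have "\<dots> = ennreal (A * c ^ DIM('a)) * ball_vol x r"
    using r A_pos by (simp add: emeasure_cball_scale[of c r y x] ennreal_mult mult.assoc)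
  finally show ?thesis
    using norm_diff_le[of r "A * c ^ DIM('a)" "m y (c * r)" x] r A_pos by (simp add: algebra_simps)
qed

text \<open>The bracketed term is the bound of \<open>oscillation_double_ball\<close>. The power of
  5 pays for the enlargement in the Vitali lemma, and the factor 2 produces the halving in each step
  of \<open>John_Nirenberg\<close>.\<close>

definition jn_level :: real where
  "jn_level = 2 * 5 ^ DIM('a) * (A * (2 + 2 ^ DIM('a)) * 2 ^ DIM('a))"

text \<open>Balls of radius at most \<open>r\<close> with centre in the given ball stay inside the
  double ball, so the total oscillation available to the stopping balls is measured there, but
  around the centre value of the original ball. Changing the centre value costs
  \<open>A * (1 + 2 ^ DIM('a))\<close>.\<close>

lemma oscillation_double_ball:
  assumes r: "0 < r"
  shows "ball_integral (\<lambda>y. enorm (b y - m x r)) x (2 * r)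
    \<le> ennreal (A * (2 + 2 ^ DIM('a)) * 2 ^ DIM('a)) * ball_vol x r"
proof -
  have d: "norm (m x r - m x (2 * r)) \<le> A * (1 + 2 ^ DIM('a))"
    using r by (intro norm_mean_diff_le) auto
  have "ball_integral (\<lambda>y. enorm (b y - m x r)) x (2 * r) \<le>
    (\<integral>\<^sup>+y. enorm (b y - m x (2 * r)) * indicator (cball x (2 * r)) y +
       ennreal (A * (1 + 2 ^ DIM('a))) * indicator (cball x (2 * r)) y \<partial>lborel)"
  proof (intro nn_integral_mono)
    fix y
    have "norm (b y - m x r) \<le> norm (b y - m x (2 * r)) + A * (1 + 2 ^ DIM('a))"
      using d norm_triangle_ineq4[of "b y - m x (2 * r)" "m x r - m x (2 * r)"] by simp
    then show "enorm (b y - m x r) * indicator (cball x (2 * r)) y \<le>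
      enorm (b y - m x (2 * r)) * indicator (cball x (2 * r)) y +
       ennreal (A * (1 + 2 ^ DIM('a))) * indicator (cball x (2 * r)) y"
      using A_pos by (auto split: split_indicator simp flip: ennreal_plus)
  qed
  also have "\<dots> = ball_integral (\<lambda>y. enorm (b y - m x (2 * r))) x (2 * r) +
       ball_integral (\<lambda>y. ennreal (A * (1 + 2 ^ DIM('a)))) x (2 * r)"
    by (intro nn_integral_add) auto
  also have "\<dots> \<le> ennreal A * ball_vol x (2 * r) + ennreal (A * (1 + 2 ^ DIM('a))) * ball_vol x (2 * r)"
    using r by (intro add_mono osc) (auto simp: nn_integral_cmult_indicator)
  also have "\<dots> = ennreal (A + A * (1 + 2 ^ DIM('a))) * ball_vol x (2 * r)"
    using A_pos by (subst ennreal_plus) (auto simp: distrib_right)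
  also have "\<dots> = ennreal ((A + A * (1 + 2 ^ DIM('a))) * 2 ^ DIM('a)) * ball_vol x r"
    using r A_pos by (subst ennreal_mult) (auto simp: emeasure_cball_scale[of 2 r x x] mult.assoc)
  also have "(A + A * (1 + 2 ^ DIM('a))) * 2 ^ DIM('a) = A * (2 + 2 ^ DIM('a)) * 2 ^ DIM('a)"
    by (simp add: algebra_simps)
  finally show ?thesis .
qed

lemma jn_level_pos: "0 < jn_level" and jn_level_ge: "A \<le> jn_level"
proof -
  have "1 \<le> 2 * (5::real) ^ DIM('a) * ((2 + 2 ^ DIM('a)) * 2 ^ DIM('a))"
  proof -
    have 1: "1 \<le> (5::real) ^ DIM('a)" "1 \<le> (2::real) ^ DIM('a)" by simp_all
    have "1 * 1 \<le> (2 + 2 ^ DIM('a)) * (2::real) ^ DIM('a)" "1 * 1 \<le> 2 * (5::real) ^ DIM('a)"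
      using 1 by (intro mult_mono; simp)+
    then have "(1 * 1) * (1 * 1) \<le> (2 * (5::real) ^ DIM('a)) * ((2 + 2 ^ DIM('a)) * 2 ^ DIM('a))"
      by (intro mult_mono) auto
    then show ?thesis by simp
  qed
  then have "A * 1 \<le> A * (2 * (5::real) ^ DIM('a) * ((2 + 2 ^ DIM('a)) * 2 ^ DIM('a)))"
    using A_pos by (intro mult_left_mono) auto
  then show "A \<le> jn_level" by (simp add: jn_level_def mult_ac)
  then show "0 < jn_level" using A_pos by simp
qed

text \<open>The stopping radii are taken from the sequence \<open>r / 5\<^bsup>j\<^esup>\<close>, so that the radius enlarged by the
  factor of the Vitali covering lemma is the last one before stopping.\<close>

lemma John_Nirenberg:
  "0 < r \<Longrightarrow> emeasure lborel {y \<in> cball x r. real k * (2 * jn_level) < norm (b y - m x r)} \<le>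
    ennreal ((1 / 2) ^ k) * ball_vol x r"
proof (induction k arbitrary: x r)
  case 0
  then show ?case by (auto intro!: emeasure_mono)
next
  case (Suc k)
  define B0 where "B0 = cball x r"
  define h where "h y = enorm (b y - m x r)" for y
  have [measurable]: "h \<in> borel_measurable borel" unfolding h_def by measurable
  have [measurable]: "B0 \<in> sets borel" by (simp add: B0_def)
  define A1 where "A1 = A * (2 + 2 ^ DIM('a)) * 2 ^ DIM('a)"
  define l where "l = jn_level"
  have l: "l = 2 * 5 ^ DIM('a) * A1" by (simp add: l_def jn_level_def A1_def)
  have l0: "0 < l" "A \<le> l" using jn_level_pos jn_level_ge by (auto simp: l_def)
  have "0 < A1" using A_pos by (simp add: A1_def add_pos_pos)
  have A1l: "A1 < l"
  proof -
    have "1 * A1 < 2 * 5 ^ DIM('a) * A1"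
      using \<open>0 < A1\<close> by (intro mult_strict_right_mono) (auto intro: less_le_trans[of 1 "2 * 1"])
    then show ?thesis by (simp add: l)
  qed
  have double: "ball_integral h x (2 * r) \<le> ennreal A1 * ball_vol x r"
    using oscillation_double_ball[OF \<open>0 < r\<close>, of x] by (simp add: h_def A1_def)
  define S where "S = {y \<in> B0. real (Suc k) * (2 * l) < norm (b y - m x r)}"
  have S: "S \<in> sets borel" unfolding S_def by measurable
  define \<rho> where "\<rho> j = r / 5 ^ j" for j :: nat
  have \<rho>0: "0 < \<rho> j" "\<rho> j \<le> r" for j
    using Suc.prems by (auto simp: \<rho>_def field_simps mult_le_cancel_left1)
  have \<rho>lim: "\<rho> \<longlonglongrightarrow> 0" unfolding \<rho>_def by real_asymp
  define v where "v j = ball_vol x (\<rho> j)" for j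
  \<comment> \<open>The stopping condition of a Calderon-Zygmund decomposition: the average of
    \<open>h\<close> over the ball of radius \<open>\<rho> j\<close> exceeds \<open>l\<close>.
    Volumes do not depend on the centre, so \<open>v j\<close> serves for every
    \<open>y\<close>.\<close>
  define big where "big y j \<longleftrightarrow> ennreal l * v j <
    ball_integral h y (\<rho> j)" for y j
  have [measurable]: "Measurable.pred borel (\<lambda>y. big y j)" for j unfolding big_def by measurable
  have vol: "ball_vol y (\<rho> j) = v j" for y :: 'a and j
    using \<rho>0(1)[of j] by (simp add: emeasure_cball v_def)
  define G where "G = {y \<in> S. \<exists>j. big y j}"
  have [measurable]: "S \<in> sets borel" by (rule S)
  have [measurable]: "G \<in> sets borel" unfolding G_def by measurable
  \<comment> \<open>On \<open>S\<close> the function \<open>h\<close> exceeds \<open>2 * l\<close>;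
    where no ball stops, all averages are at most \<open>l\<close>, so such points form a null
    set.\<close>
  have "emeasure lborel (S - G) = 0"
  proof (rule emeasure_eq_0_of_small_averages[where h=h and \<rho>=\<rho> and l=l and t="2 * l"])
    have "emeasure lborel (S - G) \<le> ball_vol x r"
      by (intro emeasure_mono) (auto simp: S_def B0_def)
    also have "\<dots> < \<infinity>" using emeasure_lborel_cball_finite[of x r] by simp
    finally show "emeasure lborel (S - G) < \<infinity>" .
    show "ennreal (2 * l) \<le> h y" if "y \<in> S - G" for y
    proof -
      have "1 * (2 * l) \<le> real (Suc k) * (2 * l)" using l0 by (intro mult_right_mono) auto
      then show ?thesis using that by (auto simp: S_def h_def intro!: ennreal_leI)
    qed
    show "ball_integral h y (\<rho> j) \<le> ennreal l * ball_vol y (\<rho> j)"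
      if "y \<in> S - G" for y j
      using that by (auto simp: G_def big_def not_less vol)
  qed (use l0 \<rho>0 \<rho>lim in auto)
  then have SG: "emeasure lborel S = emeasure lborel G"
    using emeasure_Un_null_set[of G lborel "S - G"] by (simp add: null_sets_def G_def Un_absorb1)
  define J where "J y = (LEAST j. big y j)" for y
  define R where "R y = \<rho> (J y)" for y
  have sub: "cball y (\<rho> j) \<subseteq> cball x (2 * r)" if "y \<in> B0" for y j
    using that \<rho>0(2)[of j] unfolding B0_def by (auto simp: dist_commute) (smt (verit) dist_triangle dist_commute)
  have G: "big y (J y)" "0 < J y" "\<not> big y (J y - 1)" "5 * R y = \<rho> (J y - 1)" if "y \<in> G" for y
  proof -
    from that obtain j where "big y j" by (auto simp: G_def)
    then show big: "big y (J y)" unfolding J_def by (rule LeastI)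
    have "y \<in> B0" using that by (auto simp: G_def S_def)
    \<comment> \<open>The initial radius never stops, because \<open>A1 < l\<close>. Hence a
      stopping index has a predecessor, on whose ball the average is still at most
      \<open>l\<close>.\<close>
    have "\<not> big y 0"
    proof -
      have "ball_integral h y (\<rho> 0) \<le> ball_integral h x (2 * r)"
        using sub[OF \<open>y \<in> B0\<close>, of 0] by (intro nn_integral_mono) (auto split: split_indicator)
      also note double
      also have "ennreal A1 * ball_vol x r \<le> ennreal l * ball_vol x r"
        using A1l by (intro mult_right_mono ennreal_leI) auto
      finally show ?thesis by (simp add: big_def \<rho>_def v_def not_less)
    qed
    with big show J0: "0 < J y" by (metis gr0I)
    then show "\<not> big y (J y - 1)" unfolding J_def by (intro not_less_Least) auto
    show "5 * R y = \<rho> (J y - 1)"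
      using J0 by (cases "J y") (auto simp: R_def \<rho>_def)
  qed
  have "\<And>y. y \<in> G \<Longrightarrow> 0 < R y \<and> R y \<le> r" using \<rho>0 by (simp add: R_def)
  then obtain C where C: "countable C" "C \<subseteq> G" "disjoint_family_on (\<lambda>y. cball y (R y)) C"
    "G \<subseteq> (\<Union>y\<in>C. cball y (5 * R y))"
    by (rule Vitali_selection)
  have "emeasure lborel G \<le> (\<integral>\<^sup>+y. emeasure lborel (G \<inter> cball y (5 * R y)) \<partial>count_space C)"
    using C by (intro emeasure_le_countable_cover) auto
  also have "\<dots> \<le> (\<integral>\<^sup>+y. ennreal ((1 / 2) ^ k) * ball_vol y (5 * R y) \<partial>count_space C)"
  proof (rule nn_integral_mono)
    fix y assume "y \<in> space (count_space C)"
    then have "y \<in> G" using C by auto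
    have R5: "0 < 5 * R y" using \<rho>0(1) by (simp add: R_def)
    \<comment> \<open>The last ball before stopping has average at most \<open>l\<close>, so its
      centre value has moved by at most \<open>A + l \<le> 2 * l\<close>. This uses up one of the
      \<open>Suc k\<close> steps of height \<open>2 * l\<close> and leaves \<open>k\<close> for the
      induction hypothesis.\<close>
    have "norm (m y (5 * R y) - m x r) \<le> A + l"
      using G(3)[OF \<open>y \<in> G\<close>] R5 l0 unfolding big_def not_less
      by (intro norm_diff_le) (auto simp: G(4)[OF \<open>y \<in> G\<close>] vol h_def)
    then have nd: "norm (m y (5 * R y) - m x r) \<le> 2 * l" using l0 by simp
    have "G \<inter> cball y (5 * R y) \<subseteq> {z \<in> cball y (5 * R y). real k * (2 * jn_level) < norm (b z - m y (5 * R y))}"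
    proof safe
      fix z assume z: "z \<in> G" "z \<in> cball y (5 * R y)"
      have "real (Suc k) * (2 * l) < norm (b z - m x r)" using z by (simp add: G_def S_def)
      also have "\<dots> \<le> norm (b z - m y (5 * R y)) + norm (m y (5 * R y) - m x r)"
        using norm_triangle_ineq[of "b z - m y (5 * R y)" "m y (5 * R y) - m x r"] by simp
      finally show "real k * (2 * jn_level) < norm (b z - m y (5 * R y))"
        using nd by (simp add: algebra_simps l_def)
    qed
    then have "emeasure lborel (G \<inter> cball y (5 * R y)) \<le>
        emeasure lborel {z \<in> cball y (5 * R y). real k * (2 * jn_level) < norm (b z - m y (5 * R y))}"
      by (rule emeasure_mono) measurable
    also have "\<dots> \<le> ennreal ((1 / 2) ^ k) * ball_vol y (5 * R y)"
      by (rule Suc.IH[OF R5])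
    finally show "emeasure lborel (G \<inter> cball y (5 * R y)) \<le> ennreal ((1 / 2) ^ k) * ball_vol y (5 * R y)" .
  qed
  finally have "ennreal l * emeasure lborel G \<le>
      ennreal l * (\<integral>\<^sup>+y. ennreal ((1 / 2) ^ k) * ball_vol y (5 * R y) \<partial>count_space C)"
    by (rule mult_left_mono) simp
  also have "\<dots> = (\<integral>\<^sup>+y. ennreal l * (ennreal ((1 / 2) ^ k) * ball_vol y (5 * R y)) \<partial>count_space C)"
    by (simp add: nn_integral_cmult)
  also have "\<dots> \<le> (\<integral>\<^sup>+y. ennreal (5 ^ DIM('a) * (1 / 2) ^ k) * ball_integral h y (R y) \<partial>count_space C)"
  proof (rule nn_integral_mono)
    fix y assume "y \<in> space (count_space C)"
    then have "y \<in> G" using C by auto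
    \<comment> \<open>The stopping condition is used in the other direction: volumes of the small
      disjoint balls are paid for by integrals of \<open>h\<close>, which add up inside the double
      ball.\<close>
    have "ennreal l * ball_vol y (R y) \<le> ball_integral h y (R y)"
      using G(1)[OF \<open>y \<in> G\<close>] by (simp add: big_def R_def vol)
    then have "ennreal (5 ^ DIM('a) * (1 / 2) ^ k) * (ennreal l * ball_vol y (R y)) \<le>
       ennreal (5 ^ DIM('a) * (1 / 2) ^ k) * ball_integral h y (R y)"
      by (rule mult_left_mono) simp
    moreover have "ennreal l * (ennreal ((1 / 2) ^ k) * ball_vol y (5 * R y)) =
       ennreal (5 ^ DIM('a) * (1 / 2) ^ k) * (ennreal l * ball_vol y (R y))"
    proof -
      have "ball_vol y (5 * R y) = ennreal (5 ^ DIM('a)) * ball_vol y (R y)"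
        using \<rho>0(1)[of "J y"] by (intro emeasure_cball_scale) (auto simp: R_def)
      moreover have "ennreal (5 ^ DIM('a) * (1 / 2) ^ k) = ennreal (5 ^ DIM('a)) * ennreal ((1 / 2) ^ k)"
        by (intro ennreal_mult) auto
      ultimately show ?thesis by (simp only: mult_ac)
    qed
    ultimately show "ennreal l * (ennreal ((1 / 2) ^ k) * ball_vol y (5 * R y)) \<le>
      ennreal (5 ^ DIM('a) * (1 / 2) ^ k) * ball_integral h y (R y)" by simp
  qed
  also have "\<dots> = ennreal (5 ^ DIM('a) * (1 / 2) ^ k) *
      (\<integral>\<^sup>+y. \<integral>\<^sup>+z. h z * indicator (cball y (R y)) z \<partial>lborel \<partial>count_space C)"
    by (simp add: nn_integral_cmult)
  also have "\<dots> \<le> ennreal (5 ^ DIM('a) * (1 / 2) ^ k) * ball_integral h x (2 * r)"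
  proof (intro mult_left_mono nn_integral_disjoint_family_le C)
    show "cball y (R y) \<subseteq> cball x (2 * r)" if "y \<in> C" for y
      using sub[of y "J y"] that C by (auto simp: G_def S_def R_def)
  qed auto
  also have "\<dots> \<le> ennreal (5 ^ DIM('a) * (1 / 2) ^ k) * (ennreal A1 * ball_vol x r)"
    by (intro mult_left_mono double) simp
  also have "\<dots> = ennreal l * (ennreal ((1 / 2) ^ Suc k) * ball_vol x r)"
  proof -
    have "ennreal (5 ^ DIM('a) * (1 / 2) ^ k) * ennreal A1 = ennreal l * ennreal ((1 / 2) ^ Suc k)"
      using \<open>0 < A1\<close> l0 by (subst (1 2) ennreal_mult[symmetric]) (auto simp: l)
    then show ?thesis by (simp add: mult.assoc[symmetric])
  qed
  finally have "emeasure lborel G \<le> ennreal ((1 / 2) ^ Suc k) * ball_vol x r"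
    using l0 by (subst (asm) ennreal_mult_le_mult_iff) auto
  then show ?case
    using SG by (simp add: S_def B0_def l_def)
qed

text \<open>On the set where the oscillation lies between \<open>k * L\<close> and
  \<open>Suc k * L\<close> the power grows polynomially in \<open>k\<close>, while the measure
  decays geometrically.\<close>

lemma John_Nirenberg_power:
  assumes s: "0 < s"
  obtains C where "0 < C" "\<And>x r. 0 < r \<Longrightarrow>
    (ball_integral (\<lambda>y. epow (enorm (b y - m x r)) s) x r)
      \<le> ennreal C * ball_vol x r"
proof -
  define L where "L = 2 * jn_level"
  have L: "0 < L" using jn_level_pos by (simp add: L_def)
  define a where "a k = (real (Suc k) * L) powr s * (1 / 2) ^ k" for k :: nat
  \<comment> \<open>Any ratio strictly between 1/2 and 1 absorbs the polynomial factor.\<close>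
  have "(\<lambda>k. (real (Suc k) * L) powr s * (1 / 2) ^ k) \<in> O(\<lambda>k. (3 / 4) ^ k)"
    using L s by real_asymp
  then have sum: "summable a"
    unfolding a_def by (rule summable_comparison_test_bigo[rotated]) (simp add: summable_geometric)
  have a0: "0 \<le> a k" for k using L by (simp add: a_def)
  define C where "C = suminf a"
  have C: "0 < C"
    unfolding C_def by (intro suminf_pos sum) (use L in \<open>auto simp: a_def\<close>)
  have "ball_integral (\<lambda>y. epow (enorm (b y - m x r)) s) x r
      \<le> ennreal C * ball_vol x r" if r: "0 < r" for x r
  proof -
    define S where "S k = {y \<in> cball x r. real k * L < norm (b y - m x r)}" for k
    have [measurable]: "S k \<in> sets borel" for k unfolding S_def by measurable
    have "epow (enorm (b y - m x r)) s * indicator (cball x r) y \<le>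
        (\<Sum>k. ennreal ((real (Suc k) * L) powr s) * indicator (S k) y)" for y
    proof (cases "y \<in> cball x r \<and> b y \<noteq> m x r")
      case True
      define v where "v = norm (b y - m x r)"
      have v: "0 < v" using True by (simp add: v_def)
      \<comment> \<open>The ceiling minus one, and not the floor: the level sets \<open>S k\<close>
        are defined by a strict inequality, so \<open>k * L < v\<close> must be strict.\<close>
      define k where "k = nat (\<lceil>v / L\<rceil> - 1)"
      have "0 < v / L" using v L by simp
      then have ck: "real k = of_int \<lceil>v / L\<rceil> - 1" by (simp add: k_def)
      have "real k < v / L" "v / L \<le> real k + 1" using ck by linarith+
      then have k: "real k * L < v" "v \<le> real (Suc k) * L"
        using L by (auto simp: field_simps)
      have "epow (ennreal v) s \<le> ennreal ((real (Suc k) * L) powr s)"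
        using k v s by (auto simp: epow_ennreal intro!: ennreal_leI powr_mono2)
      also have "\<dots> = (\<Sum>j\<in>{k}. ennreal ((real (Suc j) * L) powr s) * indicator (S j) y)"
        using k True by (simp add: S_def v_def)
      also have "\<dots> \<le> (\<Sum>k. ennreal ((real (Suc k) * L) powr s) * indicator (S k) y)"
        by (intro sum_le_suminf) auto
      finally show ?thesis using True by (simp add: v_def)
    qed (auto split: split_indicator)
    then have "ball_integral (\<lambda>y. epow (enorm (b y - m x r)) s) x r \<le>
       (\<integral>\<^sup>+y. (\<Sum>k. ennreal ((real (Suc k) * L) powr s) * indicator (S k) y) \<partial>lborel)"
      by (intro nn_integral_mono)
    also have "\<dots> = (\<Sum>k. ennreal ((real (Suc k) * L) powr s) * emeasure lborel (S k))"
      by (simp add: nn_integral_suminf nn_integral_cmult_indicator)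
    also have "\<dots> \<le> (\<Sum>k. ennreal (a k) * ball_vol x r)"
    proof (intro suminf_le)
      fix k
      have "ennreal ((real (Suc k) * L) powr s) * emeasure lborel (S k) \<le>
         ennreal ((real (Suc k) * L) powr s) * (ennreal ((1 / 2) ^ k) * ball_vol x r)"
        unfolding S_def L_def by (intro mult_left_mono John_Nirenberg r) simp
      also have "\<dots> = ennreal (a k) * ball_vol x r"
        unfolding a_def by (subst ennreal_mult) (auto simp: mult.assoc)
      finally show "ennreal ((real (Suc k) * L) powr s) * emeasure lborel (S k) \<le> ennreal (a k) * ball_vol x r" .
    qed auto
    also have "\<dots> = ennreal C * ball_vol x r"
      using sum a0 by (simp add: C_def suminf_ennreal2)
    finally show ?thesis .
  qed
  with C show thesis by (rule that)
qed

end

section \<open>Linear potentials\<close>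

lemma epow_add_le:
  assumes "0 < s"
  shows "epow (x + y) s \<le> ennreal (2 powr s) * (epow x s + epow y s)"
proof -
  have "x + y \<le> 2 * max x y" by (simp add: mult_2 add_mono)
  then have "epow (x + y) s \<le> epow (2 * max x y) s" using assms by (intro epow_mono) auto
  also have "\<dots> = ennreal (2 powr s) * epow (max x y) s"
    using assms epow_ennreal[of 2 s] by (simp add: epow_mult)
  also have "epow (max x y) s \<le> epow x s + epow y s" by (auto simp: max_def add_increasing add_increasing2)
  finally show ?thesis by (simp add: mult_left_mono)
qed

text \<open>The analytic core of Hedberg's argument. The line is split at the point where the
  growing and the decaying exponential coincide; each half contributes their common value there,
  divided by its rate.\<close>

lemma nn_integral_min_exp_le:
  assumes a: "0 < a" and c: "0 < c"
  shows "(\<integral>\<^sup>+u. min (ennreal (exp (a * u)) * X) (ennreal (exp (- c * u)) * N) \<partial>lborel) \<le>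
    ennreal (1 / a + 1 / c) * (epow X (c / (a + c)) * epow N (a / (a + c)))"
proof -
  have pos: "0 < 1 / a + 1 / c" using a c by (simp add: add_pos_pos)
  consider "X = 0 \<or> N = 0" | "X \<noteq> 0" "N \<noteq> 0" "X = \<infinity> \<or> N = \<infinity>"
    | x n where "X = ennreal x" "N = ennreal n" "0 < x" "0 < n"
    by (metis ennreal_cases ennreal_less_zero_iff infinity_ennreal_def zero_less_iff_neq_zero)
  then show ?thesis
  proof cases
    case 1
    then show ?thesis by auto
  next
    case 2
    then have "epow X (c / (a + c)) * epow N (a / (a + c)) = \<infinity>"
      by (auto simp: ennreal_mult_eq_top_iff)
    then show ?thesis using pos by (simp add: ennreal_mult_top)
  next
    case 3
    \<comment> \<open>The balance point, where
      \<open>exp (a * U) * x = exp (- c * U) * n\<close>.\<close>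
    define U where "U = ln (n / x) / (a + c)"
    have ac: "0 < a + c" using a c by simp
    have U: "exp (t * U) = n powr (t / (a + c)) / x powr (t / (a + c))" for t
    proof -
      have "exp (t * U) = (n / x) powr (t / (a + c))" using 3 by (simp add: U_def powr_def)
      then show ?thesis using 3 by (simp add: powr_divide)
    qed
    have frac: "a / (a + c) + c / (a + c) = 1" using ac by (simp flip: add_divide_distrib)
    have e1: "exp (a * U) * x = x powr (c / (a + c)) * n powr (a / (a + c))"
    proof -
      have "x = x powr (a / (a + c)) * x powr (c / (a + c))"
        using 3 frac by (simp flip: powr_add)
      then have "exp (a * U) * x = n powr (a / (a + c)) / x powr (a / (a + c)) * (x powr (a / (a + c)) * x powr (c / (a + c)))"
        using U[of a] by metis
      then show ?thesis using 3 by simp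
    qed
    have e2: "exp (- c * U) * n = x powr (c / (a + c)) * n powr (a / (a + c))"
    proof -
      have "n = n powr (a / (a + c)) * n powr (c / (a + c))"
        using 3 frac by (simp flip: powr_add)
      moreover have "exp (- c * U) = x powr (c / (a + c)) / n powr (c / (a + c))"
        using U[of c] by (simp add: exp_minus)
      ultimately have "exp (- c * U) * n = x powr (c / (a + c)) / n powr (c / (a + c)) * (n powr (a / (a + c)) * n powr (c / (a + c)))"
        by metis
      then show ?thesis using 3 by simp
    qed
    have "(\<integral>\<^sup>+u. min (ennreal (exp (a * u)) * X) (ennreal (exp (- c * u)) * N) \<partial>lborel) \<le>
      (\<integral>\<^sup>+u. X * (ennreal (exp (a * u)) * indicator {..U} u) + N * (ennreal (exp (- c * u)) * indicator {U..} u) \<partial>lborel)"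
      by (intro nn_integral_mono) (auto split: split_indicator simp: mult.commute min.coboundedI1 min.coboundedI2)
    also have "\<dots> = X * (\<integral>\<^sup>+u. ennreal (exp (a * u)) * indicator {..U} u \<partial>lborel) +
        N * (\<integral>\<^sup>+u. ennreal (exp (- c * u)) * indicator {U..} u \<partial>lborel)"
      by (subst nn_integral_add, simp, simp, subst (1 2) nn_integral_cmult) auto
    also have "\<dots> = ennreal (x * (exp (a * U) / a) + n * (exp (- c * U) / c))"
      using 3 a c unfolding nn_integral_exp_atMost[OF a] nn_integral_exp_minus_atLeast[OF c]
      by (simp flip: ennreal_mult' ennreal_plus)
    also have "x * (exp (a * U) / a) + n * (exp (- c * U) / c) = exp (a * U) * x / a + exp (- c * U) * n / c"
      by (simp add: mult_ac)
    also have "\<dots> = (1 / a + 1 / c) * (x powr (c / (a + c)) * n powr (a / (a + c)))"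
      unfolding e1 e2 by (simp add: distrib_right)
    finally show ?thesis
      using 3 pos by (simp add: epow_ennreal ennreal_mult)
  qed
qed

text \<open>The value on the diagonal is \<open>\<infinity>\<close>.\<close>

definition riesz_kernel :: "real \<Rightarrow> 'a::euclidean_space \<Rightarrow> 'a \<Rightarrow> ennreal" where
  "riesz_kernel a x y = inverse (ennreal (norm (x - y) powr (real DIM('a) - a)))"

lemma riesz_kernel_measurable [measurable]:
  fixes f g :: "'b \<Rightarrow> 'a::euclidean_space"
  assumes [measurable]: "f \<in> borel_measurable M" "g \<in> borel_measurable M"
  shows "(\<lambda>z. riesz_kernel a (f z) (g z)) \<in> borel_measurable M"
  unfolding riesz_kernel_def by measurable

text \<open>Displays the kernel as a superposition of indicators of balls, so that potentials become
  integrals over scales of integrals over balls.\<close>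

lemma riesz_kernel_layer_cake:
  fixes x y :: "'a::euclidean_space"
  assumes "a < real DIM('a)"
  shows "riesz_kernel a x y = ennreal (real DIM('a) - a) *
    (\<integral>\<^sup>+u. ennreal (exp (- (real DIM('a) - a) * u)) * indicator (cball x (exp u)) y \<partial>lborel)"
proof -
  have "(indicator (cball x (exp u)) y :: ennreal) = indicator {u. norm (x - y) \<le> exp u} u" for u
    by (auto simp: indicator_def dist_norm)
  then show ?thesis
    using inverse_powr_layer_cake[of "real DIM('a) - a" "norm (x - y)"] assms
    by (simp add: riesz_kernel_def)
qed

abbreviation riesz_potential :: "real \<Rightarrow> ('a::euclidean_space \<Rightarrow> ennreal) \<Rightarrow> 'a \<Rightarrow> ennreal" where
  "riesz_potential a F x \<equiv> \<integral>\<^sup>+y. riesz_kernel a x y * F y \<partial>lborel"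

abbreviation commutator_potential ::
    "('a::euclidean_space \<Rightarrow> complex) \<Rightarrow> real \<Rightarrow> ('a \<Rightarrow> ennreal) \<Rightarrow> 'a \<Rightarrow> ennreal" where
  "commutator_potential b a F x \<equiv> \<integral>\<^sup>+y. enorm (b x - b y) * riesz_kernel a x y * F y \<partial>lborel"

text \<open>The norm inequality raised to the power \<open>q\<close>, so \<open>C\<close> is the
  \<open>q\<close>-th power of an operator bound; infinite integrals need no separate
  treatment.\<close>

definition strong_type :: "real \<Rightarrow> real \<Rightarrow> real \<Rightarrow> (('a::euclidean_space \<Rightarrow> ennreal) \<Rightarrow> 'a \<Rightarrow> ennreal) \<Rightarrow> bool" where
  "strong_type C p q S \<longleftrightarrow> (\<forall>F. F \<in> borel_measurable borel \<longrightarrow>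
     pow_integral q (S F) \<le> ennreal C * epow (pow_integral p F) (q / p))"

lemma strong_typeI:
  assumes "\<And>F. F \<in> borel_measurable borel \<Longrightarrow> pow_integral q (S F) \<le> ennreal C * epow (pow_integral p F) (q / p)"
  shows "strong_type C p q S"
  using assms by (simp add: strong_type_def)

lemma strong_typeD:
  assumes "strong_type C p q S" "F \<in> borel_measurable borel"
  shows "pow_integral q (S F) \<le> ennreal C * epow (pow_integral p F) (q / p)"
  using assms by (simp add: strong_type_def)

text \<open>Rounding \<open>u\<close> up to an integer enlarges the radius by at most the factor
  \<open>e\<close>.\<close>

lemma ball_integral_le_maximal:
  fixes G :: "'a::euclidean_space \<Rightarrow> ennreal"
  assumes [measurable]: "G \<in> borel_measurable borel"
  shows "ball_integral G x (exp u)
    \<le> ennreal (exp 1 ^ DIM('a)) * ball_vol x (exp u) * maximal G x"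
proof -
  define k where "k = \<lceil>u\<rceil>"
  have k: "u \<le> of_int k" "of_int k \<le> 1 + u" unfolding k_def by linarith+
  have "ball_integral G x (exp u) \<le>
      ball_integral G x (exp (of_int k))"
    using k subset_cball[of "exp u" "exp (of_int k)" x]
    by (intro nn_integral_mono) (auto split: split_indicator)
  also have "\<dots> = ball_avg G x (exp (of_int k)) * ball_vol x (exp (of_int k))"
    by (rule ball_integral_eq_avg) simp
  also have "\<dots> \<le> maximal G x * ball_vol x (exp 1 * exp u)"
    using k unfolding maximal_def
    by (intro mult_mono SUP_upper emeasure_mono subset_cball) (auto simp flip: exp_add)
  also have "ball_vol x (exp 1 * exp u) = ennreal (exp 1 ^ DIM('a)) * ball_vol x (exp u)"
    by (rule emeasure_cball_scale) auto
  finally show ?thesis by (simp add: mult_ac)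
qed

context ball_bmo
begin

lemma m_measurable_comp [measurable]:
  assumes [measurable]: "f \<in> borel_measurable M" "g \<in> borel_measurable M"
  shows "(\<lambda>z. m (f z) (exp (g z))) \<in> borel_measurable M"
proof -
  have "(\<lambda>z. case (f z, g z) of (x, u) \<Rightarrow> m x (exp u)) \<in> borel_measurable M"
    by (rule measurable_compose[OF _ m_meas]) measurable
  then show ?thesis by simp
qed

text \<open>The summand \<open>A\<close> bounds the weight from below, so that one operator
  dominates the plain potential as well, and it absorbs the difference of centre values at
  neighbouring points.\<close>

definition osc_weight :: "'a \<Rightarrow> real \<Rightarrow> 'a \<Rightarrow> ennreal" where
  "osc_weight x u y = enorm (b y - m x (exp u)) + ennreal A"

lemma osc_weight_measurable [measurable]:
  assumes [measurable]: "f \<in> borel_measurable M" "g \<in> borel_measurable M" "h \<in> borel_measurable M"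
  shows "(\<lambda>z. osc_weight (f z) (g z) (h z)) \<in> borel_measurable M"
  unfolding osc_weight_def by measurable

text \<open>By the John-Nirenberg inequality the \<open>r'\<close>-integral of the weight over a
  ball is comparable to the volume, so Hoelder treats the weight like a constant. The case of
  \<open>r\<close> near 1 feeds the maximal function, the case \<open>r = p\<close> the norm of
  \<open>F\<close>.\<close>

lemma osc_weight_Holder:
  assumes r: "1 < r" "1 < r'" "1 / r + 1 / r' = 1"
  obtains C where "0 < C" "\<And>x u F. F \<in> borel_measurable borel \<Longrightarrow>
    (ball_integral (\<lambda>y. osc_weight x u y * F y) x (exp u)) \<le>
      ennreal C * epow (ball_vol x (exp u)) (1 / r') *
      epow (ball_integral (\<lambda>y. epow (F y) r) x (exp u)) (1 / r)"
proof -
  have "0 < r'" using r by simp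
  then obtain C0 where C0: "0 < C0" "\<And>x \<rho>. 0 < \<rho> \<Longrightarrow>
    (\<integral>\<^sup>+y. epow (enorm (b y - m x \<rho>)) r' * indicator (cball x \<rho>) y \<partial>lborel)
      \<le> ennreal C0 * ball_vol x \<rho>"
    by (rule John_Nirenberg_power) (blast intro: that)
  define C1 where "C1 = 2 powr r' * (C0 + A powr r')"
  have C1: "0 < C1" using C0 by (auto simp: C1_def add_pos_nonneg)
  have ind: "epow (indicator B y) s = indicator B y" for B :: "'a set" and y s
    by (auto split: split_indicator)
  show thesis
  proof (rule that)
    show "0 < C1 powr (1 / r')" using C1 by simp
    fix x :: 'a and u :: real and F :: "'a \<Rightarrow> ennreal"
    assume [measurable]: "F \<in> borel_measurable borel"
    define B where "B = cball x (exp u)"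
    have [measurable]: "B \<in> sets borel" by (simp add: B_def)
    have w: "pow_integral r' (\<lambda>y. osc_weight x u y * indicator B y) \<le> ennreal C1 * emeasure lborel B"
    proof -
      have "pow_integral r' (\<lambda>y. osc_weight x u y * indicator B y) \<le>
        (\<integral>\<^sup>+y. ennreal (2 powr r') * (epow (enorm (b y - m x (exp u))) r' * indicator B y +
           ennreal (A powr r') * indicator B y) \<partial>lborel)"
      proof (rule nn_integral_mono)
        fix y
        show "epow (osc_weight x u y * indicator B y) r' \<le>
           ennreal (2 powr r') * (epow (enorm (b y - m x (exp u))) r' * indicator B y +
           ennreal (A powr r') * indicator B y)"
          using epow_add_le[of r' "enorm (b y - m x (exp u))" "ennreal A"] r A_pos
          by (auto simp: osc_weight_def epow_ennreal[of A] split: split_indicator)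
      qed
      also have "\<dots> = ennreal (2 powr r') * ((\<integral>\<^sup>+y. epow (enorm (b y - m x (exp u))) r' * indicator B y \<partial>lborel) +
          ennreal (A powr r') * emeasure lborel B)"
        by (simp add: nn_integral_cmult nn_integral_add nn_integral_cmult_indicator)
      also have "\<dots> \<le> ennreal (2 powr r') * (ennreal C0 * emeasure lborel B + ennreal (A powr r') * emeasure lborel B)"
        unfolding B_def by (intro mult_left_mono add_right_mono C0) auto
      also have "\<dots> = ennreal C1 * emeasure lborel B"
        using C0 by (simp add: C1_def ennreal_mult distrib_right mult.assoc)
      finally show ?thesis .
    qed
    have "(\<integral>\<^sup>+y. osc_weight x u y * F y * indicator B y \<partial>lborel) =
        (\<integral>\<^sup>+y. (F y * indicator B y) * (osc_weight x u y * indicator B y) \<partial>lborel)"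
      by (intro nn_integral_cong) (auto split: split_indicator simp: mult.commute)
    also have "\<dots> \<le> epow (pow_integral r (\<lambda>y. F y * indicator B y)) (1 / r) *
        epow (pow_integral r' (\<lambda>y. osc_weight x u y * indicator B y)) (1 / r')"
      using r by (intro nn_integral_Holder) auto
    also have "\<dots> \<le> epow (\<integral>\<^sup>+y. epow (F y) r * indicator B y \<partial>lborel) (1 / r) *
        epow (ennreal C1 * emeasure lborel B) (1 / r')"
      using r w by (intro mult_mono epow_mono) (auto simp: epow_mult ind)
    also have "epow (ennreal C1 * emeasure lborel B) (1 / r') = ennreal (C1 powr (1 / r')) * epow (emeasure lborel B) (1 / r')"
      using r C1 by (simp add: epow_mult epow_ennreal)
    finally show "ball_integral (\<lambda>y. osc_weight x u y * F y) x (exp u) \<le>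
      ennreal (C1 powr (1 / r')) * epow (ball_vol x (exp u)) (1 / r') *
      epow (ball_integral (\<lambda>y. epow (F y) r) x (exp u)) (1 / r)"
      by (simp add: B_def mult_ac)
  qed
qed

text \<open>The layer-cake form of the Riesz potential, without the factor
  \<open>DIM('a) - a\<close>, with a weight that depends on the scale: at each scale
  \<open>b\<close> is compared with its centre value at that scale.\<close>

definition osc_potential :: "real \<Rightarrow> ('a \<Rightarrow> ennreal) \<Rightarrow> 'a \<Rightarrow> ennreal" where
  "osc_potential a F x = (\<integral>\<^sup>+u. ennreal (exp (- (real DIM('a) - a) * u)) *
     ball_integral (\<lambda>y. osc_weight x u y * F y) x (exp u) \<partial>lborel)"

lemma osc_potential_measurable [measurable]:
  assumes [measurable]: "F \<in> borel_measurable borel"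
  shows "osc_potential a F \<in> borel_measurable borel"
  unfolding osc_potential_def[abs_def] by measurable

text \<open>Hedberg's argument: the integrand over \<open>u\<close> is controlled by the maximal function of \<open>F\<^bsup>r\<^esup>\<close> for
  some \<open>1 < r < p\<close> on small balls and by the \<open>p\<close>-norm of \<open>F\<close> on large ones.\<close>

lemma osc_potential_bound:
  assumes p: "1 < p" and a: "0 < a" and q: "0 < q" and pq: "1 / q = 1 / p - a / real DIM('a)"
  obtains C where "0 < C" "strong_type C p q (osc_potential a)"
proof -
  define d where "d = real DIM('a)"
  have d: "0 < d" by (simp add: d_def)
  define \<omega> where "\<omega> = unit_ball_vol (real DIM('a))"
  have \<omega>: "0 < \<omega>" unfolding \<omega>_def by (rule unit_ball_vol_DIM_pos)
  \<comment> \<open>The decay rate on large balls: the exponents \<open>- (d - a)\<close> from the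
    kernel and \<open>d / p'\<close> from Hoelder add up to
    \<open>a - d / p = - d / q\<close>.\<close>
  define c where "c = d / q"
  have c: "0 < c" using d q by (simp add: c_def)
  have ac: "a + c = d / p"
  proof -
    have "c = d * (1 / q)" by (simp add: c_def)
    also have "1 / q = 1 / p - a / d" using pq by (simp only: d_def)
    finally show ?thesis using d by (simp add: right_diff_distrib)
  qed
  \<comment> \<open>Strictly between 1 and \<open>p\<close>: above 1 for Hoelder against the weight,
    below \<open>p\<close> so that the maximal theorem holds with exponent
    \<open>p / r > 1\<close>.\<close>
  define r where "r = (1 + p) / 2"
  have r: "1 < r" "r < p" using p by (auto simp: r_def)
  define r' where "r' = 1 / (1 - 1 / r)"
  define p' where "p' = 1 / (1 - 1 / p)"
  have r': "1 < r'" "1 / r + 1 / r' = 1" using r by (auto simp: r'_def field_simps)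
  have p': "1 < p'" "1 / p + 1 / p' = 1" using p by (auto simp: p'_def field_simps)
  obtain C1 where C1: "0 < C1" "\<And>x u F. F \<in> borel_measurable borel \<Longrightarrow>
    (ball_integral (\<lambda>y. osc_weight x u y * F y) x (exp u)) \<le>
      ennreal C1 * epow (ball_vol x (exp u)) (1 / r') *
      epow (ball_integral (\<lambda>y. epow (F y) r) x (exp u)) (1 / r)"
    by (rule osc_weight_Holder[OF r(1) r']) (blast intro: that)
  obtain C2 where C2: "0 < C2" "\<And>x u F. F \<in> borel_measurable borel \<Longrightarrow>
    (ball_integral (\<lambda>y. osc_weight x u y * F y) x (exp u)) \<le>
      ennreal C2 * epow (ball_vol x (exp u)) (1 / p') *
      epow (ball_integral (\<lambda>y. epow (F y) p) x (exp u)) (1 / p)"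
    by (rule osc_weight_Holder[OF p p']) (blast intro: that)
  define D1 where "D1 = C1 * (\<omega> * exp 1 powr (d / r))"
  define D2 where "D2 = C2 * \<omega> powr (1 / p')"
  have D: "0 < D1" "0 < D2" using C1 C2 \<omega> by (auto simp: D1_def D2_def)
  define M where "M = p / r * (2 * 5 ^ DIM('a)) * (2 powr (p / r - 1) / (p / r - 1))"
  have pr: "1 < p / r" using r p by simp
  have M: "0 < M" unfolding M_def using pr r p by (intro mult_pos_pos divide_pos_pos) auto
  define E where "E = (1 / a + 1 / c) powr q * (D1 powr p * D2 powr (q - p))"
  have "0 < 1 / a + 1 / c" using a c by (simp add: add_pos_pos)
  then have E: "0 < E" unfolding E_def using D by (intro mult_pos_pos) auto
  have vol: "ball_vol x (exp u) = ennreal (\<omega> * exp (d * u))" for x :: 'a and u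
    by (simp add: emeasure_cball \<omega>_def d_def exp_of_nat_mult)
  show thesis
  proof (rule that[OF _ strong_typeI])
    show "0 < E * M" using E M by simp
    fix F :: "'a \<Rightarrow> ennreal"
    assume [measurable]: "F \<in> borel_measurable borel"
    define N where "N = pow_integral p F"
    define MG where "MG x = maximal (\<lambda>y. epow (F y) r) x" for x
    have [measurable]: "MG \<in> borel_measurable borel" unfolding MG_def[abs_def] by measurable
    have pt: "osc_potential a F x \<le> ennreal (1 / a + 1 / c) *
        (epow (ennreal D1 * epow (MG x) (1 / r)) (c / (a + c)) * epow (ennreal D2 * epow N (1 / p)) (a / (a + c)))" for x
    proof -
      have "osc_potential a F x \<le> (\<integral>\<^sup>+u. min (ennreal (exp (a * u)) * (ennreal D1 * epow (MG x) (1 / r)))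
         (ennreal (exp (- c * u)) * (ennreal D2 * epow N (1 / p))) \<partial>lborel)"
        unfolding osc_potential_def
      proof (intro nn_integral_mono min.boundedI)
        fix u
        let ?I = "\<integral>\<^sup>+y. osc_weight x u y * F y * indicator (cball x (exp u)) y \<partial>lborel"
        define v where "v = \<omega> * exp (d * u)"
        have v: "0 < v" "ball_vol x (exp u) = ennreal v"
          using \<omega> vol[of x u] by (auto simp: v_def)
        have "?I \<le> ennreal C1 * epow (ennreal v) (1 / r') *
            epow (ball_integral (\<lambda>y. epow (F y) r) x (exp u)) (1 / r)"
          using C1(2)[of F x u] by (simp add: v)
        also have "\<dots> \<le> ennreal C1 * epow (ennreal v) (1 / r') *
            epow (ennreal (exp 1 ^ DIM('a)) * ennreal v * MG x) (1 / r)"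
          using ball_integral_le_maximal[of "\<lambda>y. epow (F y) r" x u] r
          by (intro mult_left_mono epow_mono) (auto simp: v MG_def)
        also have "\<dots> = ennreal (C1 * v powr (1 / r') * ((exp 1 ^ DIM('a)) powr (1 / r) * v powr (1 / r))) * epow (MG x) (1 / r)"
          using r v(1) C1(1) by (simp add: epow_mult epow_ennreal ennreal_mult mult.assoc)
        also have "C1 * v powr (1 / r') * ((exp 1 ^ DIM('a)) powr (1 / r) * v powr (1 / r)) = exp (d * u) * D1"
        proof -
          have "v powr (1 / r') * v powr (1 / r) = v"
            using r'(2) v(1) by (subst powr_add[symmetric]) (simp add: add.commute)
          moreover have "(exp 1 ^ DIM('a)) powr (1 / r) = exp (1::real) powr (d / r)"
            by (simp add: powr_powr d_def flip: powr_realpow)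
          moreover have "C1 * v powr (1 / r') * (exp (1::real) powr (d / r) * v powr (1 / r)) =
              C1 * exp (1::real) powr (d / r) * (v powr (1 / r') * v powr (1 / r))"
            by (simp only: mult_ac)
          ultimately show ?thesis
            by (simp add: D1_def v_def mult_ac)
        qed
        finally have "ennreal (exp (- (d - a) * u)) * ?I \<le>
            ennreal (exp (- (d - a) * u)) * (ennreal (exp (d * u) * D1) * epow (MG x) (1 / r))"
          by (rule mult_left_mono) simp
        also have "\<dots> = ennreal (exp (- (d - a) * u) * exp (d * u)) * (ennreal D1 * epow (MG x) (1 / r))"
          using D by (simp add: ennreal_mult mult.assoc)
        also have "exp (- (d - a) * u) * exp (d * u) = exp (a * u)"
          by (simp add: algebra_simps flip: exp_add)
        finally show "ennreal (exp (- (real DIM('a) - a) * u)) * ?I \<le> ennreal (exp (a * u)) * (ennreal D1 * epow (MG x) (1 / r))"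
          by (simp add: d_def)
        have "?I \<le> ennreal C2 * epow (ennreal v) (1 / p') *
            epow (ball_integral (\<lambda>y. epow (F y) p) x (exp u)) (1 / p)"
          using C2(2)[of F x u] by (simp add: v)
        also have "\<dots> \<le> ennreal C2 * epow (ennreal v) (1 / p') * epow N (1 / p)"
          unfolding N_def using p
          by (intro mult_left_mono epow_mono nn_integral_mono) (auto split: split_indicator)
        also have "\<dots> = ennreal (C2 * v powr (1 / p')) * epow N (1 / p)"
          using v(1) C2(1) by (simp add: epow_ennreal ennreal_mult)
        also have "C2 * v powr (1 / p') = exp (d * u * (1 / p')) * D2"
        proof -
          have "v powr (1 / p') = \<omega> powr (1 / p') * exp (d * u) powr (1 / p')"
            using \<omega> by (simp add: v_def powr_mult)
          also have "exp (d * u) powr (1 / p') = exp (d * u * (1 / p'))"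
            by (simp add: powr_def mult.commute)
          finally show ?thesis by (simp add: D2_def)
        qed
        also have "ennreal (exp (d * u * (1 / p')) * D2) * epow N (1 / p) = ennreal (exp (d * u * (1 / p'))) * (ennreal D2 * epow N (1 / p))"
          using D by (simp add: ennreal_mult mult.assoc)
        finally have "ennreal (exp (- (d - a) * u)) * ?I \<le>
            ennreal (exp (- (d - a) * u)) * (ennreal (exp (d * u * (1 / p'))) * (ennreal D2 * epow N (1 / p)))"
          by (rule mult_left_mono) simp
        also have "\<dots> = ennreal (exp (- (d - a) * u) * exp (d * u * (1 / p'))) * (ennreal D2 * epow N (1 / p))"
          by (simp add: ennreal_mult mult.assoc)
        also have "exp (- (d - a) * u) * exp (d * u * (1 / p')) = exp (- c * u)"
        proof -
          have 1: "1 / p' = 1 - 1 / p" using p'(2) by simp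
          have 2: "c = d / p - a" using ac by simp
          have "- (d - a) * u + d * u * (1 / p') = - c * u"
            unfolding 1 2 by (simp add: algebra_simps)
          then show ?thesis by (metis exp_add)
        qed
        finally show "ennreal (exp (- (real DIM('a) - a) * u)) * ?I \<le> ennreal (exp (- c * u)) * (ennreal D2 * epow N (1 / p))"
          by (simp add: d_def)
      qed
      also have "\<dots> \<le> ennreal (1 / a + 1 / c) *
        (epow (ennreal D1 * epow (MG x) (1 / r)) (c / (a + c)) * epow (ennreal D2 * epow N (1 / p)) (a / (a + c)))"
        by (rule nn_integral_min_exp_le[OF a c])
      finally show ?thesis .
    qed
    \<comment> \<open>The relation between \<open>p\<close> and \<open>q\<close> makes the maximal
      function appear with total power exactly \<open>p\<close>; the remaining power
      \<open>q - p\<close> falls on the norm of \<open>F\<close>.\<close>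
    have ex1: "c / (a + c) * q = p" unfolding ac using d q p by (simp add: c_def)
    have ex2: "a / (a + c) * q = q - p"
    proof -
      have "a / (a + c) + c / (a + c) = 1" using a c by (simp flip: add_divide_distrib)
      then have "a / (a + c) * q + c / (a + c) * q = q" by (metis distrib_right mult_1)
      then show ?thesis using ex1 by simp
    qed
    have qp: "0 < q - p" unfolding ex2[symmetric] using a c q by simp
    have "pow_integral q (osc_potential a F) \<le>
        (\<integral>\<^sup>+x. ennreal E * epow N ((q - p) / p) * epow (MG x) (p / r) \<partial>lborel)"
    proof (rule nn_integral_mono)
      fix x
      have "epow (osc_potential a F x) q \<le> epow (ennreal (1 / a + 1 / c) *
        (epow (ennreal D1 * epow (MG x) (1 / r)) (c / (a + c)) * epow (ennreal D2 * epow N (1 / p)) (a / (a + c)))) q"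
        using q by (intro epow_mono pt) auto
      also have "\<dots> = ennreal ((1 / a + 1 / c) powr q) *
        (epow (ennreal D1 * epow (MG x) (1 / r)) p * epow (ennreal D2 * epow N (1 / p)) (q - p))"
      proof -
        have "epow (z * (epow X t1 * epow Y t2)) q = epow z q * (epow X (t1 * q) * epow Y (t2 * q))" for z X Y t1 t2
          using q by (simp add: epow_mult epow_epow)
        moreover have "epow (ennreal (1 / a + 1 / c)) q = ennreal ((1 / a + 1 / c) powr q)"
          using a c by (intro epow_ennreal) simp
        ultimately show ?thesis by (simp only: ex1 ex2)
      qed
      also have "\<dots> = ennreal ((1 / a + 1 / c) powr q) *
        ((ennreal (D1 powr p) * epow (MG x) (p / r)) * (ennreal (D2 powr (q - p)) * epow N ((q - p) / p)))"
        using p qp D by (simp add: epow_mult epow_epow epow_ennreal)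
      also have "\<dots> = ennreal E * epow N ((q - p) / p) * epow (MG x) (p / r)"
        by (simp add: E_def ennreal_mult mult_ac)
      finally show "epow (osc_potential a F x) q \<le> ennreal E * epow N ((q - p) / p) * epow (MG x) (p / r)" .
    qed
    also have "\<dots> = ennreal E * epow N ((q - p) / p) * pow_integral (p / r) MG"
      by (simp add: nn_integral_cmult)
    also have "pow_integral (p / r) MG \<le> ennreal M * N"
      using maximal_strong_type[of "\<lambda>y. epow (F y) r" "p / r"] pr r
      by (simp add: MG_def N_def M_def epow_epow)
    also have "ennreal E * epow N ((q - p) / p) * (ennreal M * N) = ennreal (E * M) * (epow N ((q - p) / p) * epow N 1)"
      using E M by (simp add: ennreal_mult mult_ac)
    also have "epow N ((q - p) / p) * epow N 1 = epow N (q / p)"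
      using p by (subst epow_add[symmetric]) (simp add: diff_divide_distrib)
    finally show "pow_integral q (osc_potential a F) \<le> ennreal (E * M) * epow (pow_integral p F) (q / p)"
      by (simp add: N_def mult_left_mono)
  qed
qed

end

section \<open>The Riesz potential and the commutator potential\<close>

context ball_bmo
begin

lemma riesz_potential_le_osc_potential:
  assumes a: "a < real DIM('a)" and [measurable]: "F \<in> borel_measurable borel"
  shows "(riesz_potential a F x) \<le> ennreal ((real DIM('a) - a) / A) * osc_potential a F x"
proof -
  define s where "s = real DIM('a) - a"
  have s: "0 < s" using a by (simp add: s_def)
  have sA: "ennreal s = ennreal (s / A) * ennreal A"
    using s A_pos by (simp flip: ennreal_mult')
  have "(riesz_potential a F x) =
    (\<integral>\<^sup>+y. (\<integral>\<^sup>+u. ennreal s * (ennreal (exp (- s * u)) * (F y * indicator (cball x (exp u)) y)) \<partial>lborel) \<partial>lborel)"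
    unfolding riesz_kernel_layer_cake[OF a] s_def[symmetric]
    by (subst nn_integral_cmult[symmetric], simp, subst nn_integral_multc[symmetric])
       (auto simp: mult_ac)
  also have "\<dots> = (\<integral>\<^sup>+u. (\<integral>\<^sup>+y. ennreal s * (ennreal (exp (- s * u)) * (F y * indicator (cball x (exp u)) y)) \<partial>lborel) \<partial>lborel)"
    by (rule lborel_pair.Fubini') simp
  also have "\<dots> \<le> (\<integral>\<^sup>+u. (\<integral>\<^sup>+y. ennreal (s / A) * (ennreal (exp (- s * u)) * (osc_weight x u y * F y * indicator (cball x (exp u)) y)) \<partial>lborel) \<partial>lborel)"
  proof (intro nn_integral_mono)
    fix u y
    have "ennreal s * (ennreal (exp (- s * u)) * (F y * indicator (cball x (exp u)) y)) =
      ennreal (s / A) * (ennreal (exp (- s * u)) * (ennreal A * F y * indicator (cball x (exp u)) y))"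
      unfolding sA by (simp add: mult_ac)
    also have "\<dots> \<le> ennreal (s / A) * (ennreal (exp (- s * u)) * (osc_weight x u y * F y * indicator (cball x (exp u)) y))"
      by (intro mult_left_mono mult_right_mono) (auto simp: osc_weight_def)
    finally show "ennreal s * (ennreal (exp (- s * u)) * (F y * indicator (cball x (exp u)) y)) \<le> \<dots>" .
  qed
  also have "\<dots> = ennreal (s / A) * osc_potential a F x"
    by (simp add: osc_potential_def s_def nn_integral_cmult)
  finally show ?thesis by (simp add: s_def)
qed

lemma order_lt_DIM:
  assumes "1 < p" "0 < q" "1 / q = 1 / p - a / real DIM('a)"
  shows "a < real DIM('a)"
proof -
  have "0 < 1 / q" using assms(2) by simp
  moreover have "1 / p < 1" using assms(1) by simp
  ultimately have "a / real DIM('a) < 1" using assms(3) by linarith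
  then show ?thesis by (simp add: divide_less_eq)
qed

text \<open>The Hardy-Littlewood-Sobolev inequality, read off from the weighted operator, whose
  weight is at least \<open>A\<close>.\<close>

theorem riesz_potential_bound:
  assumes p: "1 < p" and a: "0 < a" and q: "0 < q" and pq: "1 / q = 1 / p - a / real DIM('a)"
  obtains C where "0 < C" "strong_type C p q (riesz_potential a :: ('a \<Rightarrow> ennreal) \<Rightarrow> _)"
proof -
  obtain C where C: "0 < C" "strong_type C p q (osc_potential a)"
    by (rule osc_potential_bound[OF p a q pq]) (rule that)
  have ad: "a < real DIM('a)" by (rule order_lt_DIM[OF p q pq])
  define k where "k = (real DIM('a) - a) / A"
  have k: "0 < k" using ad A_pos by (simp add: k_def)
  show thesis
  proof (rule that[OF _ strong_typeI])
    show "0 < k powr q * C" using k C by simp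
    fix F :: "'a \<Rightarrow> ennreal"
    assume [measurable]: "F \<in> borel_measurable borel"
    have "pow_integral q (riesz_potential a F) \<le>
      pow_integral q (\<lambda>x. ennreal k * osc_potential a F x)"
      unfolding k_def using q by (intro nn_integral_mono epow_mono riesz_potential_le_osc_potential ad) auto
    also have "\<dots> = ennreal (k powr q) * pow_integral q (osc_potential a F)"
      using q k by (simp add: epow_mult epow_ennreal nn_integral_cmult)
    also have "\<dots> \<le> ennreal (k powr q) * (ennreal C * epow (pow_integral p F) (q / p))"
      by (intro mult_left_mono strong_typeD[OF C(2)]) auto
    finally show "pow_integral q (riesz_potential a F) \<le>
      ennreal (k powr q * C) * epow (pow_integral p F) (q / p)"
      using C k by (simp add: ennreal_mult mult.assoc)
  qed
qed

text \<open>The balls of radius \<open>exp u\<close> around \<open>x\<close> and \<open>y\<close>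
  both lie in the double ball around \<open>y\<close>, so their centre values differ by at most
  \<open>2 * (A * K)\<close>. The two summands \<open>A\<close> in the weights, multiplied by
  \<open>K\<close>, absorb exactly this.\<close>

lemma norm_diff_le_osc_weights:
  assumes "norm (x - y) \<le> exp u"
  shows "enorm (b x - b y) \<le> ennreal (1 + 2 ^ DIM('a)) * (osc_weight x u y + osc_weight y u x)"
proof -
  define K :: real where "K = 1 + 2 ^ DIM('a)"
  define \<rho> where "\<rho> = exp u"
  have \<rho>: "0 < \<rho>" by (simp add: \<rho>_def)
  have K: "1 \<le> K" by (simp add: K_def)
  have xy: "dist x y \<le> \<rho>" using assms by (simp add: dist_norm \<rho>_def)
  have "cball x \<rho> \<subseteq> cball y (2 * \<rho>)"
  proof
    fix z assume "z \<in> cball x \<rho>"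
    then show "z \<in> cball y (2 * \<rho>)"
      using xy dist_triangle[of y z x] by (simp add: dist_commute)
  qed
  moreover have "cball y \<rho> \<subseteq> cball y (2 * \<rho>)" using \<rho> by (intro subset_cball) auto
  ultimately have "norm (m x \<rho> - m y (2 * \<rho>)) \<le> A * K" "norm (m y \<rho> - m y (2 * \<rho>)) \<le> A * K"
    using \<rho> unfolding K_def by (auto intro!: norm_mean_diff_le)
  then have mm: "norm (m y \<rho> - m x \<rho>) \<le> 2 * (A * K)"
    using norm_triangle_ineq4[of "m y \<rho> - m y (2 * \<rho>)" "m x \<rho> - m y (2 * \<rho>)"] by simp
  have "norm (b x - b y) = norm ((b x - m y \<rho>) + (m y \<rho> - m x \<rho>) - (b y - m x \<rho>))" by simp
  then have "norm (b x - b y) \<le> norm (b x - m y \<rho>) + norm (m y \<rho> - m x \<rho>) + norm (b y - m x \<rho>)"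
    using norm_triangle_ineq4[of "(b x - m y \<rho>) + (m y \<rho> - m x \<rho>)" "b y - m x \<rho>"]
      norm_triangle_ineq[of "b x - m y \<rho>" "m y \<rho> - m x \<rho>"] by linarith
  also have "\<dots> \<le> 1 * norm (b x - m y \<rho>) + 2 * (A * K) + 1 * norm (b y - m x \<rho>)"
    using mm by simp
  also have "\<dots> \<le> K * norm (b x - m y \<rho>) + 2 * (A * K) + K * norm (b y - m x \<rho>)"
    using K A_pos by (intro add_mono mult_right_mono) auto
  also have "\<dots> = K * ((norm (b y - m x \<rho>) + A) + (norm (b x - m y \<rho>) + A))"
    by (simp add: algebra_simps)
  finally have "enorm (b x - b y) \<le> ennreal (K * ((norm (b y - m x \<rho>) + A) + (norm (b x - m y \<rho>) + A)))"
    by (rule ennreal_leI)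
  also have "\<dots> = ennreal K * (osc_weight x u y + osc_weight y u x)"
  proof -
    have "0 \<le> norm (b y - m x \<rho>) + A" "0 \<le> norm (b x - m y \<rho>) + A" using A_pos by simp_all
    then show ?thesis
      using A_pos K by (simp add: osc_weight_def \<rho>_def ennreal_mult ennreal_plus[symmetric] del: ennreal_plus)
  qed
  finally show ?thesis by (simp add: K_def)
qed

text \<open>Each of the two halves of the oscillation is centred at one of the two variables, so the
  form is controlled by the same potential acting on \<open>F\<close> and, after exchanging the variables, on \<open>g\<close>.\<close>

lemma commutator_form_le:
  assumes a: "a < real DIM('a)"
    and [measurable]: "F \<in> borel_measurable borel" "g \<in> borel_measurable borel"
  shows "(\<integral>\<^sup>+x. g x * (commutator_potential b a F x) \<partial>lborel) \<le>
    ennreal ((real DIM('a) - a) * (1 + 2 ^ DIM('a))) *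
      ((\<integral>\<^sup>+x. g x * osc_potential a F x \<partial>lborel) + (\<integral>\<^sup>+x. F x * osc_potential a g x \<partial>lborel))"
proof -
  define s where "s = real DIM('a) - a"
  have s: "0 < s" using a by (simp add: s_def)
  define K :: real where "K = 1 + 2 ^ DIM('a)"
  have K: "0 < K" by (simp add: K_def add_pos_pos)
  define e where "e u = ennreal (exp (- s * u))" for u
  have [measurable]: "e \<in> borel_measurable borel" unfolding e_def[abs_def] by measurable
  define T where "T F g x u y = g x * (e u * (osc_weight x u y * F y * indicator (cball x (exp u)) y))"
    for F g :: "'a \<Rightarrow> ennreal" and x y :: 'a and u
  have T: "(\<integral>\<^sup>+x. \<integral>\<^sup>+y. \<integral>\<^sup>+u. T F g x u y \<partial>lborel \<partial>lborel \<partial>lborel) = (\<integral>\<^sup>+x. g x * osc_potential a F x \<partial>lborel)"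
    if [measurable]: "F \<in> borel_measurable borel" "g \<in> borel_measurable borel" for F g
  proof (rule nn_integral_cong)
    fix x
    have "(\<integral>\<^sup>+y. \<integral>\<^sup>+u. T F g x u y \<partial>lborel \<partial>lborel) = (\<integral>\<^sup>+u. \<integral>\<^sup>+y. T F g x u y \<partial>lborel \<partial>lborel)"
      unfolding T_def by (rule lborel_pair.Fubini') simp
    also have "\<dots> = g x * osc_potential a F x"
      unfolding T_def osc_potential_def s_def[symmetric] e_def[symmetric]
      by (subst nn_integral_cmult, simp, subst nn_integral_cmult) (auto simp: nn_integral_cmult)
    finally show "(\<integral>\<^sup>+y. \<integral>\<^sup>+u. T F g x u y \<partial>lborel \<partial>lborel) = g x * osc_potential a F x" .
  qed
  have "(\<integral>\<^sup>+x. g x * (commutator_potential b a F x) \<partial>lborel) =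
    (\<integral>\<^sup>+x. \<integral>\<^sup>+y. \<integral>\<^sup>+u. ennreal s * (g x * (e u * (enorm (b x - b y) * F y * indicator (cball x (exp u)) y))) \<partial>lborel \<partial>lborel \<partial>lborel)"
  proof (rule nn_integral_cong)
    fix x
    have "g x * (commutator_potential b a F x) =
      (\<integral>\<^sup>+y. g x * (enorm (b x - b y) * riesz_kernel a x y * F y) \<partial>lborel)"
      by (simp add: nn_integral_cmult)
    also have "\<dots> = (\<integral>\<^sup>+y. \<integral>\<^sup>+u. ennreal s * (g x * (e u * (enorm (b x - b y) * F y * indicator (cball x (exp u)) y))) \<partial>lborel \<partial>lborel)"
    proof (rule nn_integral_cong)
      fix y
      have "g x * (enorm (b x - b y) * riesz_kernel a x y * F y) =
        (g x * enorm (b x - b y) * F y * ennreal s) * (\<integral>\<^sup>+u. e u * indicator (cball x (exp u)) y \<partial>lborel)"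
        unfolding riesz_kernel_layer_cake[OF a] s_def[symmetric] e_def by (simp only: mult_ac)
      also have "\<dots> = (\<integral>\<^sup>+u. (g x * enorm (b x - b y) * F y * ennreal s) * (e u * indicator (cball x (exp u)) y) \<partial>lborel)"
        by (intro nn_integral_cmult[symmetric]) simp
      finally show "g x * (enorm (b x - b y) * riesz_kernel a x y * F y) =
        (\<integral>\<^sup>+u. ennreal s * (g x * (e u * (enorm (b x - b y) * F y * indicator (cball x (exp u)) y))) \<partial>lborel)"
        by (simp only: mult_ac)
    qed
    finally show "g x * (commutator_potential b a F x) = \<dots>" .
  qed
  also have "\<dots> \<le> (\<integral>\<^sup>+x. \<integral>\<^sup>+y. \<integral>\<^sup>+u. ennreal (s * K) * (T F g x u y + T g F y u x) \<partial>lborel \<partial>lborel \<partial>lborel)"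
  proof (intro nn_integral_mono)
    fix x y u
    show "ennreal s * (g x * (e u * (enorm (b x - b y) * F y * indicator (cball x (exp u)) y))) \<le>
      ennreal (s * K) * (T F g x u y + T g F y u x)"
    proof (cases "y \<in> cball x (exp u)")
      case True
      then have sym: "x \<in> cball y (exp u)" by (simp add: dist_commute)
      have "enorm (b x - b y) \<le> ennreal K * (osc_weight x u y + osc_weight y u x)"
        unfolding K_def using True by (intro norm_diff_le_osc_weights) (simp add: dist_norm)
      then have "ennreal s * (g x * (e u * (enorm (b x - b y) * F y))) \<le>
         ennreal s * (g x * (e u * ((ennreal K * (osc_weight x u y + osc_weight y u x)) * F y)))"
        by (intro mult_left_mono mult_right_mono) auto
      also have "\<dots> = ennreal (s * K) * (T F g x u y + T g F y u x)"
        using True sym s K by (simp add: T_def ennreal_mult distrib_left distrib_right mult_ac)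
      finally show ?thesis using True by simp
    qed simp
  qed
  also have "\<dots> = ennreal (s * K) * ((\<integral>\<^sup>+x. \<integral>\<^sup>+y. \<integral>\<^sup>+u. T F g x u y \<partial>lborel \<partial>lborel \<partial>lborel) +
      (\<integral>\<^sup>+x. \<integral>\<^sup>+y. \<integral>\<^sup>+u. T g F y u x \<partial>lborel \<partial>lborel \<partial>lborel))"
    unfolding T_def by (simp add: nn_integral_cmult nn_integral_add)
  also have "(\<integral>\<^sup>+x. \<integral>\<^sup>+y. \<integral>\<^sup>+u. T g F y u x \<partial>lborel \<partial>lborel \<partial>lborel) = (\<integral>\<^sup>+y. \<integral>\<^sup>+x. \<integral>\<^sup>+u. T g F y u x \<partial>lborel \<partial>lborel \<partial>lborel)"
    unfolding T_def by (rule lborel_pair.Fubini') measurable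
  finally show ?thesis
    by (simp add: T s_def K_def)
qed

theorem commutator_potential_bound:
  assumes p: "1 < p" and a: "0 < a" and q: "0 < q" and pq: "1 / q = 1 / p - a / real DIM('a)"
  obtains C where "0 < C" "strong_type C p q (commutator_potential b a)"
proof -
  have ad: "a < real DIM('a)" by (rule order_lt_DIM[OF p q pq])
  have "1 / q < 1 / p" unfolding pq using a by simp
  then have pltq: "p < q" using p q by (simp add: divide_less_eq_1 field_simps)
  define p' where "p' = 1 / (1 - 1 / p)"
  define q' where "q' = 1 / (1 - 1 / q)"
  have p': "1 < p'" "1 / p + 1 / p' = 1" using p by (auto simp: p'_def field_simps)
  have q': "1 < q'" "1 / q + 1 / q' = 1" using p pltq by (auto simp: q'_def field_simps)
  \<comment> \<open>The exponent relation is invariant under passing to the dual pair, so the bound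
    for \<open>osc_potential\<close> holds from \<open>q'\<close> to \<open>p'\<close> as well and
    serves the half in which it acts on \<open>g\<close>.\<close>
  have dual: "1 / p' = 1 / q' - a / real DIM('a)" using p'(2) q'(2) pq by linarith
  have p'0: "0 < p'" using p' by simp
  obtain C1 where C1: "0 < C1" "strong_type C1 p q (osc_potential a)"
    by (rule osc_potential_bound[OF p a q pq]) (rule that)
  obtain C2 where C2: "0 < C2" "strong_type C2 q' p' (osc_potential a)"
    by (rule osc_potential_bound[OF q'(1) a p'0 dual]) (rule that)
  define D where "D = C1 powr (1 / q) + C2 powr (1 / p')"
  define k where "k = (real DIM('a) - a) * (1 + 2 ^ DIM('a))"
  have D: "0 < D" using C1 C2 by (simp add: D_def add_pos_pos)
  have k: "0 < k" using ad by (simp add: k_def add_pos_pos)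
  show thesis
  proof (rule that[OF _ strong_typeI])
    show "0 < (k * D) powr q" using k D by simp
    fix F :: "'a \<Rightarrow> ennreal"
    assume [measurable]: "F \<in> borel_measurable borel"
    define N where "N = pow_integral p F"
    have "pow_integral q (commutator_potential b a F) \<le>
       epow (ennreal (k * D) * epow N (1 / p)) q"
    proof (rule nn_integral_epow_le_dual[OF _ _ q'])
      fix g :: "'a \<Rightarrow> ennreal"
      assume [measurable]: "g \<in> borel_measurable borel"
      define G where "G = pow_integral q' g"
      have "(\<integral>\<^sup>+x. g x * osc_potential a F x \<partial>lborel) \<le>
          epow G (1 / q') * epow (pow_integral q (osc_potential a F)) (1 / q)"
        unfolding G_def using q' p pltq by (intro nn_integral_Holder) auto
      also have "\<dots> \<le> epow G (1 / q') * epow (ennreal C1 * epow N (q / p)) (1 / q)"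
        unfolding N_def using q by (intro mult_left_mono epow_mono strong_typeD[OF C1(2)]) auto
      also have "\<dots> = ennreal (C1 powr (1 / q)) * (epow N (1 / p) * epow G (1 / q'))"
        using q C1 by (simp add: epow_mult epow_epow epow_ennreal mult_ac)
      finally have 1: "(\<integral>\<^sup>+x. g x * osc_potential a F x \<partial>lborel) \<le> ennreal (C1 powr (1 / q)) * (epow N (1 / p) * epow G (1 / q'))" .
      have "(\<integral>\<^sup>+x. F x * osc_potential a g x \<partial>lborel) \<le>
          epow N (1 / p) * epow (pow_integral p' (\<lambda>x. osc_potential a g x)) (1 / p')"
        unfolding N_def using p p' by (intro nn_integral_Holder) auto
      also have "\<dots> \<le> epow N (1 / p) * epow (ennreal C2 * epow G (p' / q')) (1 / p')"
        unfolding G_def using p'0 by (intro mult_left_mono epow_mono strong_typeD[OF C2(2)]) auto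
      also have "\<dots> = ennreal (C2 powr (1 / p')) * (epow N (1 / p) * epow G (1 / q'))"
        using p'0 C2 by (simp add: epow_mult epow_epow epow_ennreal mult_ac)
      finally have 2: "(\<integral>\<^sup>+x. F x * osc_potential a g x \<partial>lborel) \<le> ennreal (C2 powr (1 / p')) * (epow N (1 / p) * epow G (1 / q'))" .
      have "(\<integral>\<^sup>+x. g x * (commutator_potential b a F x) \<partial>lborel) \<le>
        ennreal k * ((\<integral>\<^sup>+x. g x * osc_potential a F x \<partial>lborel) + (\<integral>\<^sup>+x. F x * osc_potential a g x \<partial>lborel))"
        unfolding k_def by (rule commutator_form_le[OF ad]) auto
      also have "\<dots> \<le> ennreal k * (ennreal (C1 powr (1 / q)) * (epow N (1 / p) * epow G (1 / q')) +
          ennreal (C2 powr (1 / p')) * (epow N (1 / p) * epow G (1 / q')))"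
        by (intro mult_left_mono add_mono 1 2) auto
      also have "\<dots> = ennreal k * (ennreal D * (epow N (1 / p) * epow G (1 / q')))"
        by (simp add: D_def distrib_right)
      also have "\<dots> = ennreal (k * D) * epow N (1 / p) * epow G (1 / q')"
        using k D by (simp add: ennreal_mult mult.assoc)
      finally show "(\<integral>\<^sup>+x. g x * (commutator_potential b a F x) \<partial>lborel) \<le>
        ennreal (k * D) * epow N (1 / p) * epow (pow_integral q' g) (1 / q')" by (simp add: G_def)
    qed (use p pltq in auto)
    also have "\<dots> = ennreal ((k * D) powr q) * epow N (q / p)"
      using q k D by (simp add: epow_mult epow_epow epow_ennreal)
    finally show "pow_integral q (commutator_potential b a F) \<le>
      ennreal ((k * D) powr q) * epow (pow_integral p F) (q / p)" by (simp add: N_def)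
  qed
qed

end

section \<open>From BMO to strong bounds\<close>

lemma sigma_finite_lebesgue: "sigma_finite_measure (lebesgue :: 'a::euclidean_space measure)"
proof
  obtain A :: "'a set set" where A: "countable A" "A \<subseteq> sets lborel" "\<Union>A = space lborel" "\<forall>a\<in>A. emeasure lborel a \<noteq> \<infinity>"
    using lborel.sigma_finite_countable by blast
  then show "\<exists>A::'a set set. countable A \<and> A \<subseteq> sets lebesgue \<and> \<Union>A = space lebesgue \<and> (\<forall>a\<in>A. emeasure lebesgue a \<noteq> \<infinity>)"
    by (intro exI[of _ A]) (auto simp: emeasure_completion subset_iff)
qed

interpretation lebesgue: sigma_finite_measure "lebesgue :: 'a::euclidean_space measure"
  by (rule sigma_finite_lebesgue)

interpretation lebesgue_pair: pair_sigma_finite "lebesgue :: 'a::euclidean_space measure" "lebesgue :: 'b::euclidean_space measure"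
  ..

lemma lebesgue_borel_representative:
  fixes f :: "'a::euclidean_space \<Rightarrow> complex"
  assumes [measurable]: "f \<in> borel_measurable lebesgue"
  obtains g where "g \<in> borel_measurable borel" "AE x in lborel. f x = g x"
proof -
  obtain u where u: "u \<in> borel_measurable lborel" "AE x in lborel. Re (f x) = u x"
    using completion_ex_borel_measurable_real[of "\<lambda>x. Re (f x)" lborel] by auto
  obtain v where v: "v \<in> borel_measurable lborel" "AE x in lborel. Im (f x) = v x"
    using completion_ex_borel_measurable_real[of "\<lambda>x. Im (f x)" lborel] by auto
  have [measurable]: "u \<in> borel_measurable borel" "v \<in> borel_measurable borel" using u v by auto
  show thesis
  proof (rule that)
    show "(\<lambda>x. complex_of_real (u x) + \<i> * complex_of_real (v x)) \<in> borel_measurable borel" by measurable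
    show "AE x in lborel. f x = complex_of_real (u x) + \<i> * complex_of_real (v x)"
      using u(2) v(2) by eventually_elim (simp add: complex_eq_iff)
  qed
qed

lemma locally_integrable_measurable:
  fixes f :: "real^'n \<Rightarrow> complex"
  assumes "locally_integrable f"
  shows "f \<in> borel_measurable lebesgue"
proof (rule borel_measurable_LIMSEQ_metric)
  fix n :: nat
  have "set_integrable lebesgue (cball 0 (real n)) f" using assms by (simp add: locally_integrable_def)
  then show "(\<lambda>x. indicator (cball 0 (real n)) x *\<^sub>R f x) \<in> borel_measurable lebesgue"
    by (auto simp: set_integrable_def)
next
  fix x :: "real^'n"
  obtain N :: nat where "norm x < real N" using reals_Archimedean2 by blast
  then have "eventually (\<lambda>n. indicator (cball 0 (real n)) x *\<^sub>R f x = f x) sequentially"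
    by (intro eventually_sequentiallyI[of N]) (auto simp: indicator_def)
  then show "(\<lambda>n. indicator (cball 0 (real n)) x *\<^sub>R f x) \<longlonglongrightarrow> f x"
    by (rule tendsto_eventually)
qed

lemma indicator_cball_real_measurable [measurable]:
  fixes f g :: "'b \<Rightarrow> 'a::euclidean_space"
  assumes [measurable]: "f \<in> borel_measurable M" "g \<in> borel_measurable M" "r \<in> borel_measurable M"
  shows "(\<lambda>z. indicator (cball (f z) (r z)) (g z) :: real) \<in> borel_measurable M"
proof -
  have "(\<lambda>z. indicator (cball (f z) (r z)) (g z) :: real) = (\<lambda>z. if dist (f z) (g z) \<le> r z then 1 else 0)"
    by (auto simp: indicator_def)
  then show ?thesis by simp
qed

abbreviation cube :: "real^'n \<Rightarrow> real \<Rightarrow> (real^'n) set" where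
  "cube a l \<equiv> cbox a (\<chi> i. a $ i + l)"

lemma cube_measure:
  fixes a :: "real^'n"
  assumes "0 < l"
  shows "measure lebesgue (cube a l) = l ^ CARD('n)"
    and "emeasure lebesgue (cube a l) = ennreal (l ^ CARD('n))"
proof -
  have ne: "cube a l \<noteq> {}"
    using assms by (auto simp: cbox_interval[symmetric] mem_box_cart intro!: exI[of _ a] simp: set_eq_iff)
  show 1: "measure lebesgue (cube a l) = l ^ CARD('n)"
    using ne by (simp add: content_cbox_cart)
  show "emeasure lebesgue (cube a l) = ennreal (l ^ CARD('n))"
    unfolding 1[symmetric] using emeasure_lborel_cbox_finite[of a "\<chi> i. a $ i + l"]
    by (simp add: emeasure_eq_ennreal_measure)
qed

text \<open>The distance of the mean from \<open>c\<close>, times the volume, is at most the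
  oscillation around \<open>c\<close>; replacing \<open>c\<close> by the mean thus at most doubles
  the oscillation.\<close>

lemma ball_oscillation_le:
  fixes b :: "'a::euclidean_space \<Rightarrow> complex" and c :: complex
  defines "m \<equiv> \<lambda>x r. (1 / measure lborel (cball x r)) *\<^sub>R (LINT y|lborel. indicator (cball x r) y *\<^sub>R b y)"
  assumes r: "0 < r" and [measurable]: "b \<in> borel_measurable borel"
    and int: "integrable lborel (\<lambda>y. indicator (cball x r) y *\<^sub>R b y)"
  shows "ball_integral (\<lambda>y. enorm (b y - m x r)) x r \<le>
    2 * ball_integral (\<lambda>y. enorm (b y - c)) x r"
proof -
  let ?B = "cball x r"
  let ?I = "\<integral>\<^sup>+y. enorm (b y - c) * indicator ?B y \<partial>lborel"
  define V where "V = measure lborel ?B"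
  have EV: "emeasure lborel ?B = ennreal V"
    unfolding V_def using emeasure_lborel_cball_finite[of x r] by (intro emeasure_eq_ennreal_measure) auto
  have V: "0 < V" using emeasure_cball_pos[OF r, of x] EV by simp
  have intc: "integrable lborel (\<lambda>y. indicator ?B y *\<^sub>R c)"
    using emeasure_lborel_cball_finite[of x r] by (intro integrable_scaleR_left integrable_real_indicator) auto
  have eq: "V *\<^sub>R (m x r - c) = (LINT y|lborel. indicator ?B y *\<^sub>R (b y - c))"
  proof -
    have "(LINT y|lborel. indicator ?B y *\<^sub>R (b y - c)) = (LINT y|lborel. indicator ?B y *\<^sub>R b y) - (LINT y|lborel. indicator ?B y *\<^sub>R c)"
      using int intc by (simp add: scaleR_diff_right)
    moreover have "(LINT y|lborel. indicator ?B y *\<^sub>R c) = V *\<^sub>R c"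
      using emeasure_lborel_cball_finite[of x r]
      by (subst integral_scaleR_left) (auto simp: V_def intro!: integrable_real_indicator)
    ultimately show ?thesis using V by (simp add: m_def V_def scaleR_diff_right)
  qed
  have "enorm (m x r - c) * ennreal V = enorm (V *\<^sub>R (m x r - c))"
    using V by (simp add: ennreal_mult mult.commute)
  also have "\<dots> \<le> (\<integral>\<^sup>+y. norm (indicator ?B y *\<^sub>R (b y - c)) \<partial>lborel)"
    unfolding eq using int intc by (intro integral_norm_bound_ennreal) (simp add: scaleR_diff_right)
  also have "\<dots> = ?I"
    by (intro nn_integral_cong) (auto split: split_indicator)
  finally have mc: "enorm (m x r - c) * ennreal V \<le> ?I" .
  have "(\<integral>\<^sup>+y. enorm (b y - m x r) * indicator ?B y \<partial>lborel) \<le>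
     (\<integral>\<^sup>+y. enorm (b y - c) * indicator ?B y + enorm (m x r - c) * indicator ?B y \<partial>lborel)"
  proof (intro nn_integral_mono)
    fix y
    have "norm (b y - m x r) \<le> norm (b y - c) + norm (m x r - c)"
      using norm_triangle_ineq4[of "b y - c" "m x r - c"] by simp
    then show "enorm (b y - m x r) * indicator ?B y \<le>
      enorm (b y - c) * indicator ?B y + enorm (m x r - c) * indicator ?B y"
      by (auto split: split_indicator simp flip: ennreal_plus)
  qed
  also have "\<dots> = ?I + enorm (m x r - c) * ennreal V"
    by (simp add: nn_integral_add nn_integral_cmult_indicator EV)
  also have "\<dots> \<le> ?I + ?I" by (intro add_left_mono mc)
  finally show ?thesis by (simp add: mult_2)
qed

text \<open>Every ball lies in a concentric cube of side \<open>2 * r\<close>, whose mean is the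
  comparison constant in \<open>ball_oscillation_le\<close>; the centres are the ball means of a
  Borel representative.\<close>

lemma BMO_imp_ball_bmo:
  fixes b :: "real^'n \<Rightarrow> complex"
  assumes "b \<in> BMO"
  obtains b' m A where "ball_bmo b' m A" "AE x in lborel. b x = b' x"
proof -
  from assms obtain S where li: "locally_integrable b"
    and S: "\<And>Q. Q \<in> cubes \<Longrightarrow> cube_mean Q (\<lambda>x. norm (b x - cube_mean Q b)) \<le> S"
    unfolding BMO_def bdd_above_def by auto
  obtain b' where b' [measurable]: "b' \<in> borel_measurable borel" and eq: "AE x in lborel. b x = b' x"
    using lebesgue_borel_representative[OF locally_integrable_measurable[OF li]] by blast
  have [measurable]: "b \<in> borel_measurable lebesgue" by (rule locally_integrable_measurable[OF li])
  have [measurable]: "b' \<in> borel_measurable lebesgue" by (intro measurable_completion) simp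
  have eql: "AE x in lebesgue. b x = b' x" using eq by (rule AE_completion)
  have int: "integrable lborel (\<lambda>y. indicator K y *\<^sub>R b' y)" if "compact K" for K
  proof -
    have [measurable]: "K \<in> sets borel" using that by (simp add: borel_compact)
    have "integrable lebesgue (\<lambda>y. indicator K y *\<^sub>R b y)"
      using li that by (simp add: locally_integrable_def set_integrable_def)
    then have "integrable lebesgue (\<lambda>y. indicator K y *\<^sub>R b' y)"
      by (rule integrable_cong_AE_imp) (use eql in \<open>auto intro!: measurable_completion\<close>)
    then show ?thesis by (subst (asm) integrable_completion) auto
  qed
  define m where "m x r = (1 / measure lborel (cball x r)) *\<^sub>R (LINT y|lborel. indicator (cball x r) y *\<^sub>R b' y)" for x r
  define \<omega> where "\<omega> = unit_ball_vol (real CARD('n))"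
  have \<omega>: "0 < \<omega>" using unit_ball_vol_DIM_pos[where 'a="real^'n"] by (simp add: \<omega>_def)
  have vol: "ball_vol x r = ennreal (\<omega> * r ^ CARD('n))" if "0 \<le> r" for x :: "real^'n" and r
    using that by (simp add: emeasure_cball \<omega>_def)
  \<comment> \<open>The leading 2 is the loss from cube mean to ball mean,
    \<open>2 ^ CARD('n) / \<omega>\<close> is the volume ratio of cube and ball, and
    \<open>max S 1\<close> keeps \<open>A\<close> positive.\<close>
  define A where "A = 2 * (max S 1 * 2 ^ CARD('n) / \<omega>)"
  have A: "0 < A" using \<omega> by (simp add: A_def)
  have "ball_bmo b' m A"
  proof
    show "b' \<in> borel_measurable borel" by (rule b')
    show "0 < A" by (rule A)
    have "(\<lambda>(x, u). m x (exp u)) = (\<lambda>z. (1 / (\<omega> * exp (snd z) ^ CARD('n))) *\<^sub>R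
       (LINT y|lborel. indicator (cball (fst z) (exp (snd z))) y *\<^sub>R b' y))"
      by (auto simp: m_def content_cball \<omega>_def fun_eq_iff)
    also have "\<dots> \<in> borel_measurable (borel \<Otimes>\<^sub>M borel)" by measurable
    finally show "(\<lambda>(x, u). m x (exp u)) \<in> borel_measurable (borel \<Otimes>\<^sub>M borel)" .
  next
    fix r :: real and x :: "real^'n"
    assume r: "0 < r"
    define a where "a = x - (\<chi> i. r)"
    define Q where "Q = cube a (2 * r)"
    have Q: "Q \<in> cubes" using r by (auto simp: cubes_def Q_def intro!: exI[of _ a] exI[of _ "2 * r"])
    have mQ: "measure lebesgue Q = (2 * r) ^ CARD('n)" "emeasure lebesgue Q = ennreal ((2 * r) ^ CARD('n))"
      unfolding Q_def using cube_measure[of "2 * r" a] r by auto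
    define c where "c = cube_mean Q b"
    have sub: "cball x r \<subseteq> Q"
    proof
      fix y assume "y \<in> cball x r"
      then have "norm (y - x) \<le> r" by (simp add: dist_norm norm_minus_commute)
      then have "\<bar>y $ i - x $ i\<bar> \<le> r" for i
        using component_le_norm_cart[of "y - x" i] by simp
      then show "y \<in> Q"
        unfolding Q_def mem_box_cart a_def by (auto simp: abs_le_iff algebra_simps)
    qed
    have cQ: "compact Q" "Q \<in> sets borel" by (simp_all add: Q_def)
    have iQ: "integrable lebesgue (\<lambda>y. indicator Q y *\<^sub>R norm (b y - c))"
    proof -
      have "integrable lebesgue (\<lambda>y. indicator Q y *\<^sub>R b y)"
        using li cQ by (simp add: locally_integrable_def set_integrable_def)
      moreover have "integrable lebesgue (\<lambda>y. indicator Q y *\<^sub>R c)"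
        using mQ cQ by (intro integrable_scaleR_left integrable_real_indicator) auto
      ultimately have "integrable lebesgue (\<lambda>y. norm (indicator Q y *\<^sub>R b y - indicator Q y *\<^sub>R c))"
        by (intro integrable_norm Bochner_Integration.integrable_diff)
      then show ?thesis by (simp add: scaleR_diff_right[symmetric])
    qed
    have "(LINT y|lebesgue. indicator Q y *\<^sub>R norm (b y - c)) \<le> S * measure lebesgue Q"
      using S[OF Q] mQ r by (simp add: cube_mean_def set_lebesgue_integral_def c_def divide_le_eq mult.commute)
    also have "\<dots> \<le> max S 1 * measure lebesgue Q" by (intro mult_right_mono) auto
    finally have le: "(LINT y|lebesgue. indicator Q y *\<^sub>R norm (b y - c)) \<le> max S 1 * (2 * r) ^ CARD('n)"
      by (simp add: mQ)
    have "(\<integral>\<^sup>+y. enorm (b' y - c) * indicator Q y \<partial>lborel) = (\<integral>\<^sup>+y. enorm (b y - c) * indicator Q y \<partial>lborel)"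
      by (intro nn_integral_cong_AE) (use eq in \<open>auto elim: eventually_mono\<close>)
    also have "\<dots> = (\<integral>\<^sup>+y. ennreal (indicator Q y *\<^sub>R norm (b y - c)) \<partial>lebesgue)"
      unfolding nn_integral_completion by (intro nn_integral_cong) (auto split: split_indicator)
    also have "\<dots> = ennreal (LINT y|lebesgue. indicator Q y *\<^sub>R norm (b y - c))"
      using iQ by (intro nn_integral_eq_integral) auto
    also have "\<dots> \<le> ennreal (max S 1 * (2 * r) ^ CARD('n))" by (intro ennreal_leI le)
    also have "\<dots> = ennreal (max S 1 * 2 ^ CARD('n) / \<omega>) * ball_vol x r"
      using r \<omega> by (subst vol) (auto simp: ennreal_mult'[symmetric] power_mult_distrib)
    finally have Qle: "(\<integral>\<^sup>+y. enorm (b' y - c) * indicator Q y \<partial>lborel) \<le> \<dots>" .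
    have "ball_integral (\<lambda>y. enorm (b' y - m x r)) x r \<le>
        2 * ball_integral (\<lambda>y. enorm (b' y - c)) x r"
      unfolding m_def by (intro ball_oscillation_le r b' int) auto
    also have "\<dots> \<le> 2 * (\<integral>\<^sup>+y. enorm (b' y - c) * indicator Q y \<partial>lborel)"
      using sub by (intro mult_left_mono nn_integral_mono) (auto split: split_indicator)
    also have "\<dots> \<le> 2 * (ennreal (max S 1 * 2 ^ CARD('n) / \<omega>) * ball_vol x r)"
      by (intro mult_left_mono Qle) auto
    also have "\<dots> = ennreal A * ball_vol x r"
      unfolding A_def by (subst ennreal_mult) (use \<omega> in \<open>auto simp: mult.assoc\<close>)
    finally show "ball_integral (\<lambda>y. enorm (b' y - m x r)) x r \<le> ennreal A * ball_vol x r" .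
  qed
  with eq show thesis by (intro that)
qed

section \<open>Commutators as fractional integrals with the weight \<open>b x - b y\<close>\<close>

lemma frac_int_diff1:
  assumes "frac_int \<alpha> f1 f2 x = Some u" "frac_int \<alpha> (\<lambda>y. b y * f1 y) f2 x = Some v"
  shows "frac_int \<alpha> (\<lambda>y. (c - b y) * f1 y) f2 x = Some (c * u - v)"
proof -
  have eq: "frac_kernel \<alpha> (\<lambda>y. (c - b y) * f1 y) f2 x =
      (\<lambda>z. c * frac_kernel \<alpha> f1 f2 x z - frac_kernel \<alpha> (\<lambda>y. b y * f1 y) f2 x z)"
    by (auto simp: frac_kernel_def fun_eq_iff algebra_simps diff_divide_distrib)
  show ?thesis
    using assms unfolding frac_int_def eq by (auto split: if_splits)
qed

lemma frac_int_diff2: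
  assumes "frac_int \<alpha> f1 f2 x = Some u" "frac_int \<alpha> f1 (\<lambda>y. b y * f2 y) x = Some v"
  shows "frac_int \<alpha> f1 (\<lambda>y. (c - b y) * f2 y) x = Some (c * u - v)"
proof -
  have eq: "frac_kernel \<alpha> f1 (\<lambda>y. (c - b y) * f2 y) x =
      (\<lambda>z. c * frac_kernel \<alpha> f1 f2 x z - frac_kernel \<alpha> f1 (\<lambda>y. b y * f2 y) x z)"
    by (auto simp: frac_kernel_def fun_eq_iff algebra_simps diff_divide_distrib)
  show ?thesis
    using assms unfolding frac_int_def eq by (auto split: if_splits)
qed

lemma commutator1_eq_frac_int:
  assumes "commutator1 b (frac_int \<alpha>) f1 f2 x = Some w"
  shows "frac_int \<alpha> (\<lambda>y. (b x - b y) * f1 y) f2 x = Some w"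
  using assms by (auto simp: commutator1_def split: option.splits intro!: frac_int_diff1[THEN trans])

lemma commutator2_eq_frac_int:
  assumes "commutator2 b (frac_int \<alpha>) f1 f2 x = Some w"
  shows "frac_int \<alpha> f1 (\<lambda>y. (b x - b y) * f2 y) x = Some w"
  using assms by (auto simp: commutator2_def split: option.splits intro!: frac_int_diff2[THEN trans])

text \<open>With \<open>x\<close> frozen, \<open>b x\<close> is a constant that can be moved under
  the integral in each variable separately. The resulting weight is a product of one factor per
  variable.\<close>

lemma iterated_commutator_eq_frac_int:
  assumes "iterated_commutator (b, b) (frac_int \<alpha>) f1 f2 x = Some w"
  shows "frac_int \<alpha> (\<lambda>y. (b x - b y) * f1 y) (\<lambda>y. (b x - b y) * f2 y) x = Some w"
proof -
  from assms obtain u v where uv: "commutator1 b (frac_int \<alpha>) f1 f2 x = Some u"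
      "commutator1 b (frac_int \<alpha>) f1 (\<lambda>y. b y * f2 y) x = Some v" "w = b x * u - v"
    by (auto simp: iterated_commutator_def commutator2_def split: option.splits)
  show ?thesis
    unfolding uv(3) by (rule frac_int_diff2[OF uv(1,2)[THEN commutator1_eq_frac_int]])
qed

lemma iterated_commutator_defined:
  assumes "frac_int \<alpha> f1 f2 x \<noteq> None" "frac_int \<alpha> (\<lambda>y. b y * f1 y) f2 x \<noteq> None"
    "frac_int \<alpha> f1 (\<lambda>y. b y * f2 y) x \<noteq> None" "frac_int \<alpha> (\<lambda>y. b y * f1 y) (\<lambda>y. b y * f2 y) x \<noteq> None"
  shows "iterated_commutator (b, b) (frac_int \<alpha>) f1 f2 x \<noteq> None"
  using assms by (auto simp: iterated_commutator_def commutator1_def commutator2_def)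

text \<open>The integral is over \<open>lborel\<close> although \<open>f\<close> is only Lebesgue
  measurable in the applications; \<open>nn_integral_completion\<close> identifies it with the
  integral over \<open>lebesgue\<close>.\<close>

definition potential :: "real \<Rightarrow> ('a::euclidean_space \<Rightarrow> complex) \<Rightarrow> 'a \<Rightarrow> ennreal" where
  "potential a f x = (\<integral>\<^sup>+y. riesz_kernel a x y * enorm (f y) \<partial>lborel)"

lemma ident_lebesgue_measurable [measurable]: "(\<lambda>x. x) \<in> borel_measurable lebesgue"
  by (intro measurable_completion) simp

lemma frac_kernel_measurable [measurable]:
  fixes f1 f2 :: "real^'n \<Rightarrow> complex"
  assumes [measurable]: "f1 \<in> borel_measurable lebesgue" "f2 \<in> borel_measurable lebesgue"
  shows "frac_kernel \<alpha> f1 f2 x \<in> borel_measurable (lebesgue \<Otimes>\<^sub>M lebesgue)"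
proof -
  have [measurable]: "(\<lambda>z. fst z) \<in> borel_measurable (lebesgue \<Otimes>\<^sub>M (lebesgue :: (real^'n) measure))"
    by (rule measurable_compose[OF measurable_fst ident_lebesgue_measurable])
  have [measurable]: "(\<lambda>z. snd z) \<in> borel_measurable ((lebesgue :: (real^'n) measure) \<Otimes>\<^sub>M lebesgue)"
    by (rule measurable_compose[OF measurable_snd ident_lebesgue_measurable])
  show ?thesis unfolding frac_kernel_def case_prod_beta by measurable
qed

text \<open>Each factor of the split power of \<open>s + t\<close> dominates the power of one
  summand. If a summand is 0, the right side is infinite, since the inverse of a finite
  \<open>ennreal\<close> is never 0.\<close>

lemma inverse_powr_sum_le:
  fixes s t :: real
  assumes "0 \<le> s" "0 \<le> t" "0 < \<beta>" "0 < \<gamma>"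
  shows "ennreal (1 / (s + t) powr (\<beta> + \<gamma>)) \<le> inverse (ennreal (s powr \<beta>)) * inverse (ennreal (t powr \<gamma>))"
proof (cases "s = 0 \<or> t = 0")
  case True
  then show ?thesis
    using assms by (auto simp: ennreal_mult_top ennreal_top_mult inverse_eq_divide)
next
  case False
  with assms have st: "0 < s" "0 < t" by auto
  have "s powr \<beta> * t powr \<gamma> \<le> (s + t) powr \<beta> * (s + t) powr \<gamma>"
    using st assms by (intro mult_mono powr_mono2) auto
  then have "1 / (s + t) powr (\<beta> + \<gamma>) \<le> 1 / (s powr \<beta> * t powr \<gamma>)"
    using st by (intro divide_left_mono) (auto simp: powr_add)
  also have "\<dots> = inverse (s powr \<beta>) * inverse (t powr \<gamma>)"
    by (simp add: divide_inverse)
  finally have "ennreal (1 / (s + t) powr (\<beta> + \<gamma>)) \<le> ennreal (inverse (s powr \<beta>) * inverse (t powr \<gamma>))"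
    by (rule ennreal_leI)
  then show ?thesis using st by (simp add: ennreal_mult inverse_ennreal)
qed

lemma frac_kernel_norm_le:
  fixes f1 f2 :: "real^'n \<Rightarrow> complex"
  assumes "a1 < real CARD('n)" "a2 < real CARD('n)"
  shows "enorm (frac_kernel (a1 + a2) f1 f2 x (y1, y2)) \<le>
    (riesz_kernel a1 x y1 * enorm (f1 y1)) * (riesz_kernel a2 x y2 * enorm (f2 y2))"
proof -
  define n where "n = real CARD('n)"
  have "norm (frac_kernel (a1 + a2) f1 f2 x (y1, y2)) =
     (1 / (norm (x - y1) + norm (x - y2)) powr ((n - a1) + (n - a2))) * (norm (f1 y1) * norm (f2 y2))"
    by (simp add: frac_kernel_def norm_divide norm_mult n_def algebra_simps)
  then have "enorm (frac_kernel (a1 + a2) f1 f2 x (y1, y2)) =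
     ennreal (1 / (norm (x - y1) + norm (x - y2)) powr ((n - a1) + (n - a2))) * (enorm (f1 y1) * enorm (f2 y2))"
    by (simp only:) (subst ennreal_mult, simp, simp, subst ennreal_mult, simp_all)
  also have "\<dots> \<le> (inverse (ennreal (norm (x - y1) powr (n - a1))) * inverse (ennreal (norm (x - y2) powr (n - a2)))) *
     (enorm (f1 y1) * enorm (f2 y2))"
    using assms by (intro mult_right_mono inverse_powr_sum_le) (auto simp: n_def)
  finally show ?thesis by (simp add: riesz_kernel_def n_def mult_ac)
qed

lemma frac_kernel_nn_integral_le:
  fixes f1 f2 :: "real^'n \<Rightarrow> complex"
  assumes a: "a1 < real CARD('n)" "a2 < real CARD('n)"
    and [measurable]: "f1 \<in> borel_measurable lebesgue" "f2 \<in> borel_measurable lebesgue"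
  shows "(\<integral>\<^sup>+z. enorm (frac_kernel (a1 + a2) f1 f2 x z) \<partial>(lebesgue \<Otimes>\<^sub>M lebesgue)) \<le> potential a1 f1 x * potential a2 f2 x"
proof -
  have [measurable]: "(\<lambda>y. riesz_kernel a x y) \<in> borel_measurable lebesgue" for a and x :: "real^'n"
    by (intro measurable_completion) simp
  have "(\<integral>\<^sup>+z. enorm (frac_kernel (a1 + a2) f1 f2 x z) \<partial>(lebesgue \<Otimes>\<^sub>M lebesgue)) =
    (\<integral>\<^sup>+y1. \<integral>\<^sup>+y2. enorm (frac_kernel (a1 + a2) f1 f2 x (y1, y2)) \<partial>lebesgue \<partial>lebesgue)"
    by (rule lebesgue.nn_integral_fst[symmetric]) measurable
  also have "\<dots> \<le> (\<integral>\<^sup>+y1. \<integral>\<^sup>+y2. (riesz_kernel a1 x y1 * enorm (f1 y1)) * (riesz_kernel a2 x y2 * enorm (f2 y2)) \<partial>lebesgue \<partial>lebesgue)"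
    by (intro nn_integral_mono frac_kernel_norm_le a)
  also have "\<dots> = (\<integral>\<^sup>+y1. riesz_kernel a1 x y1 * enorm (f1 y1) \<partial>lebesgue) *
      (\<integral>\<^sup>+y2. riesz_kernel a2 x y2 * enorm (f2 y2) \<partial>lebesgue)"
    by (subst nn_integral_cmult, measurable, subst nn_integral_multc, measurable)
  finally show ?thesis by (simp add: potential_def nn_integral_completion)
qed

text \<open>Finiteness of the two potentials certifies integrability of the bilinear kernel, so one
  estimate gives both definedness and size.\<close>

lemma frac_int_Some:
  fixes f1 f2 :: "real^'n \<Rightarrow> complex"
  assumes a: "a1 < real CARD('n)" "a2 < real CARD('n)"
    and [measurable]: "f1 \<in> borel_measurable lebesgue" "f2 \<in> borel_measurable lebesgue"
    and fin: "potential a1 f1 x < \<infinity>" "potential a2 f2 x < \<infinity>"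
  shows "frac_int (a1 + a2) f1 f2 x = Some (LINT z|(lebesgue \<Otimes>\<^sub>M lebesgue). frac_kernel (a1 + a2) f1 f2 x z)"
    and "enorm (LINT z|(lebesgue \<Otimes>\<^sub>M lebesgue). frac_kernel (a1 + a2) f1 f2 x z) \<le> potential a1 f1 x * potential a2 f2 x"
proof -
  have le: "(\<integral>\<^sup>+z. enorm (frac_kernel (a1 + a2) f1 f2 x z) \<partial>(lebesgue \<Otimes>\<^sub>M lebesgue)) \<le> potential a1 f1 x * potential a2 f2 x"
    by (rule frac_kernel_nn_integral_le[OF a]) auto
  also have "\<dots> < \<infinity>" using fin by (simp add: ennreal_mult_less_top)
  finally have int: "integrable (lebesgue \<Otimes>\<^sub>M lebesgue) (frac_kernel (a1 + a2) f1 f2 x)"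
    by (intro integrableI_bounded) auto
  then show "frac_int (a1 + a2) f1 f2 x = Some (LINT z|(lebesgue \<Otimes>\<^sub>M lebesgue). frac_kernel (a1 + a2) f1 f2 x z)"
    by (simp add: frac_int_def)
  show "enorm (LINT z|(lebesgue \<Otimes>\<^sub>M lebesgue). frac_kernel (a1 + a2) f1 f2 x z) \<le> potential a1 f1 x * potential a2 f2 x"
    using integral_norm_bound_ennreal[OF int] le by (rule order_trans)
qed

text \<open>Commutators are defined only where the operator is defined on \<open>b * f\<close>
  itself. This follows from finiteness of the two potentials that are under control, by writing
  \<open>b y\<close> as \<open>b x - (b x - b y)\<close>.\<close>

lemma potential_mult_le:
  fixes b f :: "real^'n \<Rightarrow> complex"
  assumes [measurable]: "b \<in> borel_measurable lebesgue" "f \<in> borel_measurable lebesgue"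
  shows "potential a (\<lambda>y. b y * f y) x \<le> enorm (b x) * potential a f x + potential a (\<lambda>y. (b x - b y) * f y) x"
proof -
  have [measurable]: "(\<lambda>y. riesz_kernel a x y) \<in> borel_measurable lebesgue"
    by (intro measurable_completion) simp
  have "potential a (\<lambda>y. b y * f y) x = (\<integral>\<^sup>+y. riesz_kernel a x y * enorm (b y * f y) \<partial>lebesgue)"
    by (simp add: potential_def nn_integral_completion)
  also have "\<dots> \<le> (\<integral>\<^sup>+y. enorm (b x) * (riesz_kernel a x y * enorm (f y)) +
      riesz_kernel a x y * enorm ((b x - b y) * f y) \<partial>lebesgue)"
  proof (rule nn_integral_mono)
    fix y
    have "norm (b y) \<le> norm (b x) + norm (b x - b y)"
      using norm_triangle_ineq4[of "b x" "b x - b y"] by simp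
    then have "norm (b y) * norm (f y) \<le> (norm (b x) + norm (b x - b y)) * norm (f y)"
      by (rule mult_right_mono) simp
    then have "norm (b y * f y) \<le> norm (b x) * norm (f y) + norm ((b x - b y) * f y)"
      by (simp add: norm_mult distrib_right)
    then have "enorm (b y * f y) \<le> ennreal (norm (b x) * norm (f y) + norm ((b x - b y) * f y))"
      by (rule ennreal_leI)
    also have "\<dots> = enorm (b x) * enorm (f y) + enorm ((b x - b y) * f y)"
      by (simp add: ennreal_mult)
    finally have "riesz_kernel a x y * enorm (b y * f y) \<le>
       riesz_kernel a x y * (enorm (b x) * enorm (f y) + enorm ((b x - b y) * f y))"
      by (rule mult_left_mono) simp
    also have "\<dots> = enorm (b x) * (riesz_kernel a x y * enorm (f y)) +
      riesz_kernel a x y * enorm ((b x - b y) * f y)"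
      by (simp only: distrib_left mult_ac)
    finally show "riesz_kernel a x y * enorm (b y * f y) \<le> \<dots>" .
  qed
  also have "\<dots> = (\<integral>\<^sup>+y. enorm (b x) * (riesz_kernel a x y * enorm (f y)) \<partial>lebesgue) +
      (\<integral>\<^sup>+y. riesz_kernel a x y * enorm ((b x - b y) * f y) \<partial>lebesgue)"
    by (intro nn_integral_add) measurable
  also have "(\<integral>\<^sup>+y. enorm (b x) * (riesz_kernel a x y * enorm (f y)) \<partial>lebesgue) =
     enorm (b x) * (\<integral>\<^sup>+y. riesz_kernel a x y * enorm (f y) \<partial>lebesgue)"
    by (intro nn_integral_cmult) measurable
  finally show ?thesis by (simp add: potential_def nn_integral_completion)
qed

text \<open>\<open>J\<close> and \<open>H\<close> are Borel versions of the plain and the commutator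
  potential of \<open>f\<close>; Hoelder's inequality is applied to these versions over
  \<open>lborel\<close>.\<close>

definition potential_bounds ::
    "(real^'n \<Rightarrow> complex) \<Rightarrow> real \<Rightarrow> real \<Rightarrow> real \<Rightarrow> real \<Rightarrow> (real^'n \<Rightarrow> complex) \<Rightarrow> (real^'n \<Rightarrow> ennreal) \<Rightarrow> (real^'n \<Rightarrow> ennreal) \<Rightarrow> bool"
  where
  "potential_bounds b C a p q f J H \<longleftrightarrow> J \<in> borel_measurable borel \<and> H \<in> borel_measurable borel \<and>
     (AE x in lebesgue. potential a f x = J x \<and> potential a (\<lambda>y. (b x - b y) * f y) x = H x) \<and>
     pow_integral q J \<le> ennreal C * epow (pow_integral p (\<lambda>x. enorm (f x))) (q / p) \<and>
     pow_integral q H \<le> ennreal C * epow (pow_integral p (\<lambda>x. enorm (f x))) (q / p)"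

text \<open>Replacing \<open>f\<close> and \<open>b\<close> by representatives changes the
  integrands only on a null set of \<open>y\<close>; since \<open>b x\<close> also enters, a null
  set of \<open>x\<close> has to be excluded as well.\<close>

lemma BMO_potential_bounds:
  fixes b :: "real^'n \<Rightarrow> complex"
  assumes b: "b \<in> BMO" and p: "1 < p" and a: "0 < a" and q: "0 < q" and pq: "1 / q = 1 / p - a / real CARD('n)"
  obtains C where "0 < C"
    "\<And>f. f \<in> borel_measurable lebesgue \<Longrightarrow> \<exists>J H. potential_bounds b C a p q f J H"
proof -
  obtain b' m A where "ball_bmo b' m A" and eqb: "AE x in lborel. b x = b' x"
    using BMO_imp_ball_bmo[OF b] .
  interpret ball_bmo b' m A by fact
  have pq': "1 / q = 1 / p - a / real DIM(real^'n)" using pq by simp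
  obtain C1 where C1: "0 < C1" "strong_type C1 p q (riesz_potential a :: (real^'n \<Rightarrow> ennreal) \<Rightarrow> _)"
    by (rule riesz_potential_bound[OF p a q pq']) (rule that)
  obtain C2 where C2: "0 < C2" "strong_type C2 p q (commutator_potential b' a)"
    by (rule commutator_potential_bound[OF p a q pq']) (rule that)
  define C where "C = C1 + C2"
  have C: "0 < C" "ennreal C1 \<le> ennreal C" "ennreal C2 \<le> ennreal C"
    using C1 C2 by (auto simp: C_def intro!: ennreal_leI)
  show thesis
  proof (rule that[OF C(1)])
    fix f :: "real^'n \<Rightarrow> complex"
    assume "f \<in> borel_measurable lebesgue"
    then obtain g where [measurable]: "g \<in> borel_measurable borel" and eqf: "AE x in lborel. f x = g x"
      using lebesgue_borel_representative by blast
    define F where "F y = enorm (g y)" for y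
    have [measurable]: "F \<in> borel_measurable borel" unfolding F_def by measurable
    define J where "J x = (riesz_potential a F x)" for x
    define H where "H x = (commutator_potential b' a F x)" for x
    have N: "pow_integral p (\<lambda>x. enorm (f x)) = pow_integral p F"
      by (intro nn_integral_cong_AE) (use eqf in \<open>auto simp: F_def elim: eventually_mono\<close>)
    have "AE x in lborel. potential a f x = J x \<and> potential a (\<lambda>y. (b x - b y) * f y) x = H x"
      using eqb
    proof eventually_elim
      case (elim x)
      have "potential a f x = J x"
        unfolding potential_def J_def F_def
        by (intro nn_integral_cong_AE) (use eqf in \<open>auto elim: eventually_mono\<close>)
      moreover have "potential a (\<lambda>y. (b x - b y) * f y) x = H x"
        unfolding potential_def H_def
      proof (intro nn_integral_cong_AE)
        show "AE y in lborel. riesz_kernel a x y * enorm ((b x - b y) * f y) =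
          enorm (b' x - b' y) * riesz_kernel a x y * F y"
          using eqf eqb
          by eventually_elim (simp add: F_def elim norm_mult ennreal_mult mult_ac)
      qed
      ultimately show ?case by blast
    qed
    then have ae: "AE x in lebesgue. potential a f x = J x \<and> potential a (\<lambda>y. (b x - b y) * f y) x = H x"
      by (rule AE_completion)
    have Jb: "pow_integral q J \<le> ennreal C * epow (pow_integral p F) (q / p)"
      unfolding J_def by (rule order_trans[OF strong_typeD[OF C1(2)]]) (auto intro!: mult_right_mono C)
    have Hb: "pow_integral q H \<le> ennreal C * epow (pow_integral p F) (q / p)"
      unfolding H_def by (rule order_trans[OF strong_typeD[OF C2(2)]]) (auto intro!: mult_right_mono C)
    have "J \<in> borel_measurable borel" "H \<in> borel_measurable borel"
      unfolding J_def[abs_def] H_def[abs_def] by measurable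
    with ae Jb Hb show "\<exists>J H. potential_bounds b C a p q f J H"
      unfolding potential_bounds_def N by blast
  qed
qed

section \<open>Strong bounds from pointwise domination by a product\<close>

lemma Lp_nn_integral:
  fixes f :: "real^'n \<Rightarrow> complex"
  assumes "f \<in> Lp p"
  shows "pow_integral p (\<lambda>x. enorm (f x)) = ennreal (LINT x|lebesgue. norm (f x) powr p)"
proof -
  have "integrable lebesgue (\<lambda>x. norm (f x) powr p)" using assms by (simp add: Lp_def)
  then have "(\<integral>\<^sup>+x. ennreal (norm (f x) powr p) \<partial>lebesgue) = ennreal (LINT x|lebesgue. norm (f x) powr p)"
    by (intro nn_integral_eq_integral) auto
  then show ?thesis by (simp add: nn_integral_completion epow_ennreal)
qed

text \<open>Hoelder combines the bounds for the two dominating factors, and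
  \<open>1 / q = 1 / q1 + 1 / q2\<close> merges the constants into \<open>C powr (1 / q)\<close>.
  The function \<open>g\<close> carries measurability over to the operator, which is known only
  almost everywhere.\<close>

lemma bounded_to_LpI:
  fixes T :: "('n::finite) bilinear_op"
  assumes q: "0 < q" "0 < q1" "0 < q2" "1 / q = 1 / q1 + 1 / q2" and p: "0 < p1" "0 < p2" and C: "0 < C"
    and T: "\<And>f1 f2. f1 \<in> Lp p1 \<Longrightarrow> f2 \<in> Lp p2 \<Longrightarrow> \<exists>U V g. U \<in> borel_measurable borel \<and> V \<in> borel_measurable borel \<and>
      g \<in> borel_measurable lebesgue \<and>
      (AE x in lebesgue. T f1 f2 x = Some (g x) \<and> enorm (g x) \<le> U x * V x) \<and>
      (pow_integral q1 U) \<le> ennreal C * epow (pow_integral p1 (\<lambda>x. enorm (f1 x))) (q1 / p1) \<and>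
      (pow_integral q2 V) \<le> ennreal C * epow (pow_integral p2 (\<lambda>x. enorm (f2 x))) (q2 / p2)"
  shows "bounded_to_Lp p1 p2 q T"
  unfolding bounded_bilinear_op_def Let_def
proof (intro exI[of _ "C powr (1 / q)"] ballI)
  fix f1 f2 :: "real^'n \<Rightarrow> complex"
  assume f: "f1 \<in> Lp p1" "f2 \<in> Lp p2"
  define g0 where "g0 = (\<lambda>x. case T f1 f2 x of None \<Rightarrow> 0 | Some z \<Rightarrow> z)"
  from T[OF f] obtain U V g where [measurable]: "U \<in> borel_measurable borel" "V \<in> borel_measurable borel"
      and g: "g \<in> borel_measurable lebesgue"
      and ae: "AE x in lebesgue. T f1 f2 x = Some (g x) \<and> enorm (g x) \<le> U x * V x"
      and U: "pow_integral q1 U \<le> ennreal C * epow (pow_integral p1 (\<lambda>x. enorm (f1 x))) (q1 / p1)"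
      and V: "pow_integral q2 V \<le> ennreal C * epow (pow_integral p2 (\<lambda>x. enorm (f2 x))) (q2 / p2)"
    by blast
  have def: "AE x in lebesgue. T f1 f2 x \<noteq> None" using ae by (auto elim: eventually_mono)
  have eq: "AE x in lebesgue. g x = g0 x" using ae by (auto simp: g0_def elim: eventually_mono)
  have g0 [measurable]: "g0 \<in> borel_measurable lebesgue"
    using g eq by (rule borel_measurable_AE)
  have le: "AE x in lebesgue. enorm (g0 x) \<le> U x * V x"
    using ae by (auto simp: g0_def elim: eventually_mono)
  define I1 where "I1 = (LINT x|lebesgue. norm (f1 x) powr p1)"
  define I2 where "I2 = (LINT x|lebesgue. norm (f2 x) powr p2)"
  have I: "0 \<le> I1" "0 \<le> I2" by (auto simp: I1_def I2_def)
  define B where "B = (C powr (1 / q1) * I1 powr (1 / p1)) * (C powr (1 / q2) * I2 powr (1 / p2))"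
  have B: "0 \<le> B" by (simp add: B_def)
  have e1: "epow (ennreal C * epow (ennreal I1) (q1 / p1)) (q / q1) = epow (ennreal (C powr (1 / q1) * I1 powr (1 / p1))) q"
    using q p C I by (simp add: epow_mult epow_epow epow_ennreal ennreal_mult powr_powr powr_mult)
  have e2: "epow (ennreal C * epow (ennreal I2) (q2 / p2)) (q / q2) = epow (ennreal (C powr (1 / q2) * I2 powr (1 / p2))) q"
    using q p C I by (simp add: epow_mult epow_epow epow_ennreal ennreal_mult powr_powr powr_mult)
  have "(\<integral>\<^sup>+x. ennreal (norm (g0 x) powr q) \<partial>lebesgue) \<le> (\<integral>\<^sup>+x. epow (U x * V x) q \<partial>lebesgue)"
    using le q by (intro nn_integral_mono_AE) (auto simp: epow_ennreal[symmetric] elim!: eventually_mono intro: epow_mono)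
  also have "\<dots> \<le> epow (pow_integral q1 U) (q / q1) * epow (pow_integral q2 V) (q / q2)"
    unfolding nn_integral_completion using q by (intro nn_integral_Holder_powr) auto
  also have "\<dots> \<le> epow (ennreal C * epow (ennreal I1) (q1 / p1)) (q / q1) * epow (ennreal C * epow (ennreal I2) (q2 / p2)) (q / q2)"
    using q U V unfolding Lp_nn_integral[OF f(1)] Lp_nn_integral[OF f(2)] I1_def[symmetric] I2_def[symmetric]
    by (intro mult_mono epow_mono) auto
  also have "\<dots> = epow (ennreal B) q"
    unfolding e1 e2 B_def using q by (subst epow_mult[symmetric]) (auto simp: ennreal_mult)
  finally have fin: "(\<integral>\<^sup>+x. ennreal (norm (g0 x) powr q) \<partial>lebesgue) \<le> ennreal (B powr q)"
    using B by (simp add: epow_ennreal)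
  have int: "integrable lebesgue (\<lambda>x. norm (g0 x) powr q)"
    using fin by (intro integrableI_bounded) (auto simp: less_top[symmetric] top_unique intro: le_less_trans)
  then have "g0 \<in> Lp q" using g0 by (simp add: Lp_def)
  moreover have "Lp_norm q g0 \<le> C powr (1 / q) * Lp_norm p1 f1 * Lp_norm p2 f2"
  proof -
    have "ennreal (LINT x|lebesgue. norm (g0 x) powr q) \<le> ennreal (B powr q)"
      using fin int by (subst nn_integral_eq_integral[symmetric]) auto
    then have "(LINT x|lebesgue. norm (g0 x) powr q) \<le> B powr q" by simp
    then have "Lp_norm q g0 \<le> (B powr q) powr (1 / q)"
      unfolding Lp_norm_def using q by (intro powr_mono2) auto
    also have "\<dots> = B" using B q(1) by (simp add: powr_powr)
    also have "\<dots> = C powr (1 / q) * Lp_norm p1 f1 * Lp_norm p2 f2"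
      using q(4) by (simp add: B_def Lp_norm_def I1_def I2_def powr_add)
    finally show ?thesis .
  qed
  ultimately show "(AE x in lebesgue. T f1 f2 x \<noteq> None) \<and>
     (\<lambda>x. case T f1 f2 x of None \<Rightarrow> 0 | Some z \<Rightarrow> z) \<in> Lp q \<and>
     Lp_norm q (\<lambda>x. case T f1 f2 x of None \<Rightarrow> 0 | Some z \<Rightarrow> z) \<le> C powr (1 / q) * Lp_norm p1 f1 * Lp_norm p2 f2"
    using def unfolding g0_def by blast
qed

text \<open>The inputs depend on the evaluation point through the weight \<open>b x - b y\<close>,
  so measurability in \<open>x\<close> is obtained as that of a parameter integral, from joint
  measurability in all three variables.\<close>

lemma frac_kernel_integral_measurable:
  fixes \<phi>1 \<phi>2 :: "real^'n \<Rightarrow> real^'n \<Rightarrow> complex"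
  assumes "(\<lambda>w. \<phi>1 (fst w) (snd w)) \<in> borel_measurable (lebesgue \<Otimes>\<^sub>M lebesgue)"
    and "(\<lambda>w. \<phi>2 (fst w) (snd w)) \<in> borel_measurable (lebesgue \<Otimes>\<^sub>M lebesgue)"
  shows "(\<lambda>x. LINT z|(lebesgue \<Otimes>\<^sub>M lebesgue). frac_kernel \<alpha> (\<phi>1 x) (\<phi>2 x) x z) \<in> borel_measurable lebesgue"
proof -
  let ?M = "lebesgue \<Otimes>\<^sub>M (lebesgue \<Otimes>\<^sub>M lebesgue) :: ((real^'n) \<times> (real^'n) \<times> (real^'n)) measure"
  have m [measurable]: "(\<lambda>w. fst w) \<in> ?M \<rightarrow>\<^sub>M lebesgue" "(\<lambda>w. fst (snd w)) \<in> ?M \<rightarrow>\<^sub>M lebesgue"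
     "(\<lambda>w. snd (snd w)) \<in> ?M \<rightarrow>\<^sub>M lebesgue" by measurable
  note mb [measurable] = m[THEN measurable_compose, OF ident_lebesgue_measurable]
  have [measurable]: "(\<lambda>w. \<phi>1 (fst w) (fst (snd w))) \<in> borel_measurable ?M"
    using measurable_compose[OF measurable_Pair[OF m(1,2)] assms(1)] by simp
  have [measurable]: "(\<lambda>w. \<phi>2 (fst w) (snd (snd w))) \<in> borel_measurable ?M"
    using measurable_compose[OF measurable_Pair[OF m(1,3)] assms(2)] by simp
  show ?thesis
    by (rule sigma_finite_measure.borel_measurable_lebesgue_integral[OF lebesgue_pair.sigma_finite_measure_axioms]) (simp add: frac_kernel_def case_prod_beta)
qed

theorem BMO_imp_bounded_to_Lp:
  fixes b :: "real^'n \<Rightarrow> complex" and \<alpha> p1 p2 q :: real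
  assumes b: "b \<in> BMO" and \<alpha>: "0 < \<alpha>" and p: "1 < p1" "1 < p2" and q: "0 < q"
    and pq: "1 / q = 1 / p1 + 1 / p2 - \<alpha> / real CARD('n)"
  shows "bounded_to_Lp p1 p2 q (commutator1 b (frac_int \<alpha>))"
    and "bounded_to_Lp p1 p2 q (commutator2 b (frac_int \<alpha>))"
    and "bounded_to_Lp p1 p2 q (iterated_commutator (b, b) (frac_int \<alpha>))"
proof -
  define n where "n = real CARD('n)"
  have n: "0 < n" by (simp add: n_def)
  define \<sigma> where "\<sigma> = 1 / p1 + 1 / p2"
  have \<sigma>: "0 < \<sigma>" using p by (simp add: \<sigma>_def add_pos_pos)
  \<comment> \<open>Splitting the order in proportion to \<open>1 / p1\<close> and
    \<open>1 / p2\<close> gives \<open>1 / q1 = (1 - \<theta>) / p1\<close> and likewise for the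
    second factor. Both are positive since \<open>\<theta> < 1\<close>, which restates
    \<open>0 < 1 / q\<close>.\<close>
  define \<theta> where "\<theta> = \<alpha> / n / \<sigma>"
  have "0 < 1 / q" using q by simp
  then have "\<alpha> / n < \<sigma>" using pq by (simp add: \<sigma>_def n_def)
  then have \<theta>: "0 < \<theta>" "\<theta> < 1" using \<alpha> n \<sigma> by (auto simp: \<theta>_def divide_less_eq mult.commute)
  have \<theta>\<sigma>: "\<theta> * \<sigma> = \<alpha> / n" using \<sigma> by (simp add: \<theta>_def)
  define a1 where "a1 = n * \<theta> / p1"
  define a2 where "a2 = n * \<theta> / p2"
  define q1 where "q1 = p1 / (1 - \<theta>)"
  define q2 where "q2 = p2 / (1 - \<theta>)"
  have a12: "a1 + a2 = \<alpha>"
  proof -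
    have "a1 + a2 = n * (\<theta> * \<sigma>)" by (simp add: a1_def a2_def \<sigma>_def algebra_simps)
    then show ?thesis using n by (simp add: \<theta>\<sigma>)
  qed
  have a0: "0 < a1" "0 < a2" using n \<theta> p by (auto simp: a1_def a2_def)
  have an: "a1 < real CARD('n)" "a2 < real CARD('n)"
  proof -
    have "\<theta> / p1 < 1" "\<theta> / p2 < 1" using \<theta> p by (auto simp: divide_less_eq)
    then have "n * (\<theta> / p1) < n * 1" "n * (\<theta> / p2) < n * 1" using n by (intro mult_strict_left_mono; simp)+
    then show "a1 < real CARD('n)" "a2 < real CARD('n)" by (auto simp: a1_def a2_def n_def)
  qed
  have q12: "0 < q1" "0 < q2" using p \<theta> by (auto simp: q1_def q2_def)
  have e1: "1 / q1 = 1 / p1 - a1 / real CARD('n)"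
    unfolding n_def[symmetric] using n by (simp add: q1_def a1_def diff_divide_distrib)
  have e2: "1 / q2 = 1 / p2 - a2 / real CARD('n)"
    unfolding n_def[symmetric] using n by (simp add: q2_def a2_def diff_divide_distrib)
  have qq: "1 / q = 1 / q1 + 1 / q2"
  proof -
    have "a1 / n + a2 / n = \<alpha> / n" by (simp add: a12 add_divide_distrib[symmetric])
    then show ?thesis using pq e1 e2 unfolding n_def[symmetric] by linarith
  qed
  have li: "locally_integrable b" using b by (simp add: BMO_def)
  have bm [measurable]: "b \<in> borel_measurable lebesgue" by (rule locally_integrable_measurable[OF li])
  obtain C1 where C1: "0 < C1" "\<And>f. f \<in> borel_measurable lebesgue \<Longrightarrow> \<exists>J H. potential_bounds b C1 a1 p1 q1 f J H"
    by (rule BMO_potential_bounds[OF b p(1) a0(1) q12(1) e1]) (rule that)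
  obtain C2 where C2: "0 < C2" "\<And>f. f \<in> borel_measurable lebesgue \<Longrightarrow> \<exists>J H. potential_bounds b C2 a2 p2 q2 f J H"
    by (rule BMO_potential_bounds[OF b p(2) a0(2) q12(2) e2]) (rule that)
  define C where "C = C1 + C2"
  have C: "0 < C" "ennreal C1 \<le> ennreal C" "ennreal C2 \<le> ennreal C"
    using C1 C2 by (auto simp: C_def intro!: ennreal_leI)
  \<comment> \<open>Passes to a common constant and records that for inputs in \<open>Lp p\<close>
    the potentials are finite almost everywhere.\<close>
  have mono_C: "\<exists>J H. potential_bounds b C a p q f J H \<and> (AE x in lebesgue. J x < \<infinity> \<and> H x < \<infinity>)"
    if "\<exists>J H. potential_bounds b C' a p q f J H" "ennreal C' \<le> ennreal C" and f: "f \<in> Lp p" for C' a p q and f :: "real^'n \<Rightarrow> complex"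
  proof -
    from that(1) obtain J H where JH: "potential_bounds b C' a p q f J H" by blast
    have "ennreal C' * epow (pow_integral p (\<lambda>x. enorm (f x))) (q / p) \<le>
        ennreal C * epow (pow_integral p (\<lambda>x. enorm (f x))) (q / p)"
      using that(2) by (rule mult_right_mono) simp
    then have bounds: "potential_bounds b C a p q f J H"
      using JH unfolding potential_bounds_def by (meson order_trans)
    have fin: "AE x in lebesgue. F x < \<infinity>"
      if [measurable]: "F \<in> borel_measurable borel"
        and le: "pow_integral q F \<le> ennreal C * epow (pow_integral p (\<lambda>x. enorm (f x))) (q / p)"
      for F :: "real^'n \<Rightarrow> ennreal"
    proof -
      note le
      also have "ennreal C * epow (pow_integral p (\<lambda>x. enorm (f x))) (q / p) < \<infinity>"
        unfolding Lp_nn_integral[OF f] by (simp add: ennreal_mult_less_top)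
      finally have "AE x in lborel. epow (F x) q \<noteq> \<infinity>"
        by (intro nn_integral_PInf_AE) auto
      then show ?thesis by (intro AE_completion) (auto simp: less_top[symmetric] elim: eventually_mono)
    qed
    have "AE x in lebesgue. J x < \<infinity>" "AE x in lebesgue. H x < \<infinity>"
      using bounds unfolding potential_bounds_def by (intro fin; blast)+
    with bounds show ?thesis by auto
  qed
  have defined: "frac_int \<alpha> f1 f2 x \<noteq> None" "frac_int \<alpha> (\<lambda>y. b y * f1 y) f2 x \<noteq> None"
      "frac_int \<alpha> f1 (\<lambda>y. b y * f2 y) x \<noteq> None" "frac_int \<alpha> (\<lambda>y. b y * f1 y) (\<lambda>y. b y * f2 y) x \<noteq> None"
    if f: "f1 \<in> Lp p1" "f2 \<in> Lp p2" and fin: "potential a1 f1 x < \<infinity>" "potential a2 f2 x < \<infinity>"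
      "potential a1 (\<lambda>y. (b x - b y) * f1 y) x < \<infinity>" "potential a2 (\<lambda>y. (b x - b y) * f2 y) x < \<infinity>" for f1 f2 x
  proof -
    have [measurable]: "f1 \<in> borel_measurable lebesgue" "f2 \<in> borel_measurable lebesgue"
      using f by (auto simp: Lp_def)
    have "potential a1 (\<lambda>y. b y * f1 y) x < \<infinity>"
      by (rule le_less_trans[OF potential_mult_le]) (use fin in \<open>auto simp: ennreal_mult_less_top\<close>)
    moreover have "potential a2 (\<lambda>y. b y * f2 y) x < \<infinity>"
      by (rule le_less_trans[OF potential_mult_le]) (use fin in \<open>auto simp: ennreal_mult_less_top\<close>)
    ultimately show "frac_int \<alpha> f1 f2 x \<noteq> None" "frac_int \<alpha> (\<lambda>y. b y * f1 y) f2 x \<noteq> None"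
      "frac_int \<alpha> f1 (\<lambda>y. b y * f2 y) x \<noteq> None" "frac_int \<alpha> (\<lambda>y. b y * f1 y) (\<lambda>y. b y * f2 y) x \<noteq> None"
      unfolding a12[symmetric] using fin by (simp_all add: frac_int_Some[OF an])
  qed
  let ?I = "\<lambda>g1 g2 x. LINT z|(lebesgue \<Otimes>\<^sub>M lebesgue). frac_kernel \<alpha> g1 g2 x z"
  have integral_bound: "w = ?I g1 g2 x \<and> enorm (?I g1 g2 x) \<le> potential a1 g1 x * potential a2 g2 x"
    if "frac_int \<alpha> g1 g2 x = Some w" "potential a1 g1 x < \<infinity>" "potential a2 g2 x < \<infinity>"
      and [measurable]: "g1 \<in> borel_measurable lebesgue" "g2 \<in> borel_measurable lebesgue"
    for g1 g2 :: "real^'n \<Rightarrow> complex" and x w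
    using frac_int_Some[OF an, of g1 g2 x] that by (simp add: a12)
  \<comment> \<open>One flag per variable decides whether the oscillation weight is present there;
    the three commutators are three choices of the flags.\<close>
  let ?w = "\<lambda>e x y. if e then b x - b y else (1::complex)"
  have wm: "(\<lambda>z. ?w e (fst z) (snd z) * f (snd z)) \<in> borel_measurable (lebesgue \<Otimes>\<^sub>M lebesgue)"
    if [measurable]: "f \<in> borel_measurable lebesgue" for f :: "real^'n \<Rightarrow> complex" and e
  proof -
    have [measurable]: "(\<lambda>z. b (fst z)) \<in> borel_measurable (lebesgue \<Otimes>\<^sub>M (lebesgue :: (real^'n) measure))"
      "(\<lambda>z. b (snd z)) \<in> borel_measurable ((lebesgue :: (real^'n) measure) \<Otimes>\<^sub>M lebesgue)" by measurable
    show ?thesis by (cases e) simp_all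
  qed
  have bounded: "bounded_to_Lp p1 p2 q T"
    if rep: "\<And>f1 f2 x w. T f1 f2 x = Some w \<Longrightarrow> frac_int \<alpha> (\<lambda>y. ?w e1 x y * f1 y) (\<lambda>y. ?w e2 x y * f2 y) x = Some w"
      and dom: "\<And>f1 f2 x. frac_int \<alpha> f1 f2 x \<noteq> None \<Longrightarrow> frac_int \<alpha> (\<lambda>y. b y * f1 y) f2 x \<noteq> None \<Longrightarrow>
        frac_int \<alpha> f1 (\<lambda>y. b y * f2 y) x \<noteq> None \<Longrightarrow> frac_int \<alpha> (\<lambda>y. b y * f1 y) (\<lambda>y. b y * f2 y) x \<noteq> None \<Longrightarrow>
        T f1 f2 x \<noteq> None" for T :: "'n bilinear_op" and e1 e2
  proof (rule bounded_to_LpI[OF q q12 qq _ _ C(1)])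
    fix f1 f2 :: "real^'n \<Rightarrow> complex" assume f: "f1 \<in> Lp p1" "f2 \<in> Lp p2"
    then have [measurable]: "f1 \<in> borel_measurable lebesgue" "f2 \<in> borel_measurable lebesgue"
      by (auto simp: Lp_def)
    let ?g = "\<lambda>x. ?I (\<lambda>y. ?w e1 x y * f1 y) (\<lambda>y. ?w e2 x y * f2 y) x"
    obtain J1 H1 where 1: "potential_bounds b C a1 p1 q1 f1 J1 H1" "AE x in lebesgue. J1 x < \<infinity> \<and> H1 x < \<infinity>"
      using mono_C[OF C1(2) C(2) f(1)] by auto
    obtain J2 H2 where 2: "potential_bounds b C a2 p2 q2 f2 J2 H2" "AE x in lebesgue. J2 x < \<infinity> \<and> H2 x < \<infinity>"
      using mono_C[OF C2(2) C(3) f(2)] by auto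
    have "AE x in lebesgue. potential a1 f1 x = J1 x \<and> potential a1 (\<lambda>y. (b x - b y) * f1 y) x = H1 x"
      "AE x in lebesgue. potential a2 f2 x = J2 x \<and> potential a2 (\<lambda>y. (b x - b y) * f2 y) x = H2 x"
      using 1(1) 2(1) unfolding potential_bounds_def by blast+
    with 1(2) 2(2) have ae: "AE x in lebesgue. potential a1 f1 x = J1 x \<and> potential a1 (\<lambda>y. (b x - b y) * f1 y) x = H1 x \<and>
         potential a2 f2 x = J2 x \<and> potential a2 (\<lambda>y. (b x - b y) * f2 y) x = H2 x \<and>
         J1 x < \<infinity> \<and> H1 x < \<infinity> \<and> J2 x < \<infinity> \<and> H2 x < \<infinity>"
      by eventually_elim auto
    define U where "U = (if e1 then H1 else J1)"
    define W where "W = (if e2 then H2 else J2)"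
    have "AE x in lebesgue. T f1 f2 x = Some (?g x) \<and> enorm (?g x) \<le> U x * W x"
      using ae
    proof eventually_elim
      case (elim x)
      then have "T f1 f2 x \<noteq> None"
        by (intro dom defined[OF f]) auto
      then obtain w where w: "T f1 f2 x = Some w" by auto
      have "potential a1 (\<lambda>y. ?w e1 x y * f1 y) x = U x" "potential a2 (\<lambda>y. ?w e2 x y * f2 y) x = W x"
        using elim by (auto simp: U_def W_def)
      moreover have "U x < \<infinity>" "W x < \<infinity>" using elim by (auto simp: U_def W_def)
      moreover have "(\<lambda>y. ?w e x y * f y) \<in> borel_measurable lebesgue"
        if [measurable]: "f \<in> borel_measurable lebesgue" for f and e
        by (cases e) simp_all
      ultimately show ?case using integral_bound[OF rep[OF w]] w by simp
    qed
    moreover have "?g \<in> borel_measurable lebesgue"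
      by (intro frac_kernel_integral_measurable wm) auto
    moreover have "U \<in> borel_measurable borel" "W \<in> borel_measurable borel"
      "pow_integral q1 U \<le> ennreal C * epow (pow_integral p1 (\<lambda>x. enorm (f1 x))) (q1 / p1)"
      "pow_integral q2 W \<le> ennreal C * epow (pow_integral p2 (\<lambda>x. enorm (f2 x))) (q2 / p2)"
      using 1(1) 2(1) unfolding potential_bounds_def by (auto simp: U_def W_def)
    ultimately show "\<exists>U V g. U \<in> borel_measurable borel \<and> V \<in> borel_measurable borel \<and> g \<in> borel_measurable lebesgue \<and>
      (AE x in lebesgue. T f1 f2 x = Some (g x) \<and> enorm (g x) \<le> U x * V x) \<and>
      (pow_integral q1 U) \<le> ennreal C * epow (pow_integral p1 (\<lambda>x. enorm (f1 x))) (q1 / p1) \<and>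
      (pow_integral q2 V) \<le> ennreal C * epow (pow_integral p2 (\<lambda>x. enorm (f2 x))) (q2 / p2)"
      by blast
  qed (use p in auto)
  show "bounded_to_Lp p1 p2 q (commutator1 b (frac_int \<alpha>))"
    by (rule bounded[of _ True False]) (simp add: commutator1_eq_frac_int, auto simp: commutator1_def)
  show "bounded_to_Lp p1 p2 q (commutator2 b (frac_int \<alpha>))"
    by (rule bounded[of _ False True]) (simp add: commutator2_eq_frac_int, auto simp: commutator2_def)
  show "bounded_to_Lp p1 p2 q (iterated_commutator (b, b) (frac_int \<alpha>))"
  proof (rule bounded[of _ True True])
    show "iterated_commutator (b, b) (frac_int \<alpha>) f1 f2 x \<noteq> None"
      if "frac_int \<alpha> f1 f2 x \<noteq> None" "frac_int \<alpha> (\<lambda>y. b y * f1 y) f2 x \<noteq> None"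
        "frac_int \<alpha> f1 (\<lambda>y. b y * f2 y) x \<noteq> None" "frac_int \<alpha> (\<lambda>y. b y * f1 y) (\<lambda>y. b y * f2 y) x \<noteq> None" for f1 f2 x
      using that by (rule iterated_commutator_defined)
  qed (auto dest: iterated_commutator_eq_frac_int)
qed

section \<open>From weak bounds to BMO\<close>

lemma lebesgue_level_set [simp]:
  fixes g :: "'a::euclidean_space \<Rightarrow> complex"
  assumes [measurable]: "g \<in> borel_measurable lebesgue"
  shows "{x. t < norm (g x)} \<in> sets lebesgue"
proof -
  have "{x \<in> space lebesgue. t < norm (g x)} \<in> sets lebesgue" by measurable
  then show ?thesis by simp
qed

lemma Lp_imp_weak_Lp:
  fixes g :: "real^'n \<Rightarrow> complex"
  assumes g: "g \<in> Lp q" and q: "0 < q"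
  shows "g \<in> weak_Lp q" and "weak_Lp_norm q g \<le> Lp_norm q g"
proof -
  have [measurable]: "g \<in> borel_measurable lebesgue" and int: "integrable lebesgue (\<lambda>x. norm (g x) powr q)"
    using g by (auto simp: Lp_def)
  define I where "I = (LINT x|lebesgue. norm (g x) powr q)"
  have I: "0 \<le> I" by (simp add: I_def)
  have le: "ennreal (t powr q) * emeasure lebesgue {x. norm (g x) > t} \<le> ennreal I" if "0 < t" for t
  proof -
    have "ennreal (t powr q) * emeasure lebesgue {x. norm (g x) > t} =
        (\<integral>\<^sup>+x. ennreal (t powr q) * indicator {x. norm (g x) > t} x \<partial>lebesgue)"
      by (intro nn_integral_cmult_indicator[symmetric] lebesgue_level_set) measurable
    also have "\<dots> \<le> (\<integral>\<^sup>+x. ennreal (norm (g x) powr q) \<partial>lebesgue)"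
      using that q by (intro nn_integral_mono) (auto split: split_indicator intro!: ennreal_leI powr_mono2)
    also have "\<dots> = ennreal I"
      using int unfolding I_def by (intro nn_integral_eq_integral) auto
    finally show ?thesis .
  qed
  \<comment> \<open>Finiteness has to come before any bound on \<open>measure\<close>, which is 0 on
    sets of infinite measure.\<close>
  have fin: "emeasure lebesgue {x. norm (g x) > t} < \<infinity>" if "0 < t" for t
  proof (rule ccontr)
    assume "\<not> ?thesis"
    then have "emeasure lebesgue {x. norm (g x) > t} = top" by (simp add: less_top[symmetric])
    with le[OF that] that show False by (simp add: ennreal_mult_top top_unique)
  qed
  have bd: "t * measure lebesgue {x. norm (g x) > t} powr (1 / q) \<le> Lp_norm q g" if "0 < t" for t
  proof -
    define M where "M = measure lebesgue {x. norm (g x) > t}"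
    have "emeasure lebesgue {x. norm (g x) > t} = ennreal M"
      unfolding M_def using fin[OF that] by (intro emeasure_eq_ennreal_measure) auto
    then have "ennreal (t powr q * M) \<le> ennreal I" using le[OF that] by (simp add: ennreal_mult M_def)
    then have "t powr q * M \<le> I" using I by simp
    then have "(t powr q * M) powr (1 / q) \<le> I powr (1 / q)"
      using q by (intro powr_mono2) (auto simp: M_def)
    then show ?thesis
      using q that by (simp add: powr_mult powr_powr M_def I_def Lp_norm_def)
  qed
  show "g \<in> weak_Lp q"
    unfolding weak_Lp_def using fin bd by (auto intro!: bdd_aboveI2)
  show "weak_Lp_norm q g \<le> Lp_norm q g"
    unfolding weak_Lp_norm_def using bd by (intro cSUP_least) auto
qed

lemma bounded_to_Lp_imp_weak:
  fixes T :: "('n::finite) bilinear_op"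
  assumes T: "bounded_to_Lp p1 p2 q T" and q: "0 < q"
  shows "bounded_to_weak_Lp p1 p2 q T"
proof -
  obtain C where C: "\<forall>f1\<in>Lp p1. \<forall>f2\<in>Lp p2. (AE x in lebesgue. T f1 f2 x \<noteq> None) \<and>
      (let g = (\<lambda>x. case T f1 f2 x of None \<Rightarrow> 0 | Some z \<Rightarrow> z) in g \<in> Lp q \<and> Lp_norm q g \<le> C * Lp_norm p1 f1 * Lp_norm p2 f2)"
    using T unfolding bounded_bilinear_op_def by blast
  show ?thesis
    unfolding bounded_bilinear_op_def
  proof (intro exI[of _ C] ballI)
    fix f1 f2 :: "real^'n \<Rightarrow> complex" assume "f1 \<in> Lp p1" "f2 \<in> Lp p2"
    with C have "AE x in lebesgue. T f1 f2 x \<noteq> None"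
      "(\<lambda>x. case T f1 f2 x of None \<Rightarrow> 0 | Some z \<Rightarrow> z) \<in> Lp q"
      "Lp_norm q (\<lambda>x. case T f1 f2 x of None \<Rightarrow> 0 | Some z \<Rightarrow> z) \<le> C * Lp_norm p1 f1 * Lp_norm p2 f2"
      by (auto simp: Let_def)
    then show "(AE x in lebesgue. T f1 f2 x \<noteq> None) \<and>
      (let g = (\<lambda>x. case T f1 f2 x of None \<Rightarrow> 0 | Some z \<Rightarrow> z) in g \<in> weak_Lp q \<and> weak_Lp_norm q g \<le> C * Lp_norm p1 f1 * Lp_norm p2 f2)"
      using Lp_imp_weak_Lp[OF _ q] by (auto simp: Let_def intro: order_trans)
  qed
qed

section \<open>Testing on a cube and evaluating on a distant cube of the same size\<close>

definition cube_test :: "(real^'n) set \<Rightarrow> (real^'n \<Rightarrow> complex) \<Rightarrow> bool" where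
  "cube_test Q f \<longleftrightarrow> f \<in> borel_measurable lebesgue \<and> (\<forall>x. norm (f x) \<le> 2 * indicator Q x)"

lemma cube_test_Lp:
  fixes Q :: "(real^'n) set"
  assumes f: "cube_test Q f" and Q: "Q \<in> sets lebesgue" "emeasure lebesgue Q = ennreal V" "0 < V" and p: "0 < p"
  shows "f \<in> Lp p" and "Lp_norm p f \<le> 2 * V powr (1 / p)"
proof -
  have [measurable]: "f \<in> borel_measurable lebesgue" using f by (simp add: cube_test_def)
  have le: "norm (f x) powr p \<le> 2 powr p * indicator Q x" for x
  proof -
    have "norm (f x) powr p \<le> (2 * indicator Q x) powr p"
      using f p by (intro powr_mono2) (auto simp: cube_test_def)
    then show ?thesis by (auto split: split_indicator_asm)
  qed
  have iQ: "integrable lebesgue (\<lambda>x. 2 powr p * indicator Q x :: real)"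
    using Q by (intro integrable_mult_right integrable_real_indicator) auto
  have int: "integrable lebesgue (\<lambda>x. norm (f x) powr p)"
    by (rule Bochner_Integration.integrable_bound[OF iQ]) (use le in \<open>auto simp: abs_mult\<close>)
  then show "f \<in> Lp p" by (simp add: Lp_def)
  have "(LINT x|lebesgue. norm (f x) powr p) \<le> (LINT x|lebesgue. 2 powr p * indicator Q x)"
    by (intro integral_mono int iQ le)
  also have "\<dots> = 2 powr p * V"
    using Q by (simp add: measure_def)
  finally have "Lp_norm p f \<le> (2 powr p * V) powr (1 / p)"
    unfolding Lp_norm_def using p by (intro powr_mono2) auto
  also have "\<dots> = 2 * V powr (1 / p)" using p Q by (simp add: powr_mult powr_powr)
  finally show "Lp_norm p f \<le> 2 * V powr (1 / p)" .
qed

lemma Lp_norm_nonneg: "0 \<le> Lp_norm p f"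
  by (simp add: Lp_norm_def)

text \<open>Two exceptional sets of a quarter of the measure each leave room for a common good point.\<close>

lemma weak_bound_common_point:
  fixes T :: "('n::finite) bilinear_op"
  assumes T: "bounded_to_weak_Lp p1 p2 q T" and p: "1 < p1" "1 < p2" and q: "0 < q"
    and pq: "1 / q = 1 / p1 + 1 / p2 - \<alpha> / real CARD('n)"
  obtains K where "0 < K" "\<And>Q E l f1 f2 s1 s2. 0 < l \<Longrightarrow>
     Q \<in> sets lebesgue \<Longrightarrow> emeasure lebesgue Q = ennreal (l ^ CARD('n)) \<Longrightarrow>
     E \<in> sets lebesgue \<Longrightarrow> emeasure lebesgue E = ennreal (l ^ CARD('n)) \<Longrightarrow>
     cube_test Q f1 \<Longrightarrow> cube_test Q f2 \<Longrightarrow> cube_test Q s1 \<Longrightarrow> cube_test Q s2 \<Longrightarrow>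
     \<exists>x\<in>E. \<exists>u v. T f1 f2 x = Some u \<and> T s1 s2 x = Some v \<and> norm u \<le> K * l powr \<alpha> \<and> norm v \<le> K * l powr \<alpha>"
proof -
  obtain C0 where C0: "\<forall>f1\<in>Lp p1. \<forall>f2\<in>Lp p2. (AE x in lebesgue. T f1 f2 x \<noteq> None) \<and>
      (let g = (\<lambda>x. case T f1 f2 x of None \<Rightarrow> 0 | Some z \<Rightarrow> z) in g \<in> weak_Lp q \<and> weak_Lp_norm q g \<le> C0 * Lp_norm p1 f1 * Lp_norm p2 f2)"
    using T unfolding bounded_bilinear_op_def by blast
  define C where "C = max C0 1"
  have C: "0 < C" "C0 \<le> C" by (auto simp: C_def)
  \<comment> \<open>The first 4 is the product of the factors 2 in the norms of the two test
    functions; \<open>4 powr (1 / q)\<close> reduces the exceptional set to a quarter of the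
    measure.\<close>
  define K where "K = C * 4 * 4 powr (1 / q)"
  have K: "0 < K" using C by (simp add: K_def)
  have single: "{x. K * l powr \<alpha> < norm (case T f1 f2 x of None \<Rightarrow> 0 | Some z \<Rightarrow> z)} \<in> sets lebesgue \<and>
      emeasure lebesgue {x. K * l powr \<alpha> < norm (case T f1 f2 x of None \<Rightarrow> 0 | Some z \<Rightarrow> z)} \<le> ennreal (l ^ CARD('n) / 4) \<and>
      (AE x in lebesgue. T f1 f2 x \<noteq> None)"
    if l: "0 < l" and Q: "Q \<in> sets lebesgue" "emeasure lebesgue Q = ennreal (l ^ CARD('n))"
      and f: "cube_test Q f1" "cube_test Q f2" for l Q f1 f2
  proof -
    define g where "g = (\<lambda>x. case T f1 f2 x of None \<Rightarrow> 0 | Some z \<Rightarrow> z)"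
    define V where "V = l ^ CARD('n)"
    have V: "0 < V" using l by (simp add: V_def)
    note Q' = Q[folded V_def]
    have p0: "0 < p1" "0 < p2" using p by auto
    note f1 = cube_test_Lp[OF f(1) Q' V p0(1)] and f2 = cube_test_Lp[OF f(2) Q' V p0(2)]
    have g: "AE x in lebesgue. T f1 f2 x \<noteq> None" "g \<in> weak_Lp q" "weak_Lp_norm q g \<le> C0 * Lp_norm p1 f1 * Lp_norm p2 f2"
      using C0 f1(1) f2(1) unfolding g_def Let_def by auto
    have [measurable]: "g \<in> borel_measurable lebesgue" using g(2) by (simp add: weak_Lp_def)
    define t where "t = K * l powr \<alpha>"
    have t: "0 < t" using K l by (simp add: t_def)
    define M where "M = measure lebesgue {x. norm (g x) > t}"
    have "emeasure lebesgue {x. norm (g x) > t} < \<infinity>" using g(2) t by (simp add: weak_Lp_def)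
    then have EM: "emeasure lebesgue {x. norm (g x) > t} = ennreal M"
      unfolding M_def by (intro emeasure_eq_ennreal_measure) auto
    have "t * M powr (1 / q) \<le> weak_Lp_norm q g"
      unfolding weak_Lp_norm_def M_def using g(2) t by (intro cSUP_upper) (auto simp: weak_Lp_def)
    also have "\<dots> \<le> C * Lp_norm p1 f1 * Lp_norm p2 f2"
      using g(3) C by (smt (verit) Lp_norm_nonneg mult_right_mono)
    also have "\<dots> \<le> C * (2 * V powr (1 / p1)) * (2 * V powr (1 / p2))"
      using f1 f2 C by (intro mult_mono) (auto simp: Lp_norm_nonneg)
    also have "\<dots> = C * 4 * (V powr (1 / q) * V powr (\<alpha> / real CARD('n)))"
    proof -
      \<comment> \<open>The power of the volume splits into \<open>V powr (1 / q)\<close>, to be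
        compared with the exceptional set, and \<open>l powr \<alpha>\<close>, the size of the
        threshold.\<close>
      have "1 / p1 + 1 / p2 = 1 / q + \<alpha> / real CARD('n)" using pq by simp
      then have "V powr (1 / p1) * V powr (1 / p2) = V powr (1 / q) * V powr (\<alpha> / real CARD('n))"
        by (simp flip: powr_add)
      then show ?thesis by simp
    qed
    also have "V powr (\<alpha> / real CARD('n)) = l powr \<alpha>"
      using l by (simp add: V_def powr_powr flip: powr_realpow)
    finally have "C * 4 * 4 powr (1 / q) * l powr \<alpha> * M powr (1 / q) \<le> C * 4 * (V powr (1 / q) * l powr \<alpha>)"
      by (simp add: t_def K_def)
    then have "(C * 4 * l powr \<alpha>) * (4 powr (1 / q) * M powr (1 / q)) \<le> (C * 4 * l powr \<alpha>) * V powr (1 / q)"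
      by (simp add: mult_ac)
    then have "4 powr (1 / q) * M powr (1 / q) \<le> V powr (1 / q)"
      using C l by (subst (asm) mult_le_cancel_left_pos) auto
    then have "(4 powr (1 / q) * M powr (1 / q)) powr q \<le> (V powr (1 / q)) powr q"
      using q by (intro powr_mono2) auto
    then have "4 * M \<le> V" using q V by (simp add: powr_mult powr_powr M_def)
    then have "ennreal M \<le> ennreal (V / 4)" by (intro ennreal_leI) simp
    with EM g(1) have "{x. t < norm (g x)} \<in> sets lebesgue \<and>
      emeasure lebesgue {x. t < norm (g x)} \<le> ennreal (V / 4) \<and> (AE x in lebesgue. T f1 f2 x \<noteq> None)"
      by simp
    then show ?thesis unfolding g_def t_def V_def .
  qed
  show thesis
  proof (rule that[OF K])
    fix Q E :: "(real^'n) set" and l :: real and f1 f2 s1 s2 :: "real^'n \<Rightarrow> complex"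
    assume l: "0 < l" and Q: "Q \<in> sets lebesgue" "emeasure lebesgue Q = ennreal (l ^ CARD('n))"
      and E: "E \<in> sets lebesgue" "emeasure lebesgue E = ennreal (l ^ CARD('n))"
      and test: "cube_test Q f1" "cube_test Q f2" "cube_test Q s1" "cube_test Q s2"
    define B where "B f1 f2 = {x. K * l powr \<alpha> < norm (case T f1 f2 x of None \<Rightarrow> 0 | Some z \<Rightarrow> z)}" for f1 f2
    note 1 = single[OF l Q test(1,2), folded B_def] and 2 = single[OF l Q test(3,4), folded B_def]
    have "\<exists>x\<in>E. x \<notin> B f1 f2 \<and> x \<notin> B s1 s2 \<and> T f1 f2 x \<noteq> None \<and> T s1 s2 x \<noteq> None"
    proof (rule ccontr)
      assume neg: "\<not> ?thesis"
      have "AE x in lebesgue. T f1 f2 x \<noteq> None \<and> T s1 s2 x \<noteq> None" using 1 2 by auto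
      then have "AE x in lebesgue. x \<in> E \<longrightarrow> x \<in> B f1 f2 \<union> B s1 s2"
        by eventually_elim (use neg in blast)
      then have "emeasure lebesgue E \<le> emeasure lebesgue (B f1 f2 \<union> B s1 s2)"
        using 1 2 by (intro emeasure_mono_AE) auto
      also have "\<dots> \<le> emeasure lebesgue (B f1 f2) + emeasure lebesgue (B s1 s2)"
        using 1 2 by (intro emeasure_subadditive) auto
      also have "\<dots> \<le> ennreal (l ^ CARD('n) / 4) + ennreal (l ^ CARD('n) / 4)"
        using 1 2 by (intro add_mono) auto
      also have "\<dots> = ennreal (l ^ CARD('n) / 2)"
        using l by (simp flip: ennreal_plus)
      finally show False using E l by simp
    qed
    then show "\<exists>x\<in>E. \<exists>u v. T f1 f2 x = Some u \<and> T s1 s2 x = Some v \<and> norm u \<le> K * l powr \<alpha> \<and> norm v \<le> K * l powr \<alpha>"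
      unfolding B_def by fastforce
  qed
qed

text \<open>For \<open>x\<close> in the cube shifted by \<open>N * l\<close> in every coordinate,
  all distances to points of the cube are \<open>N * l * norm 1\<close> up to
  \<open>CARD('n) * l\<close>. The relative error is thus of order \<open>1 / N\<close> at every
  scale \<open>l\<close>, and continuity of the power at 1 does the rest.\<close>

lemma kernel_almost_constant:
  fixes s \<epsilon> :: real
  assumes \<epsilon>: "0 < \<epsilon>"
  obtains N where "0 < N" "\<And>(a::real^'n) l x y1 y2. 0 < l \<Longrightarrow>
    x \<in> cube (\<chi> i. a $ i + N * l) l \<Longrightarrow>
    y1 \<in> cube a l \<Longrightarrow> y2 \<in> cube a l \<Longrightarrow>
    \<bar>1 / (norm (x - y1) + norm (x - y2)) powr s - (1 / (2 * N * norm (1::real^'n)) powr s) / l powr s\<bar>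
      \<le> \<epsilon> * ((1 / (2 * N * norm (1::real^'n)) powr s) / l powr s)"
proof -
  have "((\<lambda>t. 1 / t powr s) \<longlongrightarrow> 1 / 1 powr s) (at (1::real))"
    by (intro tendsto_intros) auto
  then have "isCont (\<lambda>t. 1 / t powr s) (1::real)" by (simp add: isCont_def)
  then obtain \<delta> where \<delta>: "0 < \<delta>" "\<And>t::real. \<bar>t - 1\<bar> < \<delta> \<Longrightarrow> \<bar>1 / t powr s - 1\<bar> < \<epsilon>"
    unfolding continuous_at_eps_delta using \<epsilon> by (force simp: dist_real_def)
  define n where "n = real CARD('n)"
  define w where "w = norm (1::real^'n)"
  have w: "1 \<le> w" using component_le_norm_cart[of "1::real^'n" undefined] by (simp add: w_def)
  have n: "0 < n" by (simp add: n_def)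
  \<comment> \<open>Makes the relative error \<open>n / (N * w) = \<delta> / (2 * w)\<close>, which
    is below \<open>\<delta>\<close> because \<open>w \<ge> 1\<close>.\<close>
  define N where "N = 2 * n / \<delta>"
  have N: "0 < N" using n \<delta> by (simp add: N_def)
  show thesis
  proof (rule that[OF N])
    fix a x y1 y2 :: "real^'n" and l :: real
    assume l: "0 < l" and x: "x \<in> cube (\<chi> i. a $ i + N * l) l"
      and y: "y1 \<in> cube a l" "y2 \<in> cube a l"
    have near: "\<bar>norm (x - y) - N * l * w\<bar> \<le> n * l" if "y \<in> cube a l" for y
    proof -
      define z where "z = (x - y) - (N * l) *\<^sub>R (1::real^'n)"
      have "\<bar>z $ i\<bar> \<le> l" for i
        using x that unfolding mem_box_cart z_def by (auto simp: abs_le_iff algebra_simps dest!: spec[of _ i])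
      then have "(\<Sum>i\<in>UNIV. \<bar>z $ i\<bar>) \<le> (\<Sum>i\<in>(UNIV::'n set). l)" by (intro sum_mono)
      then have "norm z \<le> n * l" using norm_le_l1_cart[of z] by (simp add: n_def)
      moreover have "norm ((N * l) *\<^sub>R (1::real^'n)) = N * l * w" using N l by (simp add: w_def)
      moreover have "x - y = (N * l) *\<^sub>R (1::real^'n) + z" by (simp add: z_def)
      ultimately show ?thesis
        using norm_triangle_ineq[of "(N * l) *\<^sub>R (1::real^'n)" z] norm_triangle_ineq4[of "x - y" z] by simp
    qed
    define D where "D = 2 * N * w * l"
    have D: "0 < D" using N w l by (simp add: D_def)
    define t where "t = (norm (x - y1) + norm (x - y2)) / D"
    have t0: "0 \<le> t" using D by (simp add: t_def)
    have "\<bar>(norm (x - y1) + norm (x - y2)) - D\<bar> \<le> 2 * n * l"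
    proof -
      have "D = N * l * w + N * l * w" "2 * n * l = n * l + n * l" by (simp_all add: D_def)
      then show ?thesis using near[OF y(1)] near[OF y(2)] by linarith
    qed
    then have "\<bar>t - 1\<bar> \<le> 2 * n * l / D"
      using D by (simp add: t_def field_simps abs_le_iff)
    also have "2 * n * l / D = \<delta> / (2 * w)"
      using \<delta> n l w by (simp add: D_def N_def)
    also have "\<dots> < \<delta>" using \<delta> w by (simp add: divide_less_eq)
    finally have td: "\<bar>1 / t powr s - 1\<bar> < \<epsilon>" by (rule \<delta>(2))
    have "norm (x - y1) + norm (x - y2) = t * D" using D by (simp add: t_def)
    then have "1 / (norm (x - y1) + norm (x - y2)) powr s = (1 / t powr s) * (1 / D powr s)"
      using t0 D by (simp add: powr_mult)
    then have "1 / (norm (x - y1) + norm (x - y2)) powr s - 1 / D powr s = (1 / t powr s - 1) * (1 / D powr s)"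
      by (simp only: left_diff_distrib mult_1)
    then have "\<bar>1 / (norm (x - y1) + norm (x - y2)) powr s - 1 / D powr s\<bar> = \<bar>1 / t powr s - 1\<bar> * \<bar>1 / D powr s\<bar>"
      by (simp only: abs_mult)
    also have "\<bar>1 / D powr s\<bar> = 1 / D powr s" by simp
    also have "\<bar>1 / t powr s - 1\<bar> * (1 / D powr s) \<le> \<epsilon> * (1 / D powr s)" using td by (intro mult_right_mono) auto
    finally have "\<bar>1 / (norm (x - y1) + norm (x - y2)) powr s - 1 / D powr s\<bar> \<le> \<epsilon> * (1 / D powr s)" .
    moreover have "1 / D powr s = (1 / (2 * N * norm (1::real^'n)) powr s) / l powr s"
      using N w l by (simp add: D_def w_def[symmetric] powr_mult)
    ultimately show "\<bar>1 / (norm (x - y1) + norm (x - y2)) powr s - (1 / (2 * N * norm (1::real^'n)) powr s) / l powr s\<bar>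
      \<le> \<epsilon> * ((1 / (2 * N * norm (1::real^'n)) powr s) / l powr s)" by simp
  qed
qed

text \<open>With the kernel replaced by the constant \<open>k\<close>, the double integral
  factorises into two single integrals; the error is controlled by the product of the absolute
  integrals.\<close>

lemma frac_int_approx:
  fixes g1 g2 :: "real^'n \<Rightarrow> complex"
  assumes g: "integrable lebesgue g1" "integrable lebesgue g2"
    and supp: "\<And>y. y \<notin> Q \<Longrightarrow> g1 y = 0" "\<And>y. y \<notin> Q \<Longrightarrow> g2 y = 0"
    and near: "\<And>y1 y2. y1 \<in> Q \<Longrightarrow> y2 \<in> Q \<Longrightarrow>
      \<bar>1 / (norm (x - y1) + norm (x - y2)) powr (2 * real CARD('n) - \<alpha>) - k\<bar> \<le> \<epsilon> * k"
    and u: "frac_int \<alpha> g1 g2 x = Some u" and k: "0 \<le> k" "0 \<le> \<epsilon>"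
  shows "norm (u - complex_of_real k * ((LINT y|lebesgue. g1 y) * (LINT y|lebesgue. g2 y))) \<le>
    \<epsilon> * k * ((LINT y|lebesgue. norm (g1 y)) * (LINT y|lebesgue. norm (g2 y)))"
proof -
  let ?P = "lebesgue \<Otimes>\<^sub>M lebesgue :: ((real^'n) \<times> (real^'n)) measure"
  have prod: "integrable ?P (\<lambda>z. h1 (fst z) * h2 (snd z))"
    "(LINT z|?P. h1 (fst z) * h2 (snd z)) = (LINT y|lebesgue. h1 y) * (LINT y|lebesgue. h2 y)"
    if [simp]: "integrable lebesgue h1" "integrable lebesgue h2"
    for h1 h2 :: "real^'n \<Rightarrow> 'b::{real_normed_field, banach, second_countable_topology}"
  proof -
    have [measurable]: "h1 \<in> borel_measurable lebesgue" "h2 \<in> borel_measurable lebesgue"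
      by (intro borel_measurable_integrable that)+
    show int: "integrable ?P (\<lambda>z. h1 (fst z) * h2 (snd z))"
    proof (rule lebesgue_pair.Fubini_integrable)
      show "(\<lambda>z. h1 (fst z) * h2 (snd z)) \<in> borel_measurable ?P" by measurable
      show "integrable lebesgue (\<lambda>x. LINT y|lebesgue. norm (h1 (fst (x, y)) * h2 (snd (x, y))))"
        by (simp add: norm_mult)
      show "AE x in lebesgue. integrable lebesgue (\<lambda>y. h1 (fst (x, y)) * h2 (snd (x, y)))"
        by simp
    qed
    have "(LINT z|?P. h1 (fst z) * h2 (snd z)) = (LINT x|lebesgue. LINT y|lebesgue. h1 x * h2 y)"
      using lebesgue_pair.integral_fst'[OF int] by simp
    then show "(LINT z|?P. h1 (fst z) * h2 (snd z)) = (LINT y|lebesgue. h1 y) * (LINT y|lebesgue. h2 y)"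
      by simp
  qed
  have int: "integrable ?P (frac_kernel \<alpha> g1 g2 x)" and u': "u = (LINT z|?P. frac_kernel \<alpha> g1 g2 x z)"
    using u by (auto simp: frac_int_def split: if_splits)
  have intk: "integrable ?P (\<lambda>z. complex_of_real k * (g1 (fst z) * g2 (snd z)))"
    using prod(1)[OF g] by simp
  have intn: "integrable ?P (\<lambda>z. \<epsilon> * k * (norm (g1 (fst z)) * norm (g2 (snd z))))"
    using prod(1)[OF integrable_norm[OF g(1)] integrable_norm[OF g(2)]] by simp
  have "u - complex_of_real k * ((LINT y|lebesgue. g1 y) * (LINT y|lebesgue. g2 y)) =
    (LINT z|?P. frac_kernel \<alpha> g1 g2 x z - complex_of_real k * (g1 (fst z) * g2 (snd z)))"
    using int intk by (simp add: u' prod(2)[OF g])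
  then have "norm (u - complex_of_real k * ((LINT y|lebesgue. g1 y) * (LINT y|lebesgue. g2 y))) \<le>
    (LINT z|?P. norm (frac_kernel \<alpha> g1 g2 x z - complex_of_real k * (g1 (fst z) * g2 (snd z))))"
    by simp
  also have "\<dots> \<le> (LINT z|?P. \<epsilon> * k * (norm (g1 (fst z)) * norm (g2 (snd z))))"
  proof (rule integral_mono)
    fix z :: "(real^'n) \<times> (real^'n)"
    obtain y1 y2 where z: "z = (y1, y2)" by (cases z)
    define c where "c = 1 / (norm (x - y1) + norm (x - y2)) powr (2 * real CARD('n) - \<alpha>)"
    have "frac_kernel \<alpha> g1 g2 x z - complex_of_real k * (g1 (fst z) * g2 (snd z)) = complex_of_real (c - k) * (g1 y1 * g2 y2)"
      by (simp add: frac_kernel_def z c_def algebra_simps)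
    then have eq: "norm (frac_kernel \<alpha> g1 g2 x z - complex_of_real k * (g1 (fst z) * g2 (snd z))) = \<bar>c - k\<bar> * (norm (g1 y1) * norm (g2 y2))"
      by (simp only: norm_mult norm_of_real)
    show "norm (frac_kernel \<alpha> g1 g2 x z - complex_of_real k * (g1 (fst z) * g2 (snd z))) \<le> \<epsilon> * k * (norm (g1 (fst z)) * norm (g2 (snd z)))"
    proof (cases "y1 \<in> Q \<and> y2 \<in> Q")
      case True
      then show ?thesis unfolding eq using near[of y1 y2] by (simp add: z c_def mult_right_mono)
    next
      case False
      then show ?thesis unfolding eq using supp by (auto simp: z)
    qed
  qed (use int intk intn in auto)
  also have "\<dots> = \<epsilon> * k * ((LINT y|lebesgue. norm (g1 y)) * (LINT y|lebesgue. norm (g2 y)))"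
    using prod(2)[OF integrable_norm[OF g(1)] integrable_norm[OF g(2)]] by simp
  finally show ?thesis .
qed

lemma BMO_I:
  fixes b :: "real^'n \<Rightarrow> complex"
  assumes "locally_integrable b"
    and "\<And>a l. 0 < l \<Longrightarrow> cube_mean (cube a l) (\<lambda>x. norm (b x - cube_mean (cube a l) b)) \<le> B"
  shows "b \<in> BMO"
  using assms by (auto simp: BMO_def cubes_def bdd_above_def)

lemma cnj_borel_measurable [measurable]: "cnj \<in> borel_measurable borel"
  by (intro borel_measurable_continuous_onI continuous_intros)

text \<open>\<open>f\<close> is the indicator of \<open>Q\<close>, and \<open>s\<close> is the
  conjugate phase of \<open>b - m\<close> on \<open>Q\<close> minus its mean. All integrals are
  written as multiples of the volume \<open>V\<close>, and \<open>c\<close> is kept free because it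
  will be the value of \<open>b\<close> at a point chosen only afterwards.\<close>

lemma cube_test_functions:
  fixes b :: "real^'n \<Rightarrow> complex" and a :: "real^'n"
  assumes li: "locally_integrable b" and l: "0 < l"
  defines "Q \<equiv> cube a l"
  defines "m \<equiv> cube_mean Q b"
  defines "V \<equiv> l ^ CARD('n)"
  defines "R \<equiv> cube_mean Q (\<lambda>y. norm (b y - m))"
  obtains f s where "cube_test Q f" "cube_test Q s" "0 \<le> R"
    "\<And>y. y \<notin> Q \<Longrightarrow> f y = 0" "\<And>y. y \<notin> Q \<Longrightarrow> s y = 0"
    "integrable lebesgue f" "(LINT y|lebesgue. f y) = complex_of_real V * 1" "(LINT y|lebesgue. norm (f y)) \<le> V * 1"
    "\<And>c. integrable lebesgue (\<lambda>y. (c - b y) * f y)"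
    "\<And>c. (LINT y|lebesgue. (c - b y) * f y) = complex_of_real V * (c - m)"
    "\<And>c. (LINT y|lebesgue. norm ((c - b y) * f y)) \<le> V * (norm (c - m) + R)"
    "\<And>c. integrable lebesgue (\<lambda>y. (c - b y) * s y)"
    "\<And>c. (LINT y|lebesgue. (c - b y) * s y) = complex_of_real V * - complex_of_real R"
    "\<And>c. (LINT y|lebesgue. norm ((c - b y) * s y)) \<le> V * (2 * (norm (c - m) + R))"
proof -
  have V: "0 < V" using l by (simp add: V_def)
  have Q: "Q \<in> sets lebesgue" "measure lebesgue Q = V" "emeasure lebesgue Q = ennreal V" "compact Q"
    unfolding Q_def V_def using cube_measure[OF l, of a] by auto
  have [measurable]: "Q \<in> sets lebesgue" by (rule Q)
  have bm [measurable]: "b \<in> borel_measurable lebesgue" by (rule locally_integrable_measurable[OF li])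
  let ?i = "indicator Q :: real^'n \<Rightarrow> complex"
  have nind: "norm (?i y) = indicator Q y" for y by (auto split: split_indicator)
  have iQ: "integrable lebesgue (indicator Q :: real^'n \<Rightarrow> real)" "(LINT y|lebesgue. indicator Q y :: real) = V"
    using Q by (auto intro: integrable_real_indicator)
  have iQc: "integrable lebesgue ?i" "(LINT y|lebesgue. ?i y) = complex_of_real V"
  proof -
    have eq: "?i = (\<lambda>y. complex_of_real (indicator Q y))" by (auto split: split_indicator simp: fun_eq_iff)
    show "integrable lebesgue ?i" unfolding eq using iQ(1) by simp
    show "(LINT y|lebesgue. ?i y) = complex_of_real V" unfolding eq using iQ by simp
  qed
  have ib: "integrable lebesgue (\<lambda>y. ?i y * b y)"
  proof -
    have "integrable lebesgue (\<lambda>y. indicator Q y *\<^sub>R b y)"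
      using li Q by (simp add: locally_integrable_def set_integrable_def)
    moreover have "(\<lambda>y. indicator Q y *\<^sub>R b y) = (\<lambda>y. ?i y * b y)" by (auto split: split_indicator simp: fun_eq_iff)
    ultimately show ?thesis by simp
  qed
  have Lb: "(LINT y|lebesgue. ?i y * b y) = complex_of_real V * m"
  proof -
    have "(\<lambda>y. indicator Q y *\<^sub>R b y) = (\<lambda>y. ?i y * b y)" by (auto split: split_indicator simp: fun_eq_iff)
    then show ?thesis
      using V Q by (simp add: m_def cube_mean_def set_lebesgue_integral_def scaleR_conv_of_real)
  qed
  have ibc: "integrable lebesgue (\<lambda>y. ?i y * (b y - m))"
    using ib iQc(1) by (simp add: right_diff_distrib)
  have Lbc: "(LINT y|lebesgue. ?i y * (b y - m)) = 0"
    using ib iQc Lb by (simp add: right_diff_distrib)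
  have in_b: "integrable lebesgue (\<lambda>y. indicator Q y * norm (b y - m))"
    using integrable_norm[OF ibc] by (simp add: norm_mult nind)
  have Ln: "(LINT y|lebesgue. indicator Q y * norm (b y - m)) = V * R"
    using V Q by (simp add: R_def cube_mean_def set_lebesgue_integral_def)
  have R: "0 \<le> R"
  proof -
    have "0 \<le> (LINT y|lebesgue. indicator Q y * norm (b y - m))" by (intro integral_nonneg_AE) auto
    then show ?thesis using V by (simp add: Ln zero_le_mult_iff)
  qed
  \<comment> \<open>Where \<open>b y = m\<close> the quotient is 0 by the convention for division by
    zero, and the product with \<open>b y - m\<close> is still the norm.\<close>
  define \<sigma> where "\<sigma> y = cnj (b y - m) / complex_of_real (norm (b y - m))" for y
  have [measurable]: "\<sigma> \<in> borel_measurable lebesgue" unfolding \<sigma>_def by measurable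
  have \<sigma>1: "norm (\<sigma> y) \<le> 1" for y
    by (simp only: \<sigma>_def norm_divide complex_mod_cnj norm_of_real abs_norm_cancel) (simp add: divide_self_if)
  have \<sigma>b: "(b y - m) * \<sigma> y = complex_of_real (norm (b y - m))" for y
  proof -
    have "(b y - m) * \<sigma> y = complex_of_real ((norm (b y - m))\<^sup>2) / complex_of_real (norm (b y - m))"
      by (simp only: \<sigma>_def complex_norm_square times_divide_eq_right)
    also have "\<dots> = complex_of_real ((norm (b y - m))\<^sup>2 / norm (b y - m))"
      by (simp only: of_real_divide)
    also have "(norm (b y - m))\<^sup>2 / norm (b y - m) = norm (b y - m)"
      by (simp add: power2_eq_square)
    finally show ?thesis .
  qed
  have i\<sigma>: "integrable lebesgue (\<lambda>y. ?i y * \<sigma> y)"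
    by (rule Bochner_Integration.integrable_bound[OF iQ(1)])
       (use \<sigma>1 in \<open>auto simp: norm_mult nind intro: mult_left_le split: split_indicator\<close>)
  \<comment> \<open>Removing the mean makes the integral of \<open>s\<close> vanish, so that the
    constant \<open>c\<close> drops out. The pairing with \<open>b - m\<close> is unaffected, since
    \<open>b - m\<close> has mean zero on \<open>Q\<close>.\<close>
  define \<sigma>m where "\<sigma>m = (LINT y|lebesgue. ?i y * \<sigma> y) / complex_of_real V"
  have \<sigma>m1: "norm \<sigma>m \<le> 1"
  proof -
    have "norm (LINT y|lebesgue. ?i y * \<sigma> y) \<le> (LINT y|lebesgue. norm (?i y * \<sigma> y))"
      by simp
    also have "\<dots> \<le> (LINT y|lebesgue. indicator Q y)"
      using \<sigma>1 by (intro integral_mono integrable_norm i\<sigma> iQ) (auto simp: norm_mult nind split: split_indicator)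
    finally show ?thesis using V Q by (simp add: \<sigma>m_def norm_divide)
  qed
  define s where "s y = ?i y * (\<sigma> y - \<sigma>m)" for y
  have sm: "s \<in> borel_measurable lebesgue" unfolding s_def by measurable
  \<comment> \<open>Phase and mean are each bounded by 1; this is the origin of the factor 2 in
    \<open>cube_test\<close>.\<close>
  have s2: "norm (s y) \<le> 2 * indicator Q y" for y
    using norm_triangle_ineq4[of "\<sigma> y" \<sigma>m] \<sigma>1[of y] \<sigma>m1 by (auto simp: s_def norm_mult nind split: split_indicator)
  have int_sgn: "integrable lebesgue s"
    unfolding s_def[abs_def] using i\<sigma> iQc by (simp add: right_diff_distrib)
  have Ls: "(LINT y|lebesgue. s y) = 0"
    unfolding s_def using i\<sigma> iQc V by (simp add: right_diff_distrib \<sigma>m_def)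
  have bs: "(\<lambda>y. (b y - m) * s y) = (\<lambda>y. complex_of_real (indicator Q y * norm (b y - m)) - \<sigma>m * (?i y * (b y - m)))"
  proof
    fix y
    have "(b y - m) * s y = ?i y * ((b y - m) * \<sigma> y) - \<sigma>m * (?i y * (b y - m))"
      by (simp add: s_def algebra_simps)
    then show "(b y - m) * s y = complex_of_real (indicator Q y * norm (b y - m)) - \<sigma>m * (?i y * (b y - m))"
      unfolding \<sigma>b by (auto split: split_indicator)
  qed
  have ibs: "integrable lebesgue (\<lambda>y. (b y - m) * s y)"
    unfolding bs by (intro Bochner_Integration.integrable_diff integrable_mult_right integrable_of_real in_b ibc)
  have Lbs: "(LINT y|lebesgue. (b y - m) * s y) = complex_of_real (V * R)"
  proof -
    have "(LINT y|lebesgue. (b y - m) * s y) =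
       (LINT y|lebesgue. complex_of_real (indicator Q y * norm (b y - m))) - (LINT y|lebesgue. \<sigma>m * (?i y * (b y - m)))"
      unfolding bs by (intro Bochner_Integration.integral_diff integrable_mult_right integrable_of_real in_b ibc)
    also have "(LINT y|lebesgue. complex_of_real (indicator Q y * norm (b y - m))) = complex_of_real (V * R)"
      unfolding Ln[symmetric] by (rule integral_complex_of_real)
    also have "(LINT y|lebesgue. \<sigma>m * (?i y * (b y - m))) = 0"
      using ibc by (simp add: Lbc)
    finally show ?thesis by simp
  qed
  have split_f: "(\<lambda>y. (c - b y) * ?i y) = (\<lambda>y. (c - m) * ?i y - ?i y * (b y - m))" for c
    by (auto simp: algebra_simps)
  have split_s: "(\<lambda>y. (c - b y) * s y) = (\<lambda>y. (c - m) * s y - (b y - m) * s y)" for c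
    by (auto simp: algebra_simps)
  have int_f: "integrable lebesgue (\<lambda>y. (c - b y) * ?i y)" for c
    unfolding split_f using iQc ibc by (intro Bochner_Integration.integrable_diff integrable_mult_right)
  have int_s: "integrable lebesgue (\<lambda>y. (c - b y) * s y)" for c
    unfolding split_s using int_sgn ibs by (intro Bochner_Integration.integrable_diff integrable_mult_right)
  have norm_le: "(LINT y|lebesgue. norm ((c - b y) * h y)) \<le> M * V * (norm (c - m) + R)"
    if int: "integrable lebesgue (\<lambda>y. (c - b y) * h y)" and h: "\<And>y. norm (h y) \<le> M * indicator Q y" and M: "0 \<le> M"
    for c h M
  proof -
    have "(LINT y|lebesgue. norm ((c - b y) * h y)) \<le>
        (LINT y|lebesgue. M * (norm (c - m) * indicator Q y + indicator Q y * norm (b y - m)))"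
    proof (rule integral_mono)
      show "integrable lebesgue (\<lambda>y. norm ((c - b y) * h y))" using int by (rule integrable_norm)
      show "integrable lebesgue (\<lambda>y. M * (norm (c - m) * indicator Q y + indicator Q y * norm (b y - m)))"
        using iQ in_b by (intro integrable_mult_right Bochner_Integration.integrable_add)
      fix y
      have "norm (c - b y) \<le> norm (c - m) + norm (b y - m)"
        using norm_triangle_ineq4[of "c - m" "b y - m"] by simp
      then have "norm (c - b y) * norm (h y) \<le> (norm (c - m) + norm (b y - m)) * (M * indicator Q y)"
        using h by (intro mult_mono) auto
      also have "\<dots> = M * (norm (c - m) * indicator Q y + indicator Q y * norm (b y - m))"
        by (simp add: algebra_simps)
      finally show "norm ((c - b y) * h y) \<le> \<dots>"
        unfolding norm_mult .
    qed
    also have "\<dots> = M * (norm (c - m) * V + V * R)"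
      using iQ in_b Ln by simp
    finally show ?thesis by (simp add: algebra_simps)
  qed
  show thesis
  proof (rule that[of ?i s])
    show "cube_test Q ?i" "cube_test Q s"
      using sm s2 by (auto simp: cube_test_def nind)
    show "(LINT y|lebesgue. norm (?i y)) \<le> V * 1" by (simp add: nind Q)
    show "(LINT y|lebesgue. (c - b y) * ?i y) = complex_of_real V * (c - m)" for c
      unfolding split_f using iQc ibc Lbc by (simp add: mult.commute)
    show "(LINT y|lebesgue. (c - b y) * s y) = complex_of_real V * - complex_of_real R" for c
      unfolding split_s using int_sgn ibs Ls Lbs by simp
    show "(LINT y|lebesgue. norm ((c - b y) * ?i y)) \<le> V * (norm (c - m) + R)" for c
      using norm_le[OF int_f, of 1] by (simp add: nind)
    show "(LINT y|lebesgue. norm ((c - b y) * s y)) \<le> V * (2 * (norm (c - m) + R))" for c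
      using norm_le[OF int_s s2] by (simp add: mult_ac)
  qed (use R iQc int_f int_s in \<open>auto simp: s_def\<close>)
qed

text \<open>On a cube far away from \<open>Q\<close> the kernel is almost equal to a constant \<open>k\<close>, whose size matches the
  bound for the operator.\<close>

definition far_cube_bound :: "('n::finite) bilinear_op \<Rightarrow> real \<Rightarrow> real \<Rightarrow> real \<Rightarrow> real^'n \<Rightarrow> real \<Rightarrow>
    (real^'n \<Rightarrow> complex) \<times> (real^'n \<Rightarrow> complex) \<Rightarrow> (real^'n \<Rightarrow> complex) \<times> (real^'n \<Rightarrow> complex) \<Rightarrow>
    real^'n \<Rightarrow> complex \<Rightarrow> complex \<Rightarrow> real \<Rightarrow> bool" where
  "far_cube_bound T \<alpha> e A a l = (\<lambda>(f1, f2) (s1, s2) x u v k.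
     T f1 f2 x = Some u \<and> T s1 s2 x = Some v \<and> 0 < k \<and>
     norm u \<le> k * (l ^ CARD('n) * l ^ CARD('n)) * A \<and> norm v \<le> k * (l ^ CARD('n) * l ^ CARD('n)) * A \<and>
     (\<forall>y1\<in>cube a l. \<forall>y2\<in>cube a l.
        \<bar>1 / (norm (x - y1) + norm (x - y2)) powr (2 * real CARD('n) - \<alpha>) - k\<bar> \<le> e * k))"

lemma weak_bound_far_cube:
  fixes T :: "('n::finite) bilinear_op"
  assumes T: "bounded_to_weak_Lp p1 p2 q T" and p: "1 < p1" "1 < p2" and q: "0 < q"
    and pq: "1 / q = 1 / p1 + 1 / p2 - \<alpha> / real CARD('n)" and e: "0 < e"
  obtains A where "0 < A" "\<And>a l f1 f2 s1 s2. 0 < l \<Longrightarrow> \<forall>f\<in>{f1, f2, s1, s2}. cube_test (cube a l) f \<Longrightarrow>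
     \<exists>x u v k. far_cube_bound T \<alpha> e A a l (f1, f2) (s1, s2) x u v k"
proof -
  define d where "d = 2 * real CARD('n) - \<alpha>"
  obtain K where K: "0 < K" "\<And>Q E l f1 f2 s1 s2. 0 < l \<Longrightarrow>
     Q \<in> sets lebesgue \<Longrightarrow> emeasure lebesgue Q = ennreal (l ^ CARD('n)) \<Longrightarrow>
     E \<in> sets lebesgue \<Longrightarrow> emeasure lebesgue E = ennreal (l ^ CARD('n)) \<Longrightarrow>
     cube_test Q f1 \<Longrightarrow> cube_test Q f2 \<Longrightarrow> cube_test Q s1 \<Longrightarrow> cube_test Q s2 \<Longrightarrow>
     \<exists>x\<in>E. \<exists>u v. T f1 f2 x = Some u \<and> T s1 s2 x = Some v \<and> norm u \<le> K * l powr \<alpha> \<and> norm v \<le> K * l powr \<alpha>"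
    using weak_bound_common_point[OF T p q pq] by blast
  obtain N where N: "0 < N" "\<And>(a::real^'n) l x y1 y2. 0 < l \<Longrightarrow>
    x \<in> cube (\<chi> i. a $ i + N * l) l \<Longrightarrow>
    y1 \<in> cube a l \<Longrightarrow> y2 \<in> cube a l \<Longrightarrow>
    \<bar>1 / (norm (x - y1) + norm (x - y2)) powr d - (1 / (2 * N * norm (1::real^'n)) powr d) / l powr d\<bar>
      \<le> e * ((1 / (2 * N * norm (1::real^'n)) powr d) / l powr d)"
    using kernel_almost_constant[OF e, of d] by auto
  define \<kappa> where "\<kappa> = 1 / (2 * N * norm (1::real^'n)) powr d"
  have "0 < norm (1::real^'n)" by (simp add: vec_eq_iff)
  then have \<kappa>: "0 < \<kappa>" using N(1) by (simp add: \<kappa>_def)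
  show thesis
  proof (rule that)
    show "0 < K / \<kappa>" using K(1) \<kappa> by simp
    fix a :: "real^'n" and l :: real and f1 f2 s1 s2 :: "real^'n \<Rightarrow> complex"
    define Q where "Q = cube a l"
    define E where "E = cube (\<chi> i. a $ i + N * l) l"
    define V where "V = l ^ CARD('n)"
    assume l: "0 < l" and "\<forall>f\<in>{f1, f2, s1, s2}. cube_test (cube a l) f"
    then have test: "cube_test Q f1" "cube_test Q f2" "cube_test Q s1" "cube_test Q s2" by (simp_all add: Q_def)
    have "emeasure lebesgue Q = ennreal (l ^ CARD('n))" "emeasure lebesgue E = ennreal (l ^ CARD('n))"
      unfolding Q_def E_def by (rule cube_measure(2)[OF l])+
    then obtain x u v where x: "x \<in> E" and uv: "T f1 f2 x = Some u" "T s1 s2 x = Some v"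
      "norm u \<le> K * l powr \<alpha>" "norm v \<le> K * l powr \<alpha>"
      using K(2)[OF l, of Q E f1 f2 s1 s2] test by (auto simp: Q_def E_def)
    \<comment> \<open>The kernel scales like \<open>l powr (\<alpha> - 2 * n)\<close>; multiplied by
      the two volumes it becomes a multiple of \<open>l powr \<alpha>\<close>, the size of the
      operator bound, so \<open>A\<close> does not depend on the cube.\<close>
    define k where "k = \<kappa> / l powr d"
    have k: "0 < k" using \<kappa> l by (simp add: k_def)
    have "V = l powr real CARD('n)" using l by (simp add: V_def powr_realpow)
    then have "V * V = l powr (real CARD('n) + real CARD('n))" by (simp only: powr_add)
    also have "real CARD('n) + real CARD('n) = d + \<alpha>" by (simp add: d_def)
    finally have "k * (V * V) = \<kappa> * l powr \<alpha>" using l by (simp add: k_def powr_add)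
    then have KA: "k * (V * V) * (K / \<kappa>) = K * l powr \<alpha>" using \<kappa> by simp
    have near: "\<bar>1 / (norm (x - y1) + norm (x - y2)) powr (2 * real CARD('n) - \<alpha>) - k\<bar> \<le> e * k" if "y1 \<in> Q" "y2 \<in> Q" for y1 y2
      using N(2)[OF l x[unfolded E_def] that[unfolded Q_def]] by (simp only: k_def \<kappa>_def d_def)
    show "\<exists>x u v k. far_cube_bound T \<alpha> e (K / \<kappa>) a l (f1, f2) (s1, s2) x u v k"
      using uv k near unfolding far_cube_bound_def V_def[symmetric] Q_def[symmetric] KA[symmetric] split by blast
  qed
qed

text \<open>The main term of the almost constant kernel is \<open>k * (V * V)\<close> times
  \<open>z1 * z2\<close>. Dividing by \<open>k * (V * V)\<close> leaves an inequality between
  normalised integrals without reference to the size of the cube.\<close>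

lemma far_cube_estimate:
  fixes g1 g2 :: "real^'n \<Rightarrow> complex"
  assumes g: "integrable lebesgue g1" "integrable lebesgue g2"
    and supp: "\<And>y. y \<notin> Q \<Longrightarrow> g1 y = 0" "\<And>y. y \<notin> Q \<Longrightarrow> g2 y = 0"
    and near: "\<forall>y1\<in>Q. \<forall>y2\<in>Q. \<bar>1 / (norm (x - y1) + norm (x - y2)) powr (2 * real CARD('n) - \<alpha>) - k\<bar> \<le> e * k"
    and u: "frac_int \<alpha> g1 g2 x = Some u" "norm u \<le> k * (V * V) * A" and k: "0 < k" "0 < V" "0 \<le> e"
    and z: "(LINT y|lebesgue. g1 y) = complex_of_real V * z1" "(LINT y|lebesgue. g2 y) = complex_of_real V * z2"
    and w: "(LINT y|lebesgue. norm (g1 y)) \<le> V * w1" "(LINT y|lebesgue. norm (g2 y)) \<le> V * w2"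
  shows "norm z1 * norm z2 \<le> A + e * (w1 * w2)"
proof -
  let ?z = "complex_of_real k * ((complex_of_real V * z1) * (complex_of_real V * z2))"
  have "0 \<le> V * w1" using w(1) by (rule order_trans[rotated]) (simp add: integral_nonneg_AE)
  have "norm (u - ?z) \<le> e * k * ((LINT y|lebesgue. norm (g1 y)) * (LINT y|lebesgue. norm (g2 y)))"
    unfolding z[symmetric] using g supp near u k by (intro frac_int_approx[where Q=Q and x=x and \<alpha>=\<alpha>]) auto
  also have "\<dots> \<le> e * k * ((V * w1) * (V * w2))"
    using k w \<open>0 \<le> V * w1\<close> by (intro mult_left_mono mult_mono) (auto intro: integral_nonneg_AE)
  finally have "norm ?z \<le> k * (V * V) * A + e * k * ((V * w1) * (V * w2))"
    using u(2) norm_triangle_sub[of ?z u] by (simp add: norm_minus_commute)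
  moreover have "norm ?z = k * (V * V) * (norm z1 * norm z2)"
    using k by (simp only: norm_mult norm_of_real) simp
  ultimately have "k * (V * V) * (norm z1 * norm z2) \<le> k * (V * V) * (A + e * (w1 * w2))"
    by (simp add: algebra_simps)
  moreover have "0 < k * (V * V)" using k by simp
  ultimately show ?thesis by (simp only: mult_le_cancel_left_pos)
qed

text \<open>Testing on the indicator \<open>f\<close> of \<open>Q\<close> measures \<open>D = \<bar>b x - m\<bar>\<close>, and testing on the mean-zero
  function \<open>s\<close> measures the mean oscillation \<open>R\<close> of \<open>b\<close> on \<open>Q\<close>; the errors are small multiples of
  both quantities (squared for the iterated commutator) and are absorbed, since \<open>D\<close> and \<open>R\<close> are finite.\<close>

lemma weak_bound_imp_BMO:
  fixes b :: "real^'n \<Rightarrow> complex" and T :: "'n bilinear_op" and iterated :: bool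
  assumes li: "locally_integrable b" and p: "1 < p1" "1 < p2" and q: "0 < q"
    and pq: "1 / q = 1 / p1 + 1 / p2 - \<alpha> / real CARD('n)"
    and T: "bounded_to_weak_Lp p1 p2 q T"
    and rep: "\<And>f1 f2 x w. T f1 f2 x = Some w \<Longrightarrow>
      frac_int \<alpha> (\<lambda>y. (b x - b y) * f1 y) (\<lambda>y. (if iterated then b x - b y else 1) * f2 y) x = Some w"
  shows "b \<in> BMO"
proof -
  \<comment> \<open>Small enough for absorption in both cases. With
    \<open>t = (D + R) * (D + R)\<close> the iterated commutator gives
    \<open>t \<le> 4 * A + 10 * e * t\<close>, and \<open>10 * e = 1 / 2\<close>; the single
    commutator gives \<open>D + R \<le> 2 * A + 3 * e * (D + R)\<close>.\<close>
  define e :: real where "e = 1 / 20"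
  have e: "0 < e" by (simp add: e_def)
  obtain A where A: "0 < A" "\<And>a l f1 f2 s1 s2. 0 < l \<Longrightarrow> \<forall>f\<in>{f1, f2, s1, s2}. cube_test (cube a l) f \<Longrightarrow>
     \<exists>x u v k. far_cube_bound T \<alpha> e A a l (f1, f2) (s1, s2) x u v k"
    by (rule weak_bound_far_cube[OF T p q pq e]) (rule that)
  show ?thesis
  proof (rule BMO_I[OF li])
    fix a :: "real^'n" and l :: real
    assume l: "0 < l"
    define Q where "Q = cube a l"
    define m where "m = cube_mean Q b"
    define V where "V = l ^ CARD('n)"
    define R where "R = cube_mean Q (\<lambda>y. norm (b y - m))"
    have V: "0 < V" using l by (simp add: V_def)
    obtain f s where test: "cube_test Q f" "cube_test Q s" and R: "0 \<le> R"
      and supp: "\<And>y. y \<notin> Q \<Longrightarrow> f y = 0" "\<And>y. y \<notin> Q \<Longrightarrow> s y = 0"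
      and f: "integrable lebesgue f" "(LINT y|lebesgue. f y) = complex_of_real V * 1" "(LINT y|lebesgue. norm (f y)) \<le> V * 1"
      and bf: "\<And>c. integrable lebesgue (\<lambda>y. (c - b y) * f y)"
        "\<And>c. (LINT y|lebesgue. (c - b y) * f y) = complex_of_real V * (c - m)"
        "\<And>c. (LINT y|lebesgue. norm ((c - b y) * f y)) \<le> V * (norm (c - m) + R)"
      and bs: "\<And>c. integrable lebesgue (\<lambda>y. (c - b y) * s y)"
        "\<And>c. (LINT y|lebesgue. (c - b y) * s y) = complex_of_real V * - complex_of_real R"
        "\<And>c. (LINT y|lebesgue. norm ((c - b y) * s y)) \<le> V * (2 * (norm (c - m) + R))"
      by (rule cube_test_functions[OF li l, of a, folded Q_def, folded m_def V_def, folded R_def]) (rule that)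
    \<comment> \<open>Without a weight in the second variable the partner of \<open>s\<close> is
      \<open>f\<close>, whose integral is \<open>V\<close>; the mean-zero \<open>s\<close> would
      make the main term vanish. With a weight there, using \<open>s\<close> twice gives
      \<open>R * R\<close>.\<close>
    have "\<forall>h\<in>{f, f, s, if iterated then s else f}. cube_test (cube a l) h"
      using test by (auto simp: Q_def)
    from A(2)[OF l this] obtain x u v k where u: "T f f x = Some u" "norm u \<le> k * (V * V) * A"
      and v: "T s (if iterated then s else f) x = Some v" "norm v \<le> k * (V * V) * A" and k: "0 < k"
      and near: "\<forall>y1\<in>Q. \<forall>y2\<in>Q. \<bar>1 / (norm (x - y1) + norm (x - y2)) powr (2 * real CARD('n) - \<alpha>) - k\<bar> \<le> e * k"
      unfolding far_cube_bound_def V_def Q_def split by blast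
    define D where "D = norm (b x - m)"
    have D: "0 \<le> D" by (simp add: D_def)
    note pos = k V less_imp_le[OF e]
    \<comment> \<open>One bound for both cases: the single commutator yields
      \<open>R \<le> 4 * A\<close>, the iterated one \<open>R * R \<le> 4 * A\<close>.\<close>
    have "R \<le> 4 * A + sqrt (4 * A)"
    proof (cases iterated)
      case True
      have 1: "D * D \<le> A + e * ((D + R) * (D + R))"
        using far_cube_estimate[OF bf(1) bf(1) _ _ near _ u(2) pos bf(2) bf(2) bf(3) bf(3)] rep[OF u(1)] supp True
        by (simp add: D_def)
      have 2: "R * R \<le> A + e * ((2 * (D + R)) * (2 * (D + R)))"
        using far_cube_estimate[OF bs(1) bs(1) _ _ near _ v(2) pos bs(2) bs(2) bs(3) bs(3)] rep[OF v(1)] supp R True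
        by (simp add: D_def)
      have "(D + R) * (D + R) \<le> 2 * (D * D + R * R)"
        using zero_le_square[of "D - R"] by (simp add: algebra_simps)
      moreover have "r \<le> 4 * A" if "t \<le> 2 * (d + r)" "d \<le> A + e * t" "r \<le> A + 4 * e * t" for r d t :: real
        using that A(1) unfolding e_def by argo
      moreover have "R * R \<le> A + 4 * e * ((D + R) * (D + R))" using 2 by (simp add: algebra_simps)
      ultimately have "R * R \<le> 4 * A" using 1 by blast
      then have "R \<le> sqrt (4 * A)" by (intro real_le_rsqrt) (simp add: power2_eq_square)
      then show ?thesis using A(1) by simp
    next
      case False
      have 1: "D \<le> A + e * (D + R)"
        using far_cube_estimate[OF bf(1) f(1) _ supp(1) near _ u(2) pos bf(2) f(2) bf(3) f(3)] rep[OF u(1)] supp False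
        by (simp add: D_def)
      have 2: "R \<le> A + 2 * e * (D + R)"
        using far_cube_estimate[OF bs(1) f(1) _ supp(1) near _ v(2) pos bs(2) f(2) bs(3) f(3)] rep[OF v(1)] supp R False
        by (simp add: D_def algebra_simps)
      from 1 2 A(1) D have "R \<le> 4 * A" unfolding e_def by argo
      then show ?thesis using A(1) by (simp add: add_increasing2)
    qed
    then show "cube_mean (cube a l) (\<lambda>x. norm (b x - cube_mean (cube a l) b)) \<le> 4 * A + sqrt (4 * A)"
      by (simp add: R_def m_def Q_def)
  qed
qed

theorem mainTheorem5:
  fixes b :: "real^'n \<Rightarrow> complex" and \<alpha> p1 p2 q :: real
  assumes "locally_integrable b"
    and "0 < \<alpha>" and "\<alpha> < 2 * real CARD('n)"
    and "1 < p1" and "1 < p2" and "0 < q"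
    and "1 / q = 1 / p1 + 1 / p2 - \<alpha> / real CARD('n)"
  shows
    "(b \<in> BMO \<longleftrightarrow>
        bounded_to_Lp p1 p2 q (commutator1 b (frac_int \<alpha>)) \<and>
        bounded_to_Lp p1 p2 q (commutator2 b (frac_int \<alpha>))) \<and>
     (b \<in> BMO \<longleftrightarrow>
        bounded_to_weak_Lp p1 p2 q (commutator1 b (frac_int \<alpha>)) \<and>
        bounded_to_weak_Lp p1 p2 q (commutator2 b (frac_int \<alpha>))) \<and>
     (b \<in> BMO \<longleftrightarrow>
        bounded_to_Lp p1 p2 q (iterated_commutator (b, b) (frac_int \<alpha>))) \<and>
     (b \<in> BMO \<longleftrightarrow>
        bounded_to_weak_Lp p1 p2 q (iterated_commutator (b, b) (frac_int \<alpha>)))"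
proof -
  note strong = BMO_imp_bounded_to_Lp[OF _ assms(2,4-7)]
  note weak = bounded_to_Lp_imp_weak[OF _ assms(6)]
  have necessary1: "b \<in> BMO" if "bounded_to_weak_Lp p1 p2 q (commutator1 b (frac_int \<alpha>))"
    by (rule weak_bound_imp_BMO[OF assms(1,4-7) that, where iterated=False]) (simp add: commutator1_eq_frac_int)
  have necessary2: "b \<in> BMO" if "bounded_to_weak_Lp p1 p2 q (iterated_commutator (b, b) (frac_int \<alpha>))"
    by (rule weak_bound_imp_BMO[OF assms(1,4-7) that, where iterated=True]) (simp add: iterated_commutator_eq_frac_int)
  show ?thesis using strong weak necessary1 necessary2 by blast
qed

end
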